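(* (Strong comparison principle) Let $p\in(1,\infty)$ and let $(\mathcal{E}_p,\mathcal{F}_p)$ be the canonical $p$-resistance form on the Sierpiński gasket $K$. Let $U\subsetneq K$ be a connected open subset of $K$ and let $u,v\in\mathcal{H}_{\mathcal{E}_p,K\setminus U}$ satisfy $u(x)\le v(x)$ for any $x\in\partial_K U$. Then either $u(x)<v(x)$ for any $x\in U$, or $u(x)=v(x)$ for any $x\in\overline{U}^K$.
   Context: $\overline{U}^K$ and $\partial_KU$ are the closure and boundary of $U$ in $K$. $\|x\|_{\ell^s}=(\sum_k|x_k|^s)^{1/s}$ for $s\in(0,\infty)$, $\|x\|_{\ell^\infty}=\max_k|x_k|$; $\mathbf 1_X$ is the constant function $1$ on $X$; $\sup\emptyset:=0$. $p$-resistance forms. A $p$-resistance form on a non-empty set $X$ is a pair $(\mathcal{E},\mathcal{F})$ of a linear subspace $\mathcal{F}\subset\mathbb{R}^X$ and $\mathcal{E}:\mathcal{F}\to[0,\infty)$ such that: (RF1) $\mathcal{E}^{1/p}$ is a seminorm and $\{\mathcal{E}=0\}=\mathbb{R}\mathbf 1_X$; (RF2) $(\mathcal{F}/\mathbb{R}\mathbf 1_X,\mathcal{E}^{1/p})$ is a Banach space; (RF3) $\mathcal{F}$ separates points of $X$; (RF4) $\sup\{|u(x)-u(y)|^p/\mathcal{E}(u)\mid u\in\mathcal{F}\setminus\mathbb{R}\mathbf 1_X\}<\infty$ for all $x,y\in X$; (RF5) if $q\in(0,p]$, $r\in[p,\infty]$, $m,n\in\mathbb{N}$ and $T:\mathbb{R}^m\to\mathbb{R}^n$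 satisfies $T(0)=0$ and $\|T(x)-T(y)\|_{\ell^r}\le\|x-y\|_{\ell^q}$ for all $x,y$, then for $u\in\mathcal{F}^m$, $T(u)\in\mathcal{F}^n$ and $\|(\mathcal{E}(T_k(u))^{1/p})_k\|_{\ell^r}\le\|(\mathcal{E}(u_j)^{1/p})_j\|_{\ell^q}$. On a finite set $X$ one necessarily has $\mathcal{F}=\mathbb{R}^X$ and only $\mathcal{E}$ is mentioned. Trace: for $\emptyset\neq B\subset X$ and $u\in\mathcal{F}|_B$, $\mathcal{E}|_B(u):=\inf\{\mathcal{E}(v)\mid v\in\mathcal{F},v|_B=u\}$. For $B\subset X$, $\mathcal{H}_{\mathcal{E},B}$ is the set of $h\in\mathcal{F}$ that are $\mathcal{E}$-harmonic on $X\setminus B$, i.e. $\mathcal{E}(h)=\inf\{\mathcal{E}(u)\mid u\in\mathcal{F},u|_B=h|_B\}$. Sierpiński gasket. $S=\{1,2,3\}$; $V_0=\{q_1,q_2,q_3\}\subset\mathbb{R}^2$ is the vertex set of an equilateral triangle; $f_i(x)=q_i+\frac12(x-q_i)$; $K$ is the unique non-empty compact subset of $\mathbb{R}^2$ with $K=\bigcup_{i\in S}f_i(K)$, with the Euclidean metric; $F_i:=f_i|_K$. $W_n=S^n$ ($W_0=\{\emptyset\}$), $F_w=F_{w_1}\circ\cdots\circ F_{w_n}$ ($F_\emptyset=\mathrm{id}_K$), $V_n=\bigcup_{w\in W_n}F_w(V_0)$. $\mathcal{G}_{\mathrm{sym}}$ is the isometry group of $K$. Canonical form. For a $p$-resistance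 form $\mathcal{E}$ on $V_0$, $\rho>0$, $n\ge0$, put $\mathcal{R}_{\rho,n}(\mathcal{E})(u)=\sum_{w\in W_n}\rho^n\mathcal{E}(u\circ F_w|_{V_0})$, $u\in\mathbb{R}^{V_n}$. There is a unique $\rho_p\in(0,\infty)$ for which some $p$-resistance form $\mathcal{E}$ on $V_0$ satisfies $\mathcal{R}_{\rho_p,1}(\mathcal{E})|_{V_0}=\mathcal{E}$; fix such a form $\mathcal{E}_p^{(0)}$ that is also $\mathcal{G}_{\mathrm{sym}}$-invariant ($\mathcal{E}_p^{(0)}(u\circ g|_{V_0})=\mathcal{E}_p^{(0)}(u)$ for $g\in\mathcal{G}_{\mathrm{sym}}$), which exists. Put $\mathcal{E}_p^{(n)}=\mathcal{R}_{\rho_p,n}(\mathcal{E}_p^{(0)})$; for $u\in C(K)$ the sequence $\mathcal{E}_p^{(n)}(u|_{V_n})$ is non-decreasing in $n$. Define $\mathcal{F}_p=\{u\in C(K)\mid\lim_n\mathcal{E}_p^{(n)}(u|_{V_n})<\infty\}$ and $\mathcal{E}_p(u)=\lim_n\mathcal{E}_p^{(n)}(u|_{V_n})$. Then $(\mathcal{E}_p,\mathcal{F}_p)$ is a $p$-resistance form on $K$, called the canonical $p$-resistance form; it satisfies $\mathcal{E}_p|_{V_n}=\mathcal{E}_p^{(n)}$ and $\mathcal{E}_p(u)=\sum_{i\in S}\rho_p\mathcal{E}_p(u\circ F_i)$. *)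

theory Defs
  imports "HOL-Analysis.Analysis"
begin

text \<open>A real function on a subset \<open>X\<close> of a type is encoded as a total function vanishing outside
  \<open>X\<close>; \<open>funs X\<close> is the space of all functions on \<open>X\<close>. The Euclidean space of dimension \<open>n\<close> is
  \<open>funs {..<n}\<close>. Restrictions to \<open>B\<close> are extended by zero.\<close>

definition funs :: "'a set \<Rightarrow> ('a \<Rightarrow> real) set" where
  "funs X = {u. \<forall>x. x \<notin> X \<longrightarrow> u x = 0}"

definition restr :: "'a set \<Rightarrow> ('a \<Rightarrow> real) \<Rightarrow> 'a \<Rightarrow> real" where
  "restr B u = (\<lambda>x. if x \<in> B then u x else 0)"

definition const_funs :: "'a set \<Rightarrow> ('a \<Rightarrow> real) set" where
  "const_funs X = {restr X (\<lambda>_. c) | c. True}"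

definition lnorm :: "ereal \<Rightarrow> nat \<Rightarrow> (nat \<Rightarrow> real) \<Rightarrow> real" where
  "lnorm s n x =
    (if s = \<infinity> then Max ((\<lambda>k. \<bar>x k\<bar>) ` {..<n})
     else (\<Sum>k<n. \<bar>x k\<bar> powr real_of_ereal s) powr (1 / real_of_ereal s))"

definition fun_subspace :: "'a set \<Rightarrow> ('a \<Rightarrow> real) set \<Rightarrow> bool" where
  "fun_subspace X F \<longleftrightarrow>
    F \<subseteq> funs X \<and> (\<lambda>_. 0) \<in> F \<and>
    (\<forall>u\<in>F. \<forall>v\<in>F. (\<lambda>x. u x + v x) \<in> F) \<and>
    (\<forall>c. \<forall>u\<in>F. (\<lambda>x. c * u x) \<in> F)"

definition RF1 :: "real \<Rightarrow> 'a set \<Rightarrow> ('a \<Rightarrow> real) set \<Rightarrow> (('a \<Rightarrow> real) \<Rightarrow> real) \<Rightarrow> bool" where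
  "RF1 p X F E \<longleftrightarrow>
    (\<forall>u\<in>F. \<forall>v\<in>F. E (\<lambda>x. u x + v x) powr (1 / p) \<le> E u powr (1 / p) + E v powr (1 / p)) \<and>
    (\<forall>c. \<forall>u\<in>F. E (\<lambda>x. c * u x) powr (1 / p) = \<bar>c\<bar> * E u powr (1 / p)) \<and>
    {u \<in> F. E u = 0} = const_funs X"

text \<open>In the presence of \<open>RF1\<close>, the seminorm induces a norm on the quotient by the constants;
  convergence and the Cauchy property of a sequence of classes are those of any sequence of
  representatives, so that the following is completeness of the quotient.\<close>

definition RF2 :: "real \<Rightarrow> ('a \<Rightarrow> real) set \<Rightarrow> (('a \<Rightarrow> real) \<Rightarrow> real) \<Rightarrow> bool" where
  "RF2 p F E \<longleftrightarrow>
    (\<forall>s :: nat \<Rightarrow> 'a \<Rightarrow> real.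
      (\<forall>n. s n \<in> F) \<and>
      (\<forall>e>0. \<exists>N. \<forall>m\<ge>N. \<forall>n\<ge>N. E (\<lambda>x. s m x - s n x) powr (1 / p) < e) \<longrightarrow>
      (\<exists>u\<in>F. (\<lambda>n. E (\<lambda>x. s n x - u x) powr (1 / p)) \<longlonglongrightarrow> 0))"

definition RF3 :: "'a set \<Rightarrow> ('a \<Rightarrow> real) set \<Rightarrow> bool" where
  "RF3 X F \<longleftrightarrow> (\<forall>x\<in>X. \<forall>y\<in>X. x \<noteq> y \<longrightarrow> (\<exists>u\<in>F. u x \<noteq> u y))"

definition RF4 :: "real \<Rightarrow> 'a set \<Rightarrow> ('a \<Rightarrow> real) set \<Rightarrow> (('a \<Rightarrow> real) \<Rightarrow> real) \<Rightarrow> bool" where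
  "RF4 p X F E \<longleftrightarrow>
    (\<forall>x\<in>X. \<forall>y\<in>X. bdd_above {\<bar>u x - u y\<bar> powr p / E u | u. u \<in> F - const_funs X})"

definition compose_tuple ::
    "((nat \<Rightarrow> real) \<Rightarrow> nat \<Rightarrow> real) \<Rightarrow> nat \<Rightarrow> (nat \<Rightarrow> 'a \<Rightarrow> real) \<Rightarrow> nat \<Rightarrow> 'a \<Rightarrow> real" where
  "compose_tuple T m u k = (\<lambda>x. T (restr {..<m} (\<lambda>j. u j x)) k)"

definition RF5 :: "real \<Rightarrow> ('a \<Rightarrow> real) set \<Rightarrow> (('a \<Rightarrow> real) \<Rightarrow> real) \<Rightarrow> bool" where
  "RF5 p F E \<longleftrightarrow>
    (\<forall>(q::real) (r::ereal) (m::nat) (n::nat) (T :: (nat \<Rightarrow> real) \<Rightarrow> nat \<Rightarrow> real).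
      0 < q \<and> q \<le> p \<and> ereal p \<le> r \<and> 1 \<le> m \<and> 1 \<le> n \<and>
      T \<in> funs {..<m} \<rightarrow> funs {..<n} \<and> T (\<lambda>_. 0) = (\<lambda>_. 0) \<and>
      (\<forall>x \<in> funs {..<m}. \<forall>y \<in> funs {..<m}.
        lnorm r n (\<lambda>k. T x k - T y k) \<le> lnorm (ereal q) m (\<lambda>j. x j - y j)) \<longrightarrow>
      (\<forall>u. (\<forall>j<m. u j \<in> F) \<longrightarrow>
        (\<forall>k<n. compose_tuple T m u k \<in> F) \<and>
        lnorm r n (\<lambda>k. E (compose_tuple T m u k) powr (1 / p))
          \<le> lnorm (ereal q) m (\<lambda>j. E (u j) powr (1 / p))))"

definition p_resistance_form ::
    "real \<Rightarrow> 'a set \<Rightarrow> ('a \<Rightarrow> real) set \<Rightarrow> (('a \<Rightarrow> real) \<Rightarrow> real) \<Rightarrow> bool" where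
  "p_resistance_form p X F E \<longleftrightarrow>
    X \<noteq> {} \<and> fun_subspace X F \<and> (\<forall>u\<in>F. 0 \<le> E u) \<and>
    RF1 p X F E \<and> RF2 p F E \<and> RF3 X F \<and> RF4 p X F E \<and> RF5 p F E"

definition form_trace ::
    "('a \<Rightarrow> real) set \<Rightarrow> (('a \<Rightarrow> real) \<Rightarrow> real) \<Rightarrow> 'a set \<Rightarrow> ('a \<Rightarrow> real) \<Rightarrow> real" where
  "form_trace F E B u = Inf {E v | v. v \<in> F \<and> restr B v = u}"

definition harmonic_off ::
    "('a \<Rightarrow> real) set \<Rightarrow> (('a \<Rightarrow> real) \<Rightarrow> real) \<Rightarrow> 'a set \<Rightarrow> ('a \<Rightarrow> real) set" where
  "harmonic_off F E B = {h \<in> F. E h = Inf {E u | u. u \<in> F \<and> restr B u = restr B h}}"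

abbreviation letters :: "nat set" where
  "letters \<equiv> {1, 2, 3}"

definition equilateral :: "(nat \<Rightarrow> real^2) \<Rightarrow> bool" where
  "equilateral q \<longleftrightarrow>
    0 < dist (q 1) (q 2) \<and> dist (q 1) (q 2) = dist (q 2) (q 3) \<and> dist (q 2) (q 3) = dist (q 3) (q 1)"

definition contr :: "(nat \<Rightarrow> real^2) \<Rightarrow> nat \<Rightarrow> real^2 \<Rightarrow> real^2" where
  "contr q i x = q i + (1 / 2) *\<^sub>R (x - q i)"

definition is_gasket :: "(nat \<Rightarrow> real^2) \<Rightarrow> (real^2) set \<Rightarrow> bool" where
  "is_gasket q K \<longleftrightarrow> K \<noteq> {} \<and> compact K \<and> K = (\<Union>i\<in>letters. contr q i ` K)"

definition words :: "nat \<Rightarrow> nat list set" where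
  "words n = {w. set w \<subseteq> letters \<and> length w = n}"

definition contr_word :: "(nat \<Rightarrow> real^2) \<Rightarrow> nat list \<Rightarrow> real^2 \<Rightarrow> real^2" where
  "contr_word q w = foldr (\<lambda>i g. contr q i \<circ> g) w id"

definition vertices :: "(nat \<Rightarrow> real^2) \<Rightarrow> nat \<Rightarrow> (real^2) set" where
  "vertices q n = (\<Union>w\<in>words n. contr_word q w ` (q ` letters))"

definition isometries :: "'a::metric_space set \<Rightarrow> ('a \<Rightarrow> 'a) set" where
  "isometries K = {g. g ` K = K \<and> (\<forall>x\<in>K. \<forall>y\<in>K. dist (g x) (g y) = dist x y)}"

definition renorm ::
    "(nat \<Rightarrow> real^2) \<Rightarrow> real \<Rightarrow> nat \<Rightarrow> ((real^2 \<Rightarrow> real) \<Rightarrow> real) \<Rightarrow> (real^2 \<Rightarrow> real) \<Rightarrow> real" where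
  "renorm q \<rho> n E u = (\<Sum>w\<in>words n. \<rho> ^ n * E (restr (q ` letters) (u \<circ> contr_word q w)))"

definition renorm_fixed ::
    "(nat \<Rightarrow> real^2) \<Rightarrow> real \<Rightarrow> ((real^2 \<Rightarrow> real) \<Rightarrow> real) \<Rightarrow> bool" where
  "renorm_fixed q \<rho> E \<longleftrightarrow>
    (\<forall>u \<in> funs (q ` letters). form_trace (funs (vertices q 1)) (renorm q \<rho> 1 E) (q ` letters) u = E u)"

definition sym_invariant ::
    "(nat \<Rightarrow> real^2) \<Rightarrow> (real^2) set \<Rightarrow> ((real^2 \<Rightarrow> real) \<Rightarrow> real) \<Rightarrow> bool" where
  "sym_invariant q K E \<longleftrightarrow>
    (\<forall>g \<in> isometries K. \<forall>u \<in> funs (q ` letters). E (restr (q ` letters) (u \<circ> g)) = E u)"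

definition level_energy ::
    "(nat \<Rightarrow> real^2) \<Rightarrow> real \<Rightarrow> ((real^2 \<Rightarrow> real) \<Rightarrow> real) \<Rightarrow> (real^2 \<Rightarrow> real) \<Rightarrow> nat \<Rightarrow> real" where
  "level_energy q \<rho> E0 u n = renorm q \<rho> n E0 (restr (vertices q n) u)"

text \<open>The level energies are non-decreasing in the level, so having a finite limit is the same as
  being a convergent real sequence.\<close>

definition canonical_domain ::
    "(nat \<Rightarrow> real^2) \<Rightarrow> (real^2) set \<Rightarrow> real \<Rightarrow> ((real^2 \<Rightarrow> real) \<Rightarrow> real) \<Rightarrow> (real^2 \<Rightarrow> real) set" where
  "canonical_domain q K \<rho> E0 =
    {u \<in> funs K. continuous_on K u \<and> convergent (level_energy q \<rho> E0 u)}"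

definition canonical_energy ::
    "(nat \<Rightarrow> real^2) \<Rightarrow> real \<Rightarrow> ((real^2 \<Rightarrow> real) \<Rightarrow> real) \<Rightarrow> (real^2 \<Rightarrow> real) \<Rightarrow> real" where
  "canonical_energy q \<rho> E0 u = lim (level_energy q \<rho> E0 u)"

end

theory Submission
  imports Defs
begin

text \<open>The contraction property of the form on the three outer vertices yields submodularity, a
  two-point smoothness inequality (hence directional differentiability) and a quantitative strict
  convexity; the first and the last are inherited by the energies of all levels. The key point is discrete: if
  \<open>f \<le> g\<close> on the triangle, \<open>f i = g i\<close>, and the derivatives in direction of vertex \<open>i\<close> agree, then
  \<open>f = g\<close>. Indeed, for ordered energy minimizing extensions to the first level, strict convexity
  forces a second contact point in cell \<open>i\<close>; at a midpoint the fluxes of the two adjacent cells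
  balance, so that contact and equality of fluxes propagate through all three cells. The same fact
  gives \<open>\<rho> > 1\<close>, so that harmonic extensions converge uniformly on the gasket and can be used as test
  functions. For two harmonic functions \<open>u \<le> v\<close> on \<open>U\<close>, weak comparison on a small cell containing a
  contact point produces a contact at a corner of that cell, and flux balance at this corner
  spreads the contact to all corners, hence to the cell. So the contact set is open.\<close>

section \<open>Elementary inequalities for powers\<close>

text \<open>The difference of two harmonic functions is in general not harmonic, so a maximum
  principle or a Harnack inequality cannot be applied to \<open>v - u\<close>. The flux
  \<open>D f (unit_at i)\<close>, which is monotone under ordered contact, takes their place. The
  inequalities come from RF5 for maps of the plane, with exponents \<open>(q, r)\<close> equal to
  \<open>(p, p)\<close>, \<open>(min p 2, p)\<close> and \<open>(p, 2 * p)\<close>. The exponent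
  \<open>2 * p\<close> makes strict convexity an inequality between squares, that is, between
  Euclidean norms in the plane. Such inequalities add up over cells with the same constant and
  survive the limit of the levels, where a bare strict inequality would degenerate to \<le>.
  Differentiability is never passed to the limit: a test function is made harmonic inside the cells
  that meet the perturbed vertex, so that only finite sums of \<open>E\<close> are differentiated.
  Such test functions exist because minimal extensions converge uniformly, which rests on \<rho> >
  1; this is why the discrete comparison has to precede all constructions on
  \<open>K\<close>.\<close>

lemma powr_ge_tangent_one:
  fixes x r :: real
  assumes "1 \<le> r" "0 \<le> x"
  shows "1 + r * (x - 1) \<le> x powr r"
proof (cases "x = 0")
  case False
  have "(x powr r) powr (1/r) * 1 powr (1 - 1/r) \<le> (1/r) * x powr r + (1 - 1/r) * 1"
    using assms False by (intro Youngs_inequality_0) auto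
  then have "x \<le> x powr r / r + 1 - 1 / r"
    using assms False by (simp add: powr_powr)
  then have "x * r \<le> (x powr r / r + 1 - 1 / r) * r"
    using assms by (intro mult_right_mono) auto
  also have "\<dots> = x powr r + r - 1" using assms by (simp add: field_simps)
  finally show ?thesis by (simp add: algebra_simps)
qed (use assms in auto)

lemma powr_le_tangent_one:
  fixes x r :: real
  assumes "0 \<le> r" "r \<le> 1" "0 \<le> x"
  shows "x powr r \<le> 1 + r * (x - 1)"
proof (cases "x = 0")
  case False
  have "x powr r * 1 powr (1 - r) \<le> r * x + (1 - r) * 1"
    using assms False by (intro Youngs_inequality_0) auto
  then show ?thesis by (simp add: algebra_simps)
qed (use assms in auto)

text \<open>Bernoulli's inequality, itself a case of the weighted arithmetic-geometric mean
  inequality, at the ratio \<open>y / x\<close>, made homogeneous.\<close>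

lemma powr_ge_tangent:
  fixes x y p :: real
  assumes "1 \<le> p" "0 < x" "0 \<le> y"
  shows "x powr p + p * x powr (p - 1) * (y - x) \<le> y powr p"
proof -
  have "x powr p * (1 + p * (y / x - 1)) \<le> x powr p * (y / x) powr p"
    using assms by (intro mult_left_mono powr_ge_tangent_one) auto
  also have "x powr p * (y / x) powr p = y powr p"
    using assms by (simp add: powr_divide)
  finally show ?thesis
    using assms by (simp add: field_simps powr_diff)
qed

text \<open>In the application the exponent is \<open>p - 1\<close>, which may lie on either side of
  1. The constant dominates both what concavity yields for \<open>r \<le> 1\<close>, namely
  \<open>r + 1\<close>, and what convexity yields otherwise, namely
  \<open>r * 2 powr r + r\<close>.\<close>

lemma powr_diff_upper:
  fixes r s :: real
  assumes "0 < r" "0 \<le> s" "s \<le> 1"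
  shows "(1 + s) powr r - (1 - s) powr r \<le> (r * 2 powr r + r + 1) * s"
proof (cases "r \<le> 1")
  case True
  have "(1 + s) powr r \<le> 1 + r * s" using powr_le_tangent_one[of r "1 + s"] assms True by simp
  moreover have "(1 - s) powr r \<ge> 1 - s"
    using powr_mono'[of r 1 "1 - s"] assms True by (cases "s = 1") auto
  moreover have "0 \<le> r * 2 powr r * s" using assms by simp
  ultimately show ?thesis by (simp add: algebra_simps)
next
  case False
  have "1 - r * s \<le> (1 - s) powr r" using powr_ge_tangent_one[of r "1 - s"] assms False by simp
  moreover have "(1 + s) powr r \<le> 1 + r * s * (1 + s) powr (r - 1)"
    using powr_ge_tangent[of r "1 + s" 1] assms False by (simp add: algebra_simps)
  moreover have "r * s * (1 + s) powr (r - 1) \<le> r * s * 2 powr r"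
  proof (intro mult_left_mono)
    have "(1 + s) powr (r - 1) \<le> 2 powr (r - 1)" using assms False by (intro powr_mono2) auto
    also have "\<dots> \<le> 2 powr r" by (intro powr_mono) auto
    finally show "(1 + s) powr (r - 1) \<le> 2 powr r" .
  qed (use assms in auto)
  moreover have "(r * 2 powr r + r + 1) * s = r * s * 2 powr r + r * s + s"
    by (simp add: algebra_simps)
  ultimately show ?thesis using assms(2) by linarith
qed

lemma powr_diff_lower:
  fixes r s :: real
  assumes "0 < r" "0 \<le> s" "s \<le> 1"
  shows "min 1 r * s \<le> (1 + s) powr r - (1 - s) powr r"
proof (cases "r \<le> 1")
  case True
  have "1 \<le> (1 + s) powr r" using assms by (intro ge_one_powr_ge_zero) auto
  moreover have "(1 - s) powr r \<le> 1 - r * s"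
    using powr_le_tangent_one[of r "1 - s"] assms True by simp
  ultimately show ?thesis using True by simp
next
  case False
  have "1 + s \<le> (1 + s) powr r"
    using powr_mono[of 1 r "1 + s"] assms False by simp
  moreover have "(1 - s) powr r \<le> 1 - s"
    using powr_mono'[of 1 r "1 - s"] assms False by (cases "s = 1") auto
  ultimately show ?thesis using False assms by simp
qed

text \<open>The tangents at \<open>1 + s\<close> and \<open>1 - s\<close>, evaluated at 1, leave a
  difference of powers with exponent \<open>p - 1\<close>, which is linear in
  \<open>s\<close>.\<close>

lemma powr_pair_upper:
  fixes p s :: real
  assumes "1 < p" "0 \<le> s" "s \<le> 1"
  shows "(1 + s) powr p + (1 - s) powr p \<le> 2 * (1 + p * ((p - 1) * 2 powr (p - 1) + p) * s\<^sup>2)"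
proof -
  have a: "(1 + s) powr p \<le> 1 + p * s * (1 + s) powr (p - 1)"
    using powr_ge_tangent[of p "1 + s" 1] assms by (simp add: algebra_simps)
  have b: "(1 - s) powr p \<le> 1 - p * s * (1 - s) powr (p - 1)"
  proof (cases "s = 1")
    case False
    then show ?thesis using powr_ge_tangent[of p "1 - s" 1] assms by (simp add: algebra_simps)
  qed (use assms in auto)
  have "p * s * ((1 + s) powr (p - 1) - (1 - s) powr (p - 1))
      \<le> p * s * (((p - 1) * 2 powr (p - 1) + (p - 1) + 1) * s)"
    using assms by (intro mult_left_mono powr_diff_upper) auto
  moreover have "0 \<le> p * s * (((p - 1) * 2 powr (p - 1) + (p - 1) + 1) * s)"
    using assms by auto
  ultimately show ?thesis using a b
    by (simp add: algebra_simps power2_eq_square)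
qed

text \<open>Tangents at 1 alone would lose the quadratic term. Passing through
  \<open>1 + s/2\<close> and \<open>1 - s/2\<close> keeps the difference of the two slopes, which is
  of order \<open>s\<close>; the two halves and the factor 2 in front account for 1/8.\<close>

lemma powr_pair_lower:
  fixes p s :: real
  assumes "1 < p" "0 \<le> s" "s \<le> 1"
  shows "2 * (1 + p * min 1 (p - 1) / 8 * s\<^sup>2) \<le> (1 + s) powr p + (1 - s) powr p"
proof -
  have "(1 + s/2) powr p + p * (1 + s/2) powr (p - 1) * (s/2) \<le> (1 + s) powr p"
    using powr_ge_tangent[of p "1 + s/2" "1 + s"] assms by simp
  moreover have "(1 - s/2) powr p - p * (1 - s/2) powr (p - 1) * (s/2) \<le> (1 - s) powr p"
    using powr_ge_tangent[of p "1 - s/2" "1 - s"] assms by (simp add: algebra_simps)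
  moreover have "1 + p * (s/2) \<le> (1 + s/2) powr p"
    using powr_ge_tangent_one[of p "1 + s/2"] assms by simp
  moreover have "1 - p * (s/2) \<le> (1 - s/2) powr p"
    using powr_ge_tangent_one[of p "1 - s/2"] assms by simp
  moreover have "p * (s/2) * (min 1 (p - 1) * (s/2))
      \<le> p * (s/2) * ((1 + s/2) powr (p - 1) - (1 - s/2) powr (p - 1))"
    using assms by (intro mult_left_mono powr_diff_lower) auto
  moreover have "2 * (1 + p * min 1 (p - 1) / 8 * s\<^sup>2) = 2 + p * (s/2) * (min 1 (p - 1) * (s/2))"
    by (simp add: power2_eq_square)
  moreover have "p * (s/2) * ((1 + s/2) powr (p - 1) - (1 - s/2) powr (p - 1))
      = p * (1 + s/2) powr (p - 1) * (s/2) - p * (1 - s/2) powr (p - 1) * (s/2)"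
    by (simp add: algebra_simps)
  ultimately show ?thesis by linarith
qed

lemma abs_powr_pair_eq:
  fixes x y p :: real
  shows "\<bar>x + y\<bar> powr p + \<bar>x - y\<bar> powr p
    = (\<bar>x\<bar> + \<bar>y\<bar>) powr p + \<bar>\<bar>x\<bar> - \<bar>y\<bar>\<bar> powr p"
proof (cases "0 \<le> x * y")
  case True
  then have "\<bar>x + y\<bar> = \<bar>x\<bar> + \<bar>y\<bar>" "\<bar>x - y\<bar> = \<bar>\<bar>x\<bar> - \<bar>y\<bar>\<bar>"
    by (auto simp: zero_le_mult_iff)
  then show ?thesis by simp
next
  case False
  then have "\<bar>x - y\<bar> = \<bar>x\<bar> + \<bar>y\<bar>" "\<bar>x + y\<bar> = \<bar>\<bar>x\<bar> - \<bar>y\<bar>\<bar>"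
    by (auto simp: zero_le_mult_iff not_le)
  then show ?thesis by simp
qed

text \<open>If \<open>e * y \<le> x\<close>, expand to second order in \<open>t = e * y / x\<close>
  and use \<open>t\<^sup>2 \<le> t powr s\<close> for \<open>s \<le> 2\<close>. Otherwise both
  arguments on the left are at most \<open>y\<close> in absolute value.\<close>

lemma two_point_smoothness:
  fixes p :: real
  assumes p: "1 < p"
  shows "\<exists>e>0. \<forall>x y. \<bar>x + e * y\<bar> powr p + \<bar>x - e * y\<bar> powr p
      \<le> 2 * (\<bar>x\<bar> powr min p 2 + \<bar>y\<bar> powr min p 2) powr (p / min p 2)"
proof -
  define C where "C = p * ((p - 1) * 2 powr (p - 1) + p)"
  have C: "0 \<le> C" using p by (simp add: C_def)
  \<comment> \<open>The bound 1/2 serves the case in which \<open>y\<close> dominates;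
    \<open>1 / (C + 1)\<close> absorbs the constant of the expansion.\<close>
  define e where "e = min (1/2) (1 / (C + 1))"
  have e: "0 < e" "e \<le> 1/2" "C * e \<le> 1"
  proof -
    show "0 < e" using C by (simp add: e_def)
    show "e \<le> 1/2" by (simp add: e_def)
    have "C * e \<le> C * (1 / (C + 1))" using C by (intro mult_left_mono) (auto simp: e_def)
    also have "\<dots> \<le> 1" using C by (simp add: field_simps)
    finally show "C * e \<le> 1" .
  qed
  define s where "s = min p 2"
  have s: "1 < s" "s \<le> p" "s \<le> 2" using p by (auto simp: s_def)
  have *: "(x + e * y) powr p + \<bar>x - e * y\<bar> powr p \<le> 2 * (x powr s + y powr s) powr (p / s)"
    if xy: "0 \<le> x" "0 \<le> y" for x y
  proof (cases "e * y \<le> x \<and> 0 < x")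
    case True
    define t where "t = e * y / x"
    have t: "0 \<le> t" "t \<le> 1" "x * t = e * y" using True xy e by (auto simp: t_def)
    have "(x + e * y) powr p + \<bar>x - e * y\<bar> powr p = x powr p * ((1 + t) powr p + (1 - t) powr p)"
    proof -
      have "x + e * y = x * (1 + t)" "\<bar>x - e * y\<bar> = x * (1 - t)"
        using t True by (auto simp: algebra_simps)
      then show ?thesis using t(1,2) True by (simp add: powr_mult distrib_left[of "x powr p"])
    qed
    also have "\<dots> \<le> x powr p * (2 * (1 + C * t\<^sup>2))"
      using powr_pair_upper[OF p t(1,2)] by (intro mult_left_mono) (auto simp: C_def)
    also have "\<dots> \<le> x powr p * (2 * (1 + (y / x) powr s))"
    proof (intro mult_left_mono add_left_mono)
      have "t\<^sup>2 \<le> t powr s"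
        using powr_mono'[of s 2 t] t s by (cases "t = 0") (auto simp: powr_numeral)
      also have "t powr s = e powr s * (y / x) powr s"
        using True xy e by (simp add: t_def powr_mult[symmetric])
      also have "\<dots> \<le> e * (y / x) powr s"
        using powr_mono'[of 1 s e] e s by (intro mult_right_mono) auto
      finally have "C * t\<^sup>2 \<le> C * e * (y / x) powr s"
        using C by (metis mult.assoc mult_left_mono)
      also have "\<dots> \<le> 1 * (y / x) powr s" using e by (intro mult_right_mono) auto
      finally show "C * t\<^sup>2 \<le> (y / x) powr s" by simp
    qed auto
    also have "\<dots> \<le> x powr p * (2 * (1 + (y / x) powr s) powr (p / s))"
    proof (intro mult_left_mono)
      have "(1 + (y / x) powr s) powr 1 \<le> (1 + (y / x) powr s) powr (p / s)"
        using s by (intro powr_mono) auto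
      then show "1 + (y / x) powr s \<le> (1 + (y / x) powr s) powr (p / s)" by simp
    qed auto
    also have "\<dots> = 2 * (x powr s + y powr s) powr (p / s)"
    proof -
      have "x powr s + y powr s = x powr s * (1 + (y / x) powr s)"
        using True xy by (simp add: powr_divide field_simps)
      then show ?thesis using s True by (simp add: powr_mult powr_powr)
    qed
    finally show ?thesis .
  next
    case False
    then have le: "x \<le> e * y" using xy e
      by (metis linorder_not_le mult_nonneg_nonneg nle_le order_less_imp_le)
    have ey: "e * y \<le> y / 2" using e xy by (metis mult.commute mult_left_mono times_divide_eq_right mult.right_neutral)
    have "(x + e * y) powr p \<le> y powr p" "\<bar>x - e * y\<bar> powr p \<le> y powr p"
      using le ey xy p e by (intro powr_mono2; simp)+
    moreover have "y powr p \<le> (x powr s + y powr s) powr (p / s)"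
    proof -
      have "(y powr s) powr (p / s) \<le> (x powr s + y powr s) powr (p / s)"
        using s p by (intro powr_mono2) auto
      then show ?thesis using s by (simp add: powr_powr)
    qed
    ultimately show ?thesis by simp
  qed
  show ?thesis
  proof (intro exI[of _ e] conjI allI e(1))
    fix x y
    show "\<bar>x + e * y\<bar> powr p + \<bar>x - e * y\<bar> powr p
      \<le> 2 * (\<bar>x\<bar> powr min p 2 + \<bar>y\<bar> powr min p 2) powr (p / min p 2)"
      using *[of "\<bar>x\<bar>" "\<bar>y\<bar>"] e(1) abs_powr_pair_eq[of x "e * y" p]
      by (simp add: abs_mult s_def)
  qed
qed

text \<open>A Clarkson type inequality for all \<open>p > 1\<close> at once: since
  \<open>2 * p\<close> is at least 2, \<open>s powr (2 * p) \<le> s\<^sup>2\<close> on the unit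
  interval, and the square of the lower bound for the pair contains the term
  \<open>2 * c * s\<^sup>2\<close>. The restriction \<open>k \<le> 1\<close> serves the case
  \<open>x < y\<close>, where the roles are exchanged.\<close>

lemma two_point_convexity:
  fixes p :: real
  assumes p: "1 < p"
  shows "\<exists>k>0. \<forall>x y. 4 * (\<bar>x\<bar> powr (2 * p) + k * \<bar>y\<bar> powr (2 * p))
      \<le> (\<bar>x + y\<bar> powr p + \<bar>x - y\<bar> powr p)\<^sup>2"
proof -
  define c where "c = p * min 1 (p - 1) / 8"
  have c: "0 < c" using p by (simp add: c_def)
  define k where "k = min 1 (2 * c)"
  have k: "0 < k" "k \<le> 1" "k \<le> 2 * c" using c by (auto simp: k_def)
  have half: "4 * (x powr (2 * p) + 2 * c * y powr (2 * p)) \<le> ((x + y) powr p + \<bar>x - y\<bar> powr p)\<^sup>2"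
    if xy: "0 \<le> y" "y \<le> x" for x y
  proof (cases "x = 0")
    case False
    then have x: "0 < x" using xy by simp
    define s where "s = y / x"
    have s: "0 \<le> s" "s \<le> 1" "x * s = y" using x xy by (auto simp: s_def)
    have "x + y = x * (1 + s)" "\<bar>x - y\<bar> = x * (1 - s)"
      using s x xy by (auto simp: algebra_simps)
    then have eq: "(x + y) powr p + \<bar>x - y\<bar> powr p = x powr p * ((1 + s) powr p + (1 - s) powr p)"
      using s(1,2) x by (simp add: powr_mult distrib_left[of "x powr p"])
    have "4 * (x powr (2 * p) + 2 * c * y powr (2 * p)) = 4 * x powr (2*p) * (1 + 2 * c * s powr (2 * p))"
      using x s(1) by (simp add: s(3)[symmetric] powr_mult algebra_simps)
    also have "\<dots> \<le> 4 * x powr (2*p) * (1 + c * s\<^sup>2)\<^sup>2"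
    proof (intro mult_left_mono)
      have "s powr (2 * p) \<le> s\<^sup>2"
        using powr_mono'[of 2 "2 * p" s] s p by (cases "s = 0") (auto simp: powr_numeral)
      then have "2 * c * s powr (2 * p) \<le> 2 * c * s\<^sup>2" using c by (intro mult_left_mono) auto
      moreover have "(1 + c * s\<^sup>2)\<^sup>2 = 1 + 2 * c * s\<^sup>2 + (c * s\<^sup>2)\<^sup>2"
        by (simp add: power2_eq_square algebra_simps)
      ultimately show "1 + 2 * c * s powr (2 * p) \<le> (1 + c * s\<^sup>2)\<^sup>2"
        by (metis (no_types, opaque_lifting) add.commute add_increasing add_left_mono zero_le_power2)
    qed auto
    also have "\<dots> = (x powr p * (2 * (1 + c * s\<^sup>2)))\<^sup>2"
    proof -
      have "x powr (2 * p) = (x powr p)\<^sup>2"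
        using x by (simp add: power2_eq_square powr_add[symmetric])
      then show ?thesis by (simp only: power_mult_distrib) simp
    qed
    also have "\<dots> \<le> (x powr p * ((1 + s) powr p + (1 - s) powr p))\<^sup>2"
      using powr_pair_lower[OF p s(1,2), folded c_def] c s
      by (intro power_mono mult_left_mono mult_nonneg_nonneg) auto
    finally show ?thesis using eq by simp
  qed (use xy in auto)
  have *: "4 * (x powr (2 * p) + k * y powr (2 * p)) \<le> ((x + y) powr p + \<bar>x - y\<bar> powr p)\<^sup>2"
    if xy: "0 \<le> x" "0 \<le> y" for x y
  proof (cases "y \<le> x")
    case True
    have "k * y powr (2 * p) \<le> 2 * c * y powr (2 * p)" using k by (intro mult_right_mono) auto
    then show ?thesis using half[of y x] xy True by simp
  next
    case False
    have "x powr (2 * p) \<le> y powr (2 * p)" using False xy p by (intro powr_mono2) auto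
    then have "(1 - k) * x powr (2 * p) \<le> (1 - k) * y powr (2 * p)"
      using k by (intro mult_left_mono) auto
    moreover have "k * x powr (2 * p) \<le> 2 * c * x powr (2 * p)" using k by (intro mult_right_mono) auto
    ultimately have "x powr (2 * p) + k * y powr (2 * p) \<le> y powr (2 * p) + 2 * c * x powr (2 * p)"
      by (simp add: algebra_simps)
    then show ?thesis using half[of x y] xy False by (simp add: add.commute abs_minus_commute)
  qed
  show ?thesis
  proof (intro exI[of _ k] conjI allI k(1))
    fix x y
    show "4 * (\<bar>x\<bar> powr (2 * p) + k * \<bar>y\<bar> powr (2 * p))
      \<le> (\<bar>x + y\<bar> powr p + \<bar>x - y\<bar> powr p)\<^sup>2"
      using *[of "\<bar>x\<bar>" "\<bar>y\<bar>"] abs_powr_pair_eq[of x y p] by simp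
  qed
qed

section \<open>Majorization and the contraction property of sorting a pair\<close>

lemma abs_powr_convex:
  fixes p s t l m :: real
  assumes "1 \<le> p" "0 \<le> l" "0 \<le> m" "l + m = 1"
  shows "\<bar>l * s + m * t\<bar> powr p \<le> l * \<bar>s\<bar> powr p + m * \<bar>t\<bar> powr p"
proof -
  define a where "a = l * \<bar>s\<bar> + m * \<bar>t\<bar>"
  have a: "0 \<le> a" using assms by (simp add: a_def)
  have "\<bar>l * s + m * t\<bar> \<le> a"
    unfolding a_def using abs_triangle_ineq[of "l * s" "m * t"] assms by (simp add: abs_mult)
  then have 1: "\<bar>l * s + m * t\<bar> powr p \<le> a powr p" using assms by (intro powr_mono2) auto
  show ?thesis
  proof (cases "a = 0")
    case False
    then have a: "0 < a" using a by simp
    have "l * (a powr p + p * a powr (p - 1) * (\<bar>s\<bar> - a)) \<le> l * \<bar>s\<bar> powr p"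
         "m * (a powr p + p * a powr (p - 1) * (\<bar>t\<bar> - a)) \<le> m * \<bar>t\<bar> powr p"
      using a assms by (auto intro!: mult_left_mono powr_ge_tangent)
    moreover have "l * (a powr p + p * a powr (p - 1) * (\<bar>s\<bar> - a))
        + m * (a powr p + p * a powr (p - 1) * (\<bar>t\<bar> - a))
        = (l + m) * a powr p + p * a powr (p - 1) * (l * \<bar>s\<bar> + m * \<bar>t\<bar> - (l + m) * a)"
      by (simp add: algebra_simps)
    ultimately show ?thesis using 1 assms(4) by (simp add: a_def)
  qed (use 1 assms in auto)
qed

lemma abs_powr_majorization:
  fixes p s t x y :: real
  assumes "1 \<le> p" "s \<le> x" "x \<le> t" "x + y = s + t"
  shows "\<bar>x\<bar> powr p + \<bar>y\<bar> powr p \<le> \<bar>s\<bar> powr p + \<bar>t\<bar> powr p"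
proof (cases "s = t")
  case False
  then have st: "s < t" using assms by simp
  define l where "l = (t - x) / (t - s)"
  have l: "0 \<le> l" "0 \<le> 1 - l" using assms st by (auto simp: l_def field_simps)
  have "l * (t - s) = t - x" using st by (simp add: l_def)
  then have x: "x = l * s + (1 - l) * t" by (simp add: algebra_simps)
  then have y: "y = (1 - l) * s + l * t" using assms(4) by (simp add: algebra_simps)
  have "\<bar>x\<bar> powr p \<le> l * \<bar>s\<bar> powr p + (1 - l) * \<bar>t\<bar> powr p"
    unfolding x by (rule abs_powr_convex) (use assms l in auto)
  moreover have "\<bar>y\<bar> powr p \<le> (1 - l) * \<bar>s\<bar> powr p + l * \<bar>t\<bar> powr p"
    unfolding y by (rule abs_powr_convex) (use assms l in auto)
  ultimately show ?thesis by (simp add: algebra_simps)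
qed (use assms in auto)

text \<open>Only oppositely ordered pairs need an argument. Then the differences of the sorted pairs
  lie between the original differences and have the same sum.\<close>

lemma min_max_powr_contraction:
  fixes a b c d p :: real
  assumes "1 \<le> p"
  shows "\<bar>min a b - min c d\<bar> powr p + \<bar>max a b - max c d\<bar> powr p
    \<le> \<bar>a - c\<bar> powr p + \<bar>b - d\<bar> powr p"
proof -
  consider "a \<le> b" "c \<le> d" | "b \<le> a" "d \<le> c" | "a \<le> b" "d \<le> c" | "b \<le> a" "c \<le> d"
    by linarith
  then show ?thesis
  proof cases
    case 3
    then show ?thesis using abs_powr_majorization[OF assms, of "a - c" "a - d" "b - d" "b - c"] by simp
  next
    case 4
    then show ?thesis using abs_powr_majorization[OF assms, of "b - d" "b - c" "a - c" "a - d"] by simp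
  qed auto
qed

section \<open>Three-point resistance forms\<close>

lemma lnorm_two: "lnorm (ereal r) 2 x = (\<bar>x 0\<bar> powr r + \<bar>x 1\<bar> powr r) powr (1 / r)"
  by (simp add: lnorm_def lessThan_Suc numeral_2_eq_2 add.commute)

text \<open>RF5 for maps of the plane into itself. As it bounds the seminorms
  \<open>E powr (1 / p)\<close>, the exponents \<open>r\<close> and \<open>q\<close> become
  \<open>r / p\<close> and \<open>q / p\<close>.\<close>

lemma RF5_two:
  fixes T0 T1 :: "real \<Rightarrow> real \<Rightarrow> real"
  assumes rf: "RF5 p F E" and q: "0 < q" "q \<le> p" and r: "p \<le> r"
    and T_zero: "T0 0 0 = 0" "T1 0 0 = 0"
    and T_contr: "\<And>a b c d.
      (\<bar>T0 a b - T0 c d\<bar> powr r + \<bar>T1 a b - T1 c d\<bar> powr r) powr (1 / r)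
        \<le> (\<bar>a - c\<bar> powr q + \<bar>b - d\<bar> powr q) powr (1 / q)"
    and fg: "f \<in> F" "g \<in> F" and E: "\<And>u. u \<in> F \<Longrightarrow> 0 \<le> E u"
  shows "(E (\<lambda>x. T0 (f x) (g x)) powr (r / p) + E (\<lambda>x. T1 (f x) (g x)) powr (r / p)) powr (1 / r)
    \<le> (E f powr (q / p) + E g powr (q / p)) powr (1 / q)"
proof -
  define T where "T = (\<lambda>(x :: nat \<Rightarrow> real) k. if k = (0::nat) then T0 (x 0) (x 1)
     else if k = 1 then T1 (x 0) (x 1) else 0)"
  define u where "u = (\<lambda>j::nat. if j = 0 then f else g)"
  have "T \<in> funs {..<2} \<rightarrow> funs {..<2}" by (auto simp: T_def funs_def)
  moreover have "T (\<lambda>_. 0) = (\<lambda>_. 0)" by (auto simp: T_def T_zero)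
  moreover have "lnorm (ereal r) 2 (\<lambda>k. T x k - T y k) \<le> lnorm (ereal q) 2 (\<lambda>j. x j - y j)" for x y
    using T_contr[of "x 0" "x 1" "y 0" "y 1"] by (simp add: lnorm_two T_def)
  moreover have "\<forall>j<2. u j \<in> F" using fg by (simp add: u_def)
  ultimately have *: "(\<forall>k<2. compose_tuple T 2 u k \<in> F) \<and>
        lnorm r 2 (\<lambda>k. E (compose_tuple T 2 u k) powr (1 / p))
          \<le> lnorm (ereal q) 2 (\<lambda>j. E (u j) powr (1 / p))"
    using rf[unfolded RF5_def, rule_format, of q "ereal r" 2 2 T u] q r by auto
  have "compose_tuple T 2 u 0 = (\<lambda>x. T0 (f x) (g x))" "compose_tuple T 2 u 1 = (\<lambda>x. T1 (f x) (g x))"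
    by (auto simp: compose_tuple_def T_def u_def restr_def)
  then show ?thesis
    using * by (simp add: lnorm_two u_def powr_powr)
qed

text \<open>Functions on the vertex set of the triangle are indexed by the letters; only the values at
  the letters matter.\<close>

definition lift :: "(nat \<Rightarrow> real^2) \<Rightarrow> (nat \<Rightarrow> real) \<Rightarrow> real^2 \<Rightarrow> real" where
  "lift q f x = (if x = q 1 then f 1 else if x = q 2 then f 2 else if x = q 3 then f 3 else 0)"

lemma sum_letters: "(\<Sum>i\<in>letters. f i) = f 1 + f 2 + (f 3 :: real)"
  by simp

text \<open>RF5 distilled into submodularity (\<open>E_min_max\<close>), a Clarkson type inequality
  with modulus \<kappa> (\<open>E_convex\<close>) and an upper bound for symmetric second
  differences (\<open>E_smooth\<close>). By \<open>E_cong\<close>, functions on all naturals stand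
  for their values at the three letters.\<close>

locale three_point_form =
  fixes p :: real and E :: "(nat \<Rightarrow> real) \<Rightarrow> real" and \<kappa> :: real and \<epsilon> :: real
  assumes p: "1 < p"
    and E_cong: "(\<And>i. i \<in> letters \<Longrightarrow> f i = g i) \<Longrightarrow> E f = E g"
    and E_nonneg: "0 \<le> E f"
    and E_scale: "E (\<lambda>i. c * f i) = \<bar>c\<bar> powr p * E f"
    and E_triangle: "E (\<lambda>i. f i + g i) powr (1 / p) \<le> E f powr (1 / p) + E g powr (1 / p)"
    and E_eq_0_iff: "E f = 0 \<longleftrightarrow> (\<exists>c. \<forall>i\<in>letters. f i = c)"
    and E_min_max: "E (\<lambda>i. min (f i) (g i)) + E (\<lambda>i. max (f i) (g i)) \<le> E f + E g"
    and kappa: "0 < \<kappa>"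
    and E_convex: "(E f)\<^sup>2 + \<kappa> * (E g)\<^sup>2 \<le> ((E (\<lambda>i. f i + g i) + E (\<lambda>i. f i - g i)) / 2)\<^sup>2"
    and epsilon: "0 < \<epsilon>"
    and E_smooth: "E (\<lambda>i. f i + \<epsilon> * g i) + E (\<lambda>i. f i - \<epsilon> * g i)
      \<le> 2 * (E f powr (min p 2 / p) + E g powr (min p 2 / p)) powr (p / min p 2)"

lemma equilateral_distinct:
  assumes "equilateral q" shows "q 1 \<noteq> q 2" "q 2 \<noteq> q 3" "q 1 \<noteq> q 3"
  using assms by (auto simp: equilateral_def)

lemma powr_inverse_le_imp_le:
  fixes a b p :: real
  assumes "0 < p" "0 \<le> c"
    and "a powr (1 / p) \<le> c powr (1 / p)" "0 \<le> a"
  shows "a \<le> c"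
proof -
  have "(a powr (1/p)) powr p \<le> (c powr (1/p)) powr p" using assms by (intro powr_mono2[OF _ _ assms(3)]) auto
  moreover have "(a powr (1/p)) powr p = a" "(c powr (1/p)) powr p = c"
    using assms(1,2,4) by (auto simp: powr_powr)
  ultimately show ?thesis by simp
qed

lemma square_powr_half:
  fixes x p :: real
  assumes "0 \<le> x"
  shows "(x\<^sup>2) powr (1 / (2 * p)) = x powr (1 / p)"
proof -
  have "x\<^sup>2 = x powr 2" using assms by (simp add: powr_numeral)
  then show ?thesis by (simp only: powr_powr) simp
qed

text \<open>RF5 is applied to the maps sending \<open>(x, y)\<close> to
  \<open>(min x y, max x y)\<close>, to \<open>(a * (x + y), b * (x - y))\<close> and to
  \<open>(a * (x + e * y), a * (x - e * y))\<close>, with constants that normalize the two-point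
  inequalities to contractions.\<close>

lemma resistance_form_three_point:
  assumes p: "1 < p" and tri: "equilateral q"
    and form: "p_resistance_form p (q ` letters) (funs (q ` letters)) E0"
  obtains \<kappa> \<epsilon> where "three_point_form p (\<lambda>f. E0 (lift q f)) \<kappa> \<epsilon>"
proof -
  note dist = equilateral_distinct[OF tri]
  let ?F = "funs (q ` letters)"
  have lift_in: "lift q f \<in> ?F" for f by (auto simp: lift_def funs_def)
  have lift_comp: "(\<lambda>x. T (lift q f x) (lift q g x)) = lift q (\<lambda>i. T (f i) (g i))"
    if "T 0 0 = 0" for T :: "real \<Rightarrow> real \<Rightarrow> real" and f g
    using that by (auto simp: lift_def)
  have lift_q: "lift q f (q i) = f i" if "i \<in> letters" for f i
    using that dist by (auto simp: lift_def)
  have E_pos: "0 \<le> E0 u" if "u \<in> ?F" for u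
    using form that by (auto simp: p_resistance_form_def)
  have rf5: "RF5 p ?F E0" and rf1: "RF1 p (q ` letters) ?F E0"
    using form by (auto simp: p_resistance_form_def)
  have two: "(E0 (lift q (\<lambda>i. T0 (f i) (g i))) powr (r / p) + E0 (lift q (\<lambda>i. T1 (f i) (g i))) powr (r / p)) powr (1 / r)
    \<le> (E0 (lift q f) powr (s / p) + E0 (lift q g) powr (s / p)) powr (1 / s)"
    if "0 < s" "s \<le> p" "p \<le> r" "T0 0 0 = 0" "T1 0 0 = 0"
     "\<And>a b c d.
      (\<bar>T0 a b - T0 c d\<bar> powr r + \<bar>T1 a b - T1 c d\<bar> powr r) powr (1 / r)
        \<le> (\<bar>a - c\<bar> powr s + \<bar>b - d\<bar> powr s) powr (1 / s)" for T0 T1 r s f g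
    using RF5_two[OF rf5 that lift_in[of f] lift_in[of g] E_pos]
    by (simp add: lift_comp that)
  let ?E = "\<lambda>f. E0 (lift q f)"
  have scale_powr: "E0 (\<lambda>x. c * u x) powr (1 / p) = \<bar>c\<bar> * E0 u powr (1 / p)" if "u \<in> ?F" for c u
    using rf1 that by (auto simp: RF1_def)
  have scale: "?E (\<lambda>i. c * f i) = \<bar>c\<bar> powr p * ?E f" for c f
  proof -
    have "?E (\<lambda>i. c * f i) powr (1 / p) = \<bar>c\<bar> * ?E f powr (1 / p)"
      using scale_powr[OF lift_in, of c f] lift_comp[of "\<lambda>a b. c * a" f f] by simp
    then have "(?E (\<lambda>i. c * f i) powr (1 / p)) powr p = (\<bar>c\<bar> * ?E f powr (1 / p)) powr p" by simp
    then show ?thesis using p by (simp add: powr_powr powr_mult abs_of_nonneg[OF E_pos[OF lift_in]])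
  qed
  from two_point_convexity[OF p] obtain k where k: "0 < k"
    "\<forall>x y. 4 * (\<bar>x\<bar> powr (2 * p) + k * \<bar>y\<bar> powr (2 * p))
      \<le> (\<bar>x + y\<bar> powr p + \<bar>x - y\<bar> powr p)\<^sup>2"
    by (elim exE conjE)
  from two_point_smoothness[OF p] obtain e where e: "0 < e"
    "\<forall>x y. \<bar>x + e * y\<bar> powr p + \<bar>x - e * y\<bar> powr p
      \<le> 2 * (\<bar>x\<bar> powr min p 2 + \<bar>y\<bar> powr min p 2) powr (p / min p 2)"
    by (elim exE conjE)
  have "three_point_form p ?E k e"
  proof
    fix f g :: "nat \<Rightarrow> real" and c :: real
    show "1 < p" "0 < k" "0 < e" by fact+
    show "0 \<le> ?E f" using E_pos[OF lift_in] .
    show "?E (\<lambda>i. c * f i) = \<bar>c\<bar> powr p * ?E f" by (rule scale)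
    show "?E f = ?E g" if "\<And>i. i \<in> letters \<Longrightarrow> f i = g i"
    proof -
      have "lift q f = lift q g" using that by (auto simp: lift_def)
      then show ?thesis by simp
    qed
    show "?E (\<lambda>i. f i + g i) powr (1 / p) \<le> ?E f powr (1 / p) + ?E g powr (1 / p)"
    proof -
      have "E0 (\<lambda>x. lift q f x + lift q g x) powr (1 / p) \<le> ?E f powr (1 / p) + ?E g powr (1 / p)"
        using rf1 lift_in by (auto simp: RF1_def)
      then show ?thesis by (simp add: lift_comp[of "\<lambda>a b. a + b"])
    qed
    show "?E f = 0 \<longleftrightarrow> (\<exists>c. \<forall>i\<in>letters. f i = c)"
    proof -
      have "{u \<in> ?F. E0 u = 0} = const_funs (q ` letters)" using rf1 by (simp add: RF1_def)
      then have "?E f = 0 \<longleftrightarrow> lift q f \<in> const_funs (q ` letters)" using lift_in by auto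
      also have "\<dots> \<longleftrightarrow> (\<exists>c. \<forall>i\<in>letters. f i = c)"
      proof
        assume "lift q f \<in> const_funs (q ` letters)"
        then obtain c where c: "lift q f = restr (q ` letters) (\<lambda>_. c)" by (auto simp: const_funs_def)
        have "f i = c" if "i \<in> letters" for i
          using fun_cong[OF c, of "q i"] lift_q[OF that] that by (auto simp: restr_def)
        then show "\<exists>c. \<forall>i\<in>letters. f i = c" by blast
      next
        assume "\<exists>c. \<forall>i\<in>letters. f i = c"
        then obtain c where c: "\<And>i. i \<in> letters \<Longrightarrow> f i = c" by blast
        have "lift q f = restr (q ` letters) (\<lambda>_. c)"
          using c by (auto simp: lift_def restr_def)
        then show "lift q f \<in> const_funs (q ` letters)" by (auto simp: const_funs_def)
      qed
      finally show ?thesis .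
    qed
    show "?E (\<lambda>i. min (f i) (g i)) + ?E (\<lambda>i. max (f i) (g i)) \<le> ?E f + ?E g"
    proof -
      have "(?E (\<lambda>i. min (f i) (g i)) powr (p / p) + ?E (\<lambda>i. max (f i) (g i)) powr (p / p)) powr (1 / p)
        \<le> (?E f powr (p / p) + ?E g powr (p / p)) powr (1 / p)"
        using min_max_powr_contraction p by (intro two powr_mono2) auto
      then have "(?E (\<lambda>i. min (f i) (g i)) + ?E (\<lambda>i. max (f i) (g i))) powr (1 / p)
        \<le> (?E f + ?E g) powr (1 / p)"
        using p E_pos[OF lift_in] by simp
      then show ?thesis using p E_pos[OF lift_in] by - (rule powr_inverse_le_imp_le[of p], auto)
    qed
    show "(?E f)\<^sup>2 + k * (?E g)\<^sup>2 \<le> ((?E (\<lambda>i. f i + g i) + ?E (\<lambda>i. f i - g i)) / 2)\<^sup>2"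
    proof -
      \<comment> \<open>The map acts on \<open>f + g\<close> and \<open>f - g\<close> and returns
        \<open>2 * a * f\<close> and \<open>2 * b * g\<close>. As \<open>(2 * a) powr p = 2\<close>,
        the energy of \<open>f\<close> is doubled; \<open>b\<close> carries in addition the constant
        \<open>k\<close>.\<close>
      define a where "a = 2 powr (1 / p) / 2"
      have a: "0 < a" by (simp add: a_def)
      define b where "b = a * k powr (1 / (2 * p))"
      have apow: "a powr (2 * p) = 4 / 2 powr (2 * p)"
        using p by (simp add: a_def powr_divide powr_powr powr_numeral)
      have bpow: "b powr (2 * p) = a powr (2 * p) * k"
        using p k(1) a by (simp add: b_def powr_mult powr_powr)
      have ab: "0 < a" "0 < b" using k(1) a by (auto simp: b_def)
      have contr: "(\<bar>a * (x + y) - a * (x' + y')\<bar> powr (2 * p) + \<bar>b * (x - y) - b * (x' - y')\<bar> powr (2 * p)) powr (1 / (2 * p))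
        \<le> (\<bar>x - x'\<bar> powr p + \<bar>y - y'\<bar> powr p) powr (1 / p)" for x y x' y' :: real
      proof -
        define X Y where "X = x - x'" "Y = y - y'"
        have "a * (x + y) - a * (x' + y') = a * (X + Y)" "b * (x - y) - b * (x' - y') = b * (X - Y)"
          by (simp_all add: X_Y_def algebra_simps)
        then have "\<bar>a * (x + y) - a * (x' + y')\<bar> = a * \<bar>X + Y\<bar>"
          "\<bar>b * (x - y) - b * (x' - y')\<bar> = b * \<bar>X - Y\<bar>"
          using ab by (simp_all only: abs_mult abs_of_pos)
        moreover have "a * \<bar>X + Y\<bar> = 2 * a * \<bar>(X + Y) / 2\<bar>" "b * \<bar>X - Y\<bar> = 2 * b * \<bar>(X - Y) / 2\<bar>"
          by auto
        moreover have "(2 * a * \<bar>(X + Y) / 2\<bar>) powr (2 * p) = 4 * \<bar>(X + Y) / 2\<bar> powr (2 * p)"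
          using ab apow by (simp add: powr_mult powr_divide)
        moreover have "(2 * b * \<bar>(X - Y) / 2\<bar>) powr (2 * p) = 4 * (k * \<bar>(X - Y) / 2\<bar> powr (2 * p))"
          using ab apow bpow by (simp add: powr_mult powr_divide)
        ultimately have "\<bar>a * (x + y) - a * (x' + y')\<bar> powr (2 * p) + \<bar>b * (x - y) - b * (x' - y')\<bar> powr (2 * p)
          = 4 * (\<bar>(X + Y) / 2\<bar> powr (2 * p) + k * \<bar>(X - Y) / 2\<bar> powr (2 * p))"
          by (simp only: distrib_left)
        also have "\<dots> \<le> (\<bar>X\<bar> powr p + \<bar>Y\<bar> powr p)\<^sup>2"
          using k(2)[rule_format, of "(X + Y) / 2" "(X - Y) / 2"] by (simp add: field_simps)
        finally have "(\<bar>a * (x + y) - a * (x' + y')\<bar> powr (2 * p) + \<bar>b * (x - y) - b * (x' - y')\<bar> powr (2 * p)) powr (1 / (2 * p))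
            \<le> ((\<bar>X\<bar> powr p + \<bar>Y\<bar> powr p)\<^sup>2) powr (1 / (2 * p))"
          using p by (intro powr_mono2) auto
        also have "\<dots> = (\<bar>X\<bar> powr p + \<bar>Y\<bar> powr p) powr (1 / p)"
          by (intro square_powr_half) auto
        finally show ?thesis by (simp add: X_Y_def)
      qed
      let ?f = "\<lambda>i. f i + g i" and ?g = "\<lambda>i. f i - g i"
      have "(?E (\<lambda>i. a * (?f i + ?g i)) powr (2 * p / p) + ?E (\<lambda>i. b * (?f i - ?g i)) powr (2 * p / p)) powr (1 / (2 * p))
        \<le> (?E ?f powr (p / p) + ?E ?g powr (p / p)) powr (1 / p)"
        using p contr by (intro two) auto
      moreover have "?E (\<lambda>i. a * (?f i + ?g i)) = 2 * ?E f"
      proof -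
        have "?E (\<lambda>i. a * (?f i + ?g i)) = ?E (\<lambda>i. (2 * a) * f i)"
          by (intro arg_cong[of _ _ E0] arg_cong[of _ _ "lift q"]) (auto simp: algebra_simps)
        also have "\<dots> = \<bar>2 * a\<bar> powr p * ?E f" by (rule scale)
        also have "\<bar>2 * a\<bar> powr p = 2" using p by (simp add: a_def powr_powr)
        finally show ?thesis .
      qed
      moreover have "?E (\<lambda>i. b * (?f i - ?g i)) = 2 * sqrt k * ?E g"
      proof -
        have "?E (\<lambda>i. b * (?f i - ?g i)) = ?E (\<lambda>i. (2 * b) * g i)"
          by (intro arg_cong[of _ _ E0] arg_cong[of _ _ "lift q"]) (auto simp: algebra_simps)
        also have "\<dots> = \<bar>2 * b\<bar> powr p * ?E g" by (rule scale)
        also have "\<bar>2 * b\<bar> powr p = 2 * sqrt k"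
          using p k(1) by (simp add: a_def b_def powr_powr powr_mult powr_half_sqrt)
        finally show ?thesis .
      qed
      ultimately have "((2 * ?E f)\<^sup>2 + (2 * sqrt k * ?E g)\<^sup>2) powr (1 / (2 * p)) \<le> (?E ?f + ?E ?g) powr (1 / p)"
        using p k(1) E_pos[OF lift_in] by simp
      also have "\<dots> = ((?E ?f + ?E ?g)\<^sup>2) powr (1 / (2 * p))"
        using E_pos[OF lift_in] by (intro square_powr_half[symmetric]) auto
      finally have "(2 * ?E f)\<^sup>2 + (2 * sqrt k * ?E g)\<^sup>2 \<le> (?E ?f + ?E ?g)\<^sup>2"
        using p by - (rule powr_inverse_le_imp_le[of "2 * p"], auto)
      then show ?thesis using k(1) by (simp add: power_mult_distrib power_divide)
    qed
    show "?E (\<lambda>i. f i + e * g i) + ?E (\<lambda>i. f i - e * g i)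
      \<le> 2 * (?E f powr (min p 2 / p) + ?E g powr (min p 2 / p)) powr (p / min p 2)"
    proof -
      define s where "s = min p 2"
      have s: "0 < s" "s \<le> p" using p by (auto simp: s_def)
      \<comment> \<open>\<open>a powr p = 1 / 2\<close> cancels the factor 2 of the two-point
        inequality.\<close>
      define a where "a = 1 / 2 powr (1 / p)"
      have a: "0 < a" by (simp add: a_def)
      have apow: "a powr p = 1 / 2" using p by (simp add: a_def powr_divide powr_powr)
      have scaled: "\<bar>a * z\<bar> powr p = \<bar>z\<bar> powr p / 2" for z
        using a by (simp add: abs_mult powr_mult apow)
      have contr: "(\<bar>a * (x + e * y) - a * (x' + e * y')\<bar> powr p + \<bar>a * (x - e * y) - a * (x' - e * y')\<bar> powr p) powr (1 / p)
        \<le> (\<bar>x - x'\<bar> powr s + \<bar>y - y'\<bar> powr s) powr (1 / s)" for x y x' y'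
      proof -
        define X Y where "X = x - x'" "Y = y - y'"
        have "a * (x + e * y) - a * (x' + e * y') = a * (X + e * Y)"
          "a * (x - e * y) - a * (x' - e * y') = a * (X - e * Y)"
          by (simp_all add: X_Y_def algebra_simps)
        then have "\<bar>a * (x + e * y) - a * (x' + e * y')\<bar> powr p + \<bar>a * (x - e * y) - a * (x' - e * y')\<bar> powr p
          = (\<bar>X + e * Y\<bar> powr p + \<bar>X - e * Y\<bar> powr p) / 2"
          by (simp only: scaled add_divide_distrib)
        also have "\<dots> \<le> (\<bar>X\<bar> powr s + \<bar>Y\<bar> powr s) powr (p / s)"
          using e(2)[rule_format, of X Y] by (simp add: s_def)
        finally have "(\<bar>a * (x + e * y) - a * (x' + e * y')\<bar> powr p + \<bar>a * (x - e * y) - a * (x' - e * y')\<bar> powr p) powr (1 / p)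
           \<le> ((\<bar>X\<bar> powr s + \<bar>Y\<bar> powr s) powr (p / s)) powr (1 / p)"
          using p by (intro powr_mono2) auto
        then show ?thesis using p by (simp add: powr_powr X_Y_def)
      qed
      have "(?E (\<lambda>i. a * (f i + e * g i)) powr (p / p) + ?E (\<lambda>i. a * (f i - e * g i)) powr (p / p)) powr (1 / p)
        \<le> (?E f powr (s / p) + ?E g powr (s / p)) powr (1 / s)"
        using p s contr by (intro two) auto
      then have "((?E (\<lambda>i. f i + e * g i) + ?E (\<lambda>i. f i - e * g i)) / 2) powr (1 / p)
        \<le> ((?E f powr (s / p) + ?E g powr (s / p)) powr (p / s)) powr (1 / p)"
        using p a apow E_pos[OF lift_in] by (simp add: scale powr_powr add_divide_distrib)
      then have "(?E (\<lambda>i. f i + e * g i) + ?E (\<lambda>i. f i - e * g i)) / 2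
        \<le> (?E f powr (s / p) + ?E g powr (s / p)) powr (p / s)"
        using p E_pos[OF lift_in] by - (rule powr_inverse_le_imp_le[of p], auto)
      then show ?thesis by (simp add: s_def)
    qed
  qed
  then show thesis by (rule that)
qed

section \<open>Differentiability and strict convexity\<close>

text \<open>By convexity every left slope at 0 is at most every right slope. The gap between the two
  slopes for the same \<open>t\<close> is the symmetric second difference divided by
  \<open>t\<close>, of order \<open>t powr (s - 1)\<close>, and so vanishes in the limit.\<close>

lemma convex_symmetric_differentiable:
  fixes \<phi> :: "real \<Rightarrow> real"
  assumes conv: "\<And>l s t. 0 \<le> l \<Longrightarrow> l \<le> 1 \<Longrightarrow> \<phi> (l * s + (1 - l) * t) \<le> l * \<phi> s + (1 - l) * \<phi> t"
    and s: "1 < s" and smooth: "\<And>t. 0 < t \<Longrightarrow> t \<le> 1 \<Longrightarrow> \<phi> t + \<phi> (- t) \<le> 2 * \<phi> 0 + C * t powr s"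
  shows "\<exists>D. (\<phi> has_real_derivative D) (at 0)"
proof -
  define L where "L = Inf ((\<lambda>t. (\<phi> t - \<phi> 0) / t) ` {0<..})"
  have slope: "(\<phi> 0 - \<phi> (- t)) / t \<le> (\<phi> t' - \<phi> 0) / t'" if t: "0 < t" "0 < t'" for t t'
  proof -
    define l where "l = t' / (t + t')"
    have l: "0 \<le> l" "l \<le> 1" "(t + t') * l = t'" using t by (auto simp: l_def)
    have "l * (- t) + (1 - l) * t' = 0" using l(3) by (simp add: algebra_simps)
    then have "\<phi> 0 \<le> l * \<phi> (- t) + (1 - l) * \<phi> t'" using conv[OF l(1,2), of "- t" t'] by simp
    then have "(t + t') * \<phi> 0 \<le> (t + t') * (l * \<phi> (- t) + (1 - l) * \<phi> t')"
      using t by (intro mult_left_mono) auto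
    also have "\<dots> = ((t + t') * l) * \<phi> (- t) + ((t + t') - (t + t') * l) * \<phi> t'"
      by (simp add: algebra_simps)
    also have "\<dots> = t' * \<phi> (- t) + t * \<phi> t'" by (simp only: l(3)) simp
    finally show ?thesis using t by (simp add: field_simps)
  qed
  have bdd: "bdd_below ((\<lambda>t. (\<phi> t - \<phi> 0) / t) ` {0<..})"
    using slope[of 1] by (auto simp: bdd_below_def)
  have up: "L \<le> (\<phi> t - \<phi> 0) / t" if "0 < t" for t
    unfolding L_def using that bdd by (intro cINF_lower) auto
  have low: "(\<phi> 0 - \<phi> (- t)) / t \<le> L" if "0 < t" for t
    unfolding L_def using slope that by (intro cINF_greatest) auto
  have gap: "(\<phi> t - \<phi> 0) / t - (\<phi> 0 - \<phi> (- t)) / t \<le> C * t powr (s - 1)" if "0 < t" "t \<le> 1" for t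
  proof -
    have "(\<phi> t - \<phi> 0) / t - (\<phi> 0 - \<phi> (- t)) / t = (\<phi> t + \<phi> (- t) - 2 * \<phi> 0) / t"
      by (simp add: diff_divide_distrib add_divide_distrib)
    also have "\<dots> \<le> (C * t powr s) / t"
      using smooth[OF that] that by (intro divide_right_mono) auto
    also have "\<dots> = C * t powr (s - 1)" using that by (simp add: powr_diff)
    finally show ?thesis .
  qed
  have bound: "norm ((\<phi> (0 + h) - \<phi> 0) / h - L) \<le> C * \<bar>h\<bar> powr (s - 1)" if "h \<noteq> 0" "\<bar>h\<bar> \<le> 1" for h
  proof (cases "0 < h")
    case True
    then show ?thesis using up[of h] low[of h] gap[of h] that by simp
  next
    case False
    then have "0 < - h" "- h \<le> 1" using that by auto
    moreover have "(\<phi> h - \<phi> 0) / h = (\<phi> 0 - \<phi> h) / - h" by (simp add: diff_divide_distrib)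
    ultimately show ?thesis using up[of "- h"] low[of "- h"] gap[of "- h"] by simp
  qed
  have "((\<lambda>h. (\<phi> (0 + h) - \<phi> 0) / h - L) \<longlongrightarrow> 0) (at 0)"
  proof (rule Lim_null_comparison)
    show "\<forall>\<^sub>F h in at 0. norm ((\<phi> (0 + h) - \<phi> 0) / h - L) \<le> C * \<bar>h\<bar> powr (s - 1)"
      unfolding eventually_at using bound by (intro exI[of _ 1]) (auto simp: dist_norm)
    have "((\<lambda>h::real. C * \<bar>h\<bar> powr (s - 1)) \<longlongrightarrow> C * \<bar>0\<bar> powr (s - 1)) (at 0)"
      using s by (intro tendsto_mult tendsto_powr2 tendsto_const tendsto_rabs tendsto_ident_at) auto
    then show "((\<lambda>h::real. C * \<bar>h\<bar> powr (s - 1)) \<longlongrightarrow> 0) (at 0)" by simp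
  qed
  then show ?thesis by (auto simp: DERIV_def LIM_zero_iff)
qed

lemma deriv_nonneg_of_right_min:
  fixes G :: "real \<Rightarrow> real"
  assumes "(G has_real_derivative d) (at 0)" "\<And>t. 0 < t \<Longrightarrow> t < 1 \<Longrightarrow> G 0 \<le> G t"
  shows "0 \<le> d"
proof (rule ccontr)
  assume "\<not> 0 \<le> d"
  then obtain e where e: "0 < e" "\<And>h. 0 < h \<Longrightarrow> h < e \<Longrightarrow> G (0 + h) < G 0"
    using DERIV_neg_dec_right[OF assms(1)] by auto
  have "G (0 + min (e/2) (1/2)) < G 0" using e(1) by (intro e(2)) auto
  moreover have "G 0 \<le> G (min (e/2) (1/2))" using e(1) by (intro assms(2)) auto
  ultimately show False by simp
qed

lemma deriv_zero_of_min:
  fixes G :: "real \<Rightarrow> real"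
  assumes "(G has_real_derivative d) (at 0)" "\<And>t. G 0 \<le> G t"
  shows "d = 0"
  by (rule DERIV_local_min[OF assms(1), of 1]) (use assms(2) in auto)

lemma third_letter:
  assumes "i \<in> letters" "j \<in> letters" "i \<noteq> j"
  shows "\<exists>k\<in>letters. k \<noteq> i \<and> k \<noteq> j \<and> letters = {i, j, k}"
proof -
  have "i = 1 \<or> i = 2 \<or> i = 3" "j = 1 \<or> j = 2 \<or> j = 3" using assms(1,2) by simp_all
  then show ?thesis using assms(3)
    by (elim disjE) (simp_all add: insert_commute)
qed

abbreviation unit_at :: "nat \<Rightarrow> nat \<Rightarrow> real" where
  "unit_at i \<equiv> (\<lambda>j. if j = i then 1 else 0)"

section \<open>Directional derivatives and the behaviour of fluxes at contact points\<close>

context three_point_form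
begin

text \<open>\<open>deriv\<close> is total; the derivative exists by \<open>D_has_derivative\<close>.
  \<open>D f (unit_at i)\<close> is the flux at vertex \<open>i\<close>, a discrete normal
  derivative.\<close>

definition D :: "(nat \<Rightarrow> real) \<Rightarrow> (nat \<Rightarrow> real) \<Rightarrow> real" where
  "D f g = deriv (\<lambda>t. E (\<lambda>i. f i + t * g i)) 0"

lemma E_const: "E (\<lambda>_. c) = 0"
  using E_eq_0_iff[of "\<lambda>_. c"] by auto

lemma E_pos: "i \<in> letters \<Longrightarrow> j \<in> letters \<Longrightarrow> f i \<noteq> f j \<Longrightarrow> 0 < E f"
  using E_nonneg[of f] E_eq_0_iff[of f] by (metis less_eq_real_def)

lemma E_add_const: "E (\<lambda>i. f i + c) = E f"
proof -
  have le: "E (\<lambda>i. f i + c) \<le> E f" for f c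
  proof -
    have "E (\<lambda>i. f i + c) powr (1 / p) \<le> E f powr (1 / p)"
      using E_triangle[of f "\<lambda>_. c"] by (simp add: E_const)
    then show ?thesis using p E_nonneg by - (rule powr_inverse_le_imp_le[of p], auto)
  qed
  show ?thesis using le[of f c] le[of "\<lambda>i. f i + c" "- c"] by (simp add: algebra_simps)
qed

lemma E_convex_comb:
  assumes "0 \<le> l" "l \<le> 1"
  shows "E (\<lambda>i. l * f i + (1 - l) * g i) \<le> l * E f + (1 - l) * E g"
proof -
  let ?N = "\<lambda>f. E f powr (1 / p)"
  have N: "?N f powr p = E f" for f using p E_nonneg[of f] by (simp add: powr_powr)
  have "?N (\<lambda>i. l * f i + (1 - l) * g i) \<le> ?N (\<lambda>i. l * f i) + ?N (\<lambda>i. (1 - l) * g i)"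
    by (rule E_triangle)
  also have "\<dots> = l * ?N f + (1 - l) * ?N g"
    using assms p E_nonneg by (simp add: E_scale powr_mult powr_powr)
  finally have "?N (\<lambda>i. l * f i + (1 - l) * g i) powr p \<le> (l * ?N f + (1 - l) * ?N g) powr p"
    using p by (intro powr_mono2) auto
  also have "\<dots> \<le> l * ?N f powr p + (1 - l) * ?N g powr p"
    using abs_powr_convex[of p l "1 - l" "?N f" "?N g"] p assms by simp
  finally show ?thesis by (simp only: N)
qed

lemma E_midpoint: "E (\<lambda>i. (f i + g i) / 2) \<le> (E f + E g) / 2"
  using E_convex_comb[of "1/2" f g] by (simp add: add_divide_distrib)

text \<open>\<open>E_convex\<close> for the midpoint and the half difference, whose sum and
  difference are \<open>f\<close> and \<open>g\<close>.\<close>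

lemma E_midpoint_strict:
  assumes "E (\<lambda>i. f i - g i) \<noteq> 0"
  shows "E (\<lambda>i. (f i + g i) / 2) < (E f + E g) / 2"
proof -
  have "(E (\<lambda>i. (f i + g i) / 2))\<^sup>2 + \<kappa> * (E (\<lambda>i. (f i - g i) / 2))\<^sup>2
    \<le> ((E (\<lambda>i. (f i + g i) / 2 + (f i - g i) / 2) + E (\<lambda>i. (f i + g i) / 2 - (f i - g i) / 2)) / 2)\<^sup>2"
    by (rule E_convex)
  moreover have "(\<lambda>i. (f i + g i) / 2 + (f i - g i) / 2) = f" "(\<lambda>i. (f i + g i) / 2 - (f i - g i) / 2) = g"
    by (auto simp: field_simps)
  moreover have "E (\<lambda>i. (f i - g i) / 2) \<noteq> 0"
    using E_scale[of "1/2" "\<lambda>i. f i - g i"] assms by simp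
  then have "0 < \<kappa> * (E (\<lambda>i. (f i - g i) / 2))\<^sup>2" using kappa by simp
  ultimately have "(E (\<lambda>i. (f i + g i) / 2))\<^sup>2 < ((E f + E g) / 2)\<^sup>2" by simp
  then show ?thesis by (rule power_less_imp_less_base) (simp add: E_nonneg)
qed

text \<open>\<open>E_smooth\<close> in the direction \<open>(t / \<epsilon>) * g\<close> bounds
  \<open>\<phi> t + \<phi> (- t)\<close> by \<open>2 * (X + t powr s * Y) powr (p / s)\<close>,
  which exceeds \<open>2 * \<phi> 0\<close> by a term of order \<open>t powr s\<close> with
  \<open>s > 1\<close>.\<close>

lemma D_has_derivative: "((\<lambda>t. E (\<lambda>i. f i + t * g i)) has_real_derivative D f g) (at 0)"
proof -
  define \<phi> where "\<phi> = (\<lambda>t. E (\<lambda>i. f i + t * g i))"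
  define s where "s = min p 2"
  have s: "1 < s" "s \<le> p" using p by (auto simp: s_def)
  define X where "X = E f powr (s / p)"
  define Y where "Y = E g powr (s / p) / \<epsilon> powr s"
  have XY: "0 \<le> X" "0 \<le> Y" by (auto simp: X_def Y_def)
  \<comment> \<open>Built from the slope of \<open>z powr (p / s)\<close> at \<open>X + Y\<close>,
    which bounds the slopes on the whole interval from \<open>X\<close> to \<open>X + Y\<close> as
    \<open>p / s \<ge> 1\<close>.\<close>
  define C where "C = 2 * (p / s * (X + Y) powr (p / s - 1) * Y)"
  have conv: "\<phi> (l * s + (1 - l) * t) \<le> l * \<phi> s + (1 - l) * \<phi> t" if "0 \<le> l" "l \<le> 1" for l s t
  proof -
    have "(\<lambda>i. f i + (l * s + (1 - l) * t) * g i) = (\<lambda>i. l * (f i + s * g i) + (1 - l) * (f i + t * g i))"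
      by (auto simp: algebra_simps)
    then show ?thesis unfolding \<phi>_def
      using E_convex_comb[OF that, of "\<lambda>i. f i + s * g i" "\<lambda>i. f i + t * g i"] by simp
  qed
  have smooth: "\<phi> t + \<phi> (- t) \<le> 2 * \<phi> 0 + C * t powr s" if t: "0 < t" "t \<le> 1" for t
  proof -
    define z where "z = t powr s * Y"
    have z: "0 \<le> z" "z \<le> Y"
    proof -
      have "t powr s \<le> 1" using t s by (intro powr_le1) auto
      then show "z \<le> Y" using XY mult_right_mono[of "t powr s" 1 Y] by (simp add: z_def)
    qed (use XY in \<open>auto simp: z_def\<close>)
    have scaled: "E (\<lambda>i. t / \<epsilon> * g i) powr (s / p) = z"
      using t epsilon p s E_nonneg[of g]
      by (subst E_scale) (simp add: powr_mult powr_powr powr_divide z_def Y_def)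
    have cancel: "\<epsilon> * (t / \<epsilon> * c) = t * c" for c using epsilon by simp
    have "\<phi> t + \<phi> (- t) \<le> 2 * (X + z) powr (p / s)"
      using E_smooth[of f "\<lambda>i. t / \<epsilon> * g i"] scaled
      by (simp add: cancel X_def s_def \<phi>_def del: times_divide_eq_left)
    also have "\<dots> \<le> 2 * (X powr (p / s) + p / s * (X + Y) powr (p / s - 1) * z)"
    proof (cases "X + z = 0")
      case False
      have "(X + z) powr (p / s) \<le> X powr (p / s) + p / s * (X + z) powr (p / s - 1) * z"
        using powr_ge_tangent[of "p / s" "X + z" X] False XY z s by (simp add: algebra_simps)
      also have "p / s * (X + z) powr (p / s - 1) * z \<le> p / s * (X + Y) powr (p / s - 1) * z"
        using z XY s by (intro mult_right_mono mult_left_mono powr_mono2) auto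
      finally show ?thesis by simp
    qed (use XY z s in auto)
    also have "X powr (p / s) = \<phi> 0"
      using s E_nonneg[of f] by (simp add: X_def \<phi>_def powr_powr)
    finally show ?thesis by (simp add: C_def z_def algebra_simps)
  qed
  have "\<exists>d. (\<phi> has_real_derivative d) (at 0)"
    by (rule convex_symmetric_differentiable[OF conv s(1) smooth]) auto
  then obtain d where d: "(\<phi> has_real_derivative d) (at 0)" by (elim exE)
  have "D f g = d" unfolding D_def by (rule DERIV_imp_deriv[OF d[unfolded \<phi>_def]])
  then show ?thesis using d by (simp add: \<phi>_def)
qed

lemma D_eqI: "((\<lambda>t. E (\<lambda>i. f i + t * g i)) has_real_derivative d) (at 0) \<Longrightarrow> D f g = d"
  unfolding D_def by (rule DERIV_imp_deriv)

lemma D_cong: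
  assumes "\<And>i. i \<in> letters \<Longrightarrow> f i = f' i" "\<And>i. i \<in> letters \<Longrightarrow> g i = g' i"
  shows "D f g = D f' g'"
proof -
  have "E (\<lambda>i. f i + t * g i) = E (\<lambda>i. f' i + t * g' i)" for t
    using assms by (intro E_cong) auto
  then show ?thesis by (simp add: D_def)
qed

lemma D_scale: "D f (\<lambda>i. c * g i) = c * D f g"
proof (rule D_eqI)
  have "((\<lambda>t. E (\<lambda>i. f i + t * g i)) \<circ> (\<lambda>t. c * t) has_real_derivative D f g * c) (at 0)"
    using D_has_derivative[of f g] by (intro DERIV_chain) (auto intro!: derivative_eq_intros)
  then show "((\<lambda>t. E (\<lambda>i. f i + t * (c * g i))) has_real_derivative c * D f g) (at 0)"
    by (simp add: o_def mult_ac)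
qed

text \<open>Convexity turns directional derivatives into a linear functional: the midpoint defect is
  nonnegative and vanishes at \<open>t = 0\<close>, so its derivative is zero.\<close>

lemma D_add: "D f (\<lambda>i. g i + h i) = D f g + D f h"
proof -
  let ?G = "\<lambda>t. (E (\<lambda>i. f i + t * (2 * g i)) + E (\<lambda>i. f i + t * (2 * h i))) / 2 - E (\<lambda>i. f i + t * (g i + h i))"
  have "(?G has_real_derivative (D f (\<lambda>i. 2 * g i) + D f (\<lambda>i. 2 * h i)) / 2 - D f (\<lambda>i. g i + h i)) (at 0)"
    by (intro DERIV_diff DERIV_cdivide DERIV_add D_has_derivative)
  moreover have "?G 0 \<le> ?G t" for t
  proof -
    have "(\<lambda>i. f i + t * (g i + h i)) = (\<lambda>i. ((f i + t * (2 * g i)) + (f i + t * (2 * h i))) / 2)"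
      by (auto simp: field_simps)
    then show ?thesis using E_midpoint[of "\<lambda>i. f i + t * (2 * g i)" "\<lambda>i. f i + t * (2 * h i)"] by simp
  qed
  ultimately have "(D f (\<lambda>i. 2 * g i) + D f (\<lambda>i. 2 * h i)) / 2 - D f (\<lambda>i. g i + h i) = 0"
    by (rule deriv_zero_of_min)
  then show ?thesis by (simp add: D_scale)
qed

lemma D_add_const: "D (\<lambda>i. f i + c) g = D f g"
proof -
  have "(\<lambda>i. f i + c + t * g i) = (\<lambda>i. f i + t * g i + c)" for t by auto
  then have "E (\<lambda>i. f i + c + t * g i) = E (\<lambda>i. f i + t * g i)" for t by (simp add: E_add_const)
  then show ?thesis by (simp add: D_def)
qed

lemma D_const_right: "D f (\<lambda>_. c) = 0"
  by (rule D_eqI) (simp add: E_add_const)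

lemma D_sum_units:
  assumes "letters = {i, j, k}"
  shows "D f (unit_at i) + D f (unit_at j) + D f (unit_at k) = 0"
proof -
  have d: "i \<noteq> j" "i \<noteq> k" "j \<noteq> k"
    using arg_cong[OF assms, of card] by (auto simp: card_insert_if split: if_splits)
  have "0 = D f (\<lambda>_. 1)" by (simp add: D_const_right)
  also have "\<dots> = D f (\<lambda>l. (unit_at i l + unit_at j l) + unit_at k l)"
  proof (rule D_cong)
    fix l assume "l \<in> letters"
    then have "l \<in> {i, j, k}" by (simp only: assms)
    then show "1 = (unit_at i l + unit_at j l) + unit_at k l" using d by auto
  qed simp
  also have "\<dots> = D f (unit_at i) + D f (unit_at j) + D f (unit_at k)"
    by (simp only: D_add)
  finally show ?thesis by simp
qed

text \<open>Infinitesimal submodularity: the minimum of \<open>f + t * h\<close> and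
  \<open>g\<close> is \<open>f\<close> and the maximum is \<open>g + t * h\<close>, so adding
  \<open>t * h\<close> raises the energy of \<open>f\<close> at least as much as that of
  \<open>g\<close>.\<close>

lemma D_antimono:
  assumes le: "\<And>i. i \<in> letters \<Longrightarrow> f i \<le> g i" and h: "\<And>i. i \<in> letters \<Longrightarrow> 0 \<le> h i"
    and eq: "\<And>i. i \<in> letters \<Longrightarrow> h i \<noteq> 0 \<Longrightarrow> f i = g i"
  shows "D g h \<le> D f h"
proof -
  let ?G = "\<lambda>t. E (\<lambda>i. f i + t * h i) - E (\<lambda>i. g i + t * h i)"
  have "(?G has_real_derivative D f h - D g h) (at 0)"
    by (intro derivative_intros D_has_derivative)
  moreover have "?G 0 \<le> ?G t" if t: "0 < t" for t
  proof -
    have "E (\<lambda>i. min (f i + t * h i) (g i)) = E f" "E (\<lambda>i. max (f i + t * h i) (g i)) = E (\<lambda>i. g i + t * h i)"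
    proof -
      have *: "min (f i + t * h i) (g i) = f i \<and> max (f i + t * h i) (g i) = g i + t * h i"
        if i: "i \<in> letters" for i
      proof (cases "h i = 0")
        case False
        then show ?thesis using eq[OF i False] h[OF i] t by simp
      qed (use le[OF i] in auto)
      show "E (\<lambda>i. min (f i + t * h i) (g i)) = E f"
        by (rule E_cong) (rule conjunct1[OF *])
      show "E (\<lambda>i. max (f i + t * h i) (g i)) = E (\<lambda>i. g i + t * h i)"
        by (rule E_cong) (rule conjunct2[OF *])
    qed
    then show ?thesis using E_min_max[of "\<lambda>i. f i + t * h i" g] by simp
  qed
  ultimately have "0 \<le> D f h - D g h" by (rule deriv_nonneg_of_right_min) auto
  then show ?thesis by simp
qed

lemma E_tangent: "E f + D f g \<le> E (\<lambda>i. f i + g i)"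
proof -
  let ?G = "\<lambda>t. E f + t * (E (\<lambda>i. f i + g i) - E f) - E (\<lambda>i. f i + t * g i)"
  have "(?G has_real_derivative (E (\<lambda>i. f i + g i) - E f) - D f g) (at 0)"
    by (rule derivative_eq_intros D_has_derivative refl)+ simp
  moreover have "?G 0 \<le> ?G t" if "0 < t" "t < 1" for t
  proof -
    have "(\<lambda>i. f i + t * g i) = (\<lambda>i. t * (f i + g i) + (1 - t) * f i)" by (auto simp: algebra_simps)
    then show ?thesis using E_convex_comb[of t "\<lambda>i. f i + g i" f] that by (simp add: algebra_simps)
  qed
  ultimately have "0 \<le> (E (\<lambda>i. f i + g i) - E f) - D f g" by (rule deriv_nonneg_of_right_min)
  then show ?thesis by simp
qed

text \<open>If the derivative did not increase, the tangents at the two ends would push the midpoint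
  energy up to the mean, against strict midpoint convexity.\<close>

lemma D_strict_mono:
  assumes c: "0 < c" and h: "E h \<noteq> 0"
  shows "D f h < D (\<lambda>i. f i + c * h i) h"
proof -
  let ?g = "\<lambda>i. f i + c * h i" and ?m = "\<lambda>i. f i + c / 2 * h i"
  have "E (\<lambda>i. ?g i - f i) \<noteq> 0" using c h by (simp add: E_scale)
  then have "E (\<lambda>i. (?g i + f i) / 2) < (E ?g + E f) / 2" by (rule E_midpoint_strict)
  moreover have m: "(\<lambda>i. (?g i + f i) / 2) = ?m" by (auto simp: field_simps)
  ultimately have mid: "2 * E ?m < E ?g + E f" by (simp only: m) simp
  have left: "E f + c / 2 * D f h \<le> E ?m"
    using E_tangent[of f "\<lambda>i. c / 2 * h i"] by (simp only: D_scale)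
  have right: "E ?g + - (c / 2) * D ?g h \<le> E ?m"
  proof -
    have "E ?g + D ?g (\<lambda>i. - (c / 2) * h i) \<le> E (\<lambda>i. ?g i + - (c / 2) * h i)" by (rule E_tangent)
    moreover have "(\<lambda>i. ?g i + - (c / 2) * h i) = ?m" by (auto simp: field_simps)
    ultimately show ?thesis by (simp only: D_scale)
  qed
  show ?thesis
  proof (rule ccontr)
    assume "\<not> D f h < D ?g h"
    then have "c / 2 * D ?g h \<le> c / 2 * D f h" using c by (intro mult_left_mono) auto
    then show False using mid left right by simp
  qed
qed

lemma E_unit_at:
  assumes i: "i \<in> letters"
  shows "E (unit_at i) \<noteq> 0"
proof -
  define j :: nat where "j = (if i = 1 then 2 else 1)"
  have "j \<in> letters" "j \<noteq> i" by (simp_all add: j_def)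
  with i have "0 < E (unit_at i)"
    by - (rule E_pos[of i j "unit_at i"], simp_all)
  then show ?thesis by simp
qed

text \<open>Without a second contact, \<open>f\<close> can be raised by some \<open>c > 0\<close> at
  the two other vertices and still stay below \<open>g\<close>. Up to an additive constant this
  lowers \<open>f\<close> at \<open>i\<close>, so the flux there strictly decreases; by
  \<open>D_antimono\<close> it nevertheless stays at least the flux of \<open>g\<close>.\<close>

lemma equal_flux_imp_contact:
  assumes le_all: "\<forall>i\<in>letters. f i \<le> g i"
    and i: "i \<in> letters" and eq: "f i = g i" and flux: "D f (unit_at i) = D g (unit_at i)"
  shows "\<exists>j\<in>letters. j \<noteq> i \<and> f j = g j"
proof (rule ccontr)
  note le = le_all[rule_format]
  assume neq: "\<not> (\<exists>j\<in>letters. j \<noteq> i \<and> f j = g j)"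
  have lt: "0 < g j - f j" if j: "j \<in> letters - {i}" for j
  proof -
    have "j \<in> letters" "j \<noteq> i" using j by blast+
    then show ?thesis using le[of j] neq by (metis diff_gt_0_iff_gt less_eq_real_def)
  qed
  have "(if i = 1 then 2 else 1) \<in> letters - {i}" by simp
  then have fin: "finite (letters - {i})" "letters - {i} \<noteq> {}" by blast+
  define c where "c = Min ((\<lambda>j. g j - f j) ` (letters - {i}))"
  have c: "0 < c" "\<And>j. j \<in> letters - {i} \<Longrightarrow> c \<le> g j - f j"
  proof -
    have fin': "finite ((\<lambda>j. g j - f j) ` (letters - {i}))" "(\<lambda>j. g j - f j) ` (letters - {i}) \<noteq> {}"
      using fin by (simp_all only: finite_imageI image_is_empty not_False_eq_True)
    show "0 < c" unfolding c_def Min_gr_iff[OF fin'] using lt by blast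
    show "c \<le> g j - f j" if "j \<in> letters - {i}" for j
      unfolding c_def using fin'(1) that by (intro Min_le) blast+
  qed
  define f' where "f' = (\<lambda>j. f j + (- c) * unit_at i j)"
  have "D g (unit_at i) \<le> D (\<lambda>j. f' j + c) (unit_at i)"
  proof (rule D_antimono)
    fix j assume j: "j \<in> letters"
    show "f' j + c \<le> g j" using c(2)[of j] eq j by (cases "j = i") (auto simp: f'_def)
    show "(if j = i then 1 else 0 :: real) \<noteq> 0 \<Longrightarrow> f' j + c = g j"
      using eq by (auto simp: f'_def split: if_splits)
  qed auto
  also have "\<dots> = D f' (unit_at i)" by (rule D_add_const)
  also have "\<dots> < D (\<lambda>j. f' j + c * unit_at i j) (unit_at i)"
    by (rule D_strict_mono[OF c(1) E_unit_at[OF i]])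
  also have "(\<lambda>j. f' j + c * unit_at i j) = f" by (auto simp: f'_def)
  finally show False using flux by simp
qed

text \<open>The fluxes sum to zero, hence agree at the third vertex \<open>k\<close>. As
  \<open>g - f\<close> is a multiple of \<open>unit_at k\<close>, a positive multiple would strictly
  increase the flux.\<close>

lemma two_contacts_imp_equal:
  assumes le_all: "\<forall>i\<in>letters. f i \<le> g i"
    and ij: "i \<in> letters" "j \<in> letters" "i \<noteq> j" and eq: "f i = g i" "f j = g j"
    and flux: "D f (unit_at i) = D g (unit_at i)" "D f (unit_at j) = D g (unit_at j)"
    and l: "l \<in> letters"
  shows "f l = g l"
proof -
  note le = le_all[rule_format]
  from third_letter[OF ij] obtain k where k: "k \<in> letters" "k \<noteq> i" "k \<noteq> j" "letters = {i, j, k}"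
    by (elim bexE conjE)
  have fl: "D f (unit_at k) = D g (unit_at k)"
    using D_sum_units[OF k(4), of f] D_sum_units[OF k(4), of g] flux by simp
  have "f k = g k"
  proof (rule ccontr)
    assume "f k \<noteq> g k"
    then have c: "0 < g k - f k" using le[OF k(1)] by simp
    have "D f (unit_at k) < D (\<lambda>i. f i + (g k - f k) * unit_at k i) (unit_at k)"
      by (rule D_strict_mono[OF c E_unit_at[OF k(1)]])
    also have "\<dots> = D g (unit_at k)"
    proof (rule D_cong)
      fix l assume "l \<in> letters"
      then have "l \<in> {i, j, k}" by (simp only: k(4))
      then show "f l + (g k - f k) * unit_at k l = g l" using eq k(2,3) by auto
    qed simp
    finally show False using fl by simp
  qed
  moreover have "l \<in> {i, j, k}" using l by (simp only: k(4))
  ultimately show ?thesis using eq by blast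
qed

lemma E_clip_upper: "E (\<lambda>i. min (f i) c) \<le> E f"
  using E_min_max[of f "\<lambda>_. c"] E_nonneg[of "\<lambda>i. max (f i) c"] by (simp add: E_const)

lemma E_clip_lower: "E (\<lambda>i. max (f i) c) \<le> E f"
  using E_min_max[of f "\<lambda>_. c"] E_nonneg[of "\<lambda>i. min (f i) c"] by (simp add: E_const)

text \<open>The seminorm \<open>E powr (1 / p)\<close> is Lipschitz in the three values, being
  bounded through its values at the unit functions.\<close>

lemma E_continuous_on:
  fixes F :: "nat \<Rightarrow> 'a::topological_space \<Rightarrow> real"
  assumes cont: "\<And>i. i \<in> letters \<Longrightarrow> continuous_on S (F i)"
  shows "continuous_on S (\<lambda>x. E (\<lambda>i. F i x))"
proof -
  let ?N = "\<lambda>f. E f powr (1 / p)"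
  have scale: "?N (\<lambda>i. c * f i) = \<bar>c\<bar> * ?N f" for c f
    using p E_nonneg by (simp add: E_scale powr_mult powr_powr)
  have bound: "?N f \<le> \<bar>f 1\<bar> * ?N (unit_at 1) + (\<bar>f 2\<bar> * ?N (unit_at 2) + \<bar>f 3\<bar> * ?N (unit_at 3))" for f
  proof -
    have "E f = E (\<lambda>i. f 1 * unit_at 1 i + (f 2 * unit_at 2 i + f 3 * unit_at 3 i))"
      by (intro E_cong) auto
    then show ?thesis
      using E_triangle[of "\<lambda>i. f 1 * unit_at 1 i" "\<lambda>i. f 2 * unit_at 2 i + f 3 * unit_at 3 i"]
        E_triangle[of "\<lambda>i. f 2 * unit_at 2 i" "\<lambda>i. f 3 * unit_at 3 i"]
      by (simp only: scale)
  qed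
  have diff: "\<bar>?N f - ?N g\<bar> \<le> ?N (\<lambda>i. f i - g i)" for f g
  proof -
    have "?N f \<le> ?N g + ?N (\<lambda>i. f i - g i)" using E_triangle[of g "\<lambda>i. f i - g i"] by simp
    moreover have "?N g \<le> ?N f + ?N (\<lambda>i. g i - f i)" using E_triangle[of f "\<lambda>i. g i - f i"] by simp
    moreover have "?N (\<lambda>i. g i - f i) = ?N (\<lambda>i. f i - g i)" using scale[of "-1" "\<lambda>i. f i - g i"] by simp
    ultimately show ?thesis by linarith
  qed
  have "continuous_on S (\<lambda>x. ?N (\<lambda>i. F i x))"
    unfolding continuous_on_def
  proof
    fix x assume x: "x \<in> S"
    have t: "((\<lambda>y. F i y - F i x) \<longlongrightarrow> 0) (at x within S)" if "i \<in> letters" for i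
      using cont[OF that] x by (simp add: continuous_on_def LIM_zero_iff)
    have "((\<lambda>y. ?N (\<lambda>i. F i y) - ?N (\<lambda>i. F i x)) \<longlongrightarrow> 0) (at x within S)"
    proof (rule Lim_null_comparison)
      show "\<forall>\<^sub>F y in at x within S. norm (?N (\<lambda>i. F i y) - ?N (\<lambda>i. F i x)) \<le>
         \<bar>F 1 y - F 1 x\<bar> * ?N (unit_at 1) + (\<bar>F 2 y - F 2 x\<bar> * ?N (unit_at 2) + \<bar>F 3 y - F 3 x\<bar> * ?N (unit_at 3))"
      proof (intro always_eventually allI)
        fix y
        show "norm (?N (\<lambda>i. F i y) - ?N (\<lambda>i. F i x)) \<le>
         \<bar>F 1 y - F 1 x\<bar> * ?N (unit_at 1) + (\<bar>F 2 y - F 2 x\<bar> * ?N (unit_at 2) + \<bar>F 3 y - F 3 x\<bar> * ?N (unit_at 3))"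
          unfolding real_norm_def
          by (rule order_trans[OF diff bound])
      qed
      have "((\<lambda>y. \<bar>F 1 y - F 1 x\<bar> * ?N (unit_at 1) + (\<bar>F 2 y - F 2 x\<bar> * ?N (unit_at 2) + \<bar>F 3 y - F 3 x\<bar> * ?N (unit_at 3)))
        \<longlongrightarrow> \<bar>0\<bar> * ?N (unit_at 1) + (\<bar>0\<bar> * ?N (unit_at 2) + \<bar>0\<bar> * ?N (unit_at 3))) (at x within S)"
        by (intro tendsto_intros t) auto
      then show "((\<lambda>y. \<bar>F 1 y - F 1 x\<bar> * ?N (unit_at 1) + (\<bar>F 2 y - F 2 x\<bar> * ?N (unit_at 2) + \<bar>F 3 y - F 3 x\<bar> * ?N (unit_at 3)))
        \<longlongrightarrow> 0) (at x within S)" by simp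
    qed
    then show "((\<lambda>x. ?N (\<lambda>i. F i x)) \<longlongrightarrow> ?N (\<lambda>i. F i x)) (at x within S)" by (simp add: LIM_zero_iff)
  qed
  then have "continuous_on S (\<lambda>x. ?N (\<lambda>i. F i x) powr p)"
    by (rule continuous_on_powr'[OF _ continuous_on_const]) (use p in auto)
  then show ?thesis using p E_nonneg by (simp add: powr_powr)
qed

end

section \<open>Comparison of fluxes for a renormalization fixed point\<close>

text \<open>The fixed point equation appears as the two properties of an infimum:
  \<open>trace_le\<close> is the lower bound, \<open>trace_approx\<close> says that it is
  approached. That it is attained is proved below.\<close>

locale renormalized_form = three_point_form +
  fixes \<rho> :: real
  assumes rho: "0 < \<rho>"
    and trace_le: "(\<And>i j. i \<in> letters \<Longrightarrow> j \<in> letters \<Longrightarrow> A i j = A j i)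
      \<Longrightarrow> E (\<lambda>i. A i i) \<le> \<rho> * (\<Sum>i\<in>letters. E (A i))"
    and trace_approx: "0 < e \<Longrightarrow> \<exists>A. (\<forall>i\<in>letters. \<forall>j\<in>letters. A i j = A j i) \<and>
      (\<forall>i\<in>letters. A i i = f i) \<and> \<rho> * (\<Sum>i\<in>letters. E (A i)) \<le> E f + e"
begin

text \<open>A function on the first level vertices is a symmetric matrix on the letters: the entry
  \<open>A i j\<close> is the value at the common image of vertex \<open>j\<close> under map \<open>i\<close> and of vertex \<open>i\<close> under
  map \<open>j\<close>, and the diagonal gives the values at the outer vertices.\<close>

definition minimal :: "(nat \<Rightarrow> nat \<Rightarrow> real) \<Rightarrow> bool" where
  "minimal A \<longleftrightarrow> (\<forall>i\<in>letters. \<forall>j\<in>letters. A i j = A j i) \<and>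
    \<rho> * (\<Sum>i\<in>letters. E (A i)) = E (\<lambda>i. A i i)"

lemma minimal_sym: "minimal A \<Longrightarrow> i \<in> letters \<Longrightarrow> j \<in> letters \<Longrightarrow> A i j = A j i"
  unfolding minimal_def by blast

lemma minimal_energy: "minimal A \<Longrightarrow> \<rho> * (\<Sum>i\<in>letters. E (A i)) = E (\<lambda>i. A i i)"
  unfolding minimal_def by blast

lemma minimalI:
  assumes "\<And>i j. i \<in> letters \<Longrightarrow> j \<in> letters \<Longrightarrow> A i j = A j i"
    and "\<rho> * (\<Sum>i\<in>letters. E (A i)) \<le> E (\<lambda>i. A i i)"
  shows "minimal A"
  unfolding minimal_def
proof (intro conjI ballI assms(1) antisym assms(2))
  show "E (\<lambda>i. A i i) \<le> \<rho> * (\<Sum>i\<in>letters. E (A i))" by (rule trace_le) (rule assms(1))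
qed

text \<open>Clipping the midpoint values to the range of \<open>f\<close> does not raise the energy,
  so it suffices to minimize a continuous function over a compact cube of midpoint values.\<close>

lemma minimal_extension_exists: "\<exists>A. minimal A \<and> (\<forall>i\<in>letters. A i i = f i)"
proof -
  define m where "m = min (f 1) (min (f 2) (f 3))"
  define M where "M = max (f 1) (max (f 2) (f 3))"
  have fmM: "m \<le> f i" "f i \<le> M" if "i \<in> letters" for i using that by (auto simp: m_def M_def)
  have mM: "m \<le> M" using fmM[of 1] by simp
  \<comment> \<open>The index sums 3, 4 and 5 name the midpoints between vertices 1 and 2, 1 and 3,
    2 and 3, which makes the matrix symmetric by construction.\<close>
  define B where "B = (\<lambda>(x :: real \<times> real \<times> real) (i::nat) (j::nat). if i = j then f i
      else if i + j = 3 then fst x else if i + j = 4 then fst (snd x) else snd (snd x))"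
  define \<Phi> where "\<Phi> = (\<lambda>x. \<rho> * (E (B x 1) + E (B x 2) + E (B x 3)))"
  have B_sym: "B x i j = B x j i" for x i j by (simp add: B_def add.commute)
  let ?S = "{m..M} \<times> {m..M} \<times> {m..M}"
  have "continuous_on ?S \<Phi>"
  proof -
    have "continuous_on ?S (\<lambda>x. B x i j)" for i j
      by (cases "i = j"; cases "i + j = 3"; cases "i + j = 4")
        (simp_all add: B_def continuous_on_fst continuous_on_snd)
    then have "continuous_on ?S (\<lambda>x. E (\<lambda>j. B x i j))" for i by (intro E_continuous_on)
    then show ?thesis unfolding \<Phi>_def by (intro continuous_intros)
  qed
  moreover have "compact ?S" by (intro compact_Times compact_Icc)
  moreover have "?S \<noteq> {}" using mM by auto
  ultimately obtain x where x: "x \<in> ?S" and xmin: "\<And>y. y \<in> ?S \<Longrightarrow> \<Phi> x \<le> \<Phi> y"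
    using continuous_attains_inf[of ?S \<Phi>] by blast
  have le: "\<Phi> x \<le> \<rho> * (\<Sum>i\<in>letters. E (A i))"
    if A: "\<And>i j. i \<in> letters \<Longrightarrow> j \<in> letters \<Longrightarrow> A i j = A j i"
      "\<And>i. i \<in> letters \<Longrightarrow> A i i = f i" for A
  proof -
    define c where "c = (\<lambda>a. max (min a M) m)"
    define y where "y = (c (A 1 2), c (A 1 3), c (A 2 3))"
    have cin: "c a \<in> {m..M}" for a using mM by (auto simp: c_def)
    have y: "y \<in> ?S" using cin by (simp add: y_def)
    have cf: "c (f i) = f i" if "i \<in> letters" for i using fmM[OF that] by (simp add: c_def)
    have "B y i j = c (A i j)" if "i \<in> letters" "j \<in> letters" for i j
    proof -
      have "i = 1 \<or> i = 2 \<or> i = 3" "j = 1 \<or> j = 2 \<or> j = 3" using that by simp_all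
      then show ?thesis using A(1)[of 1 2] A(1)[of 1 3] A(1)[of 2 3] A(2)[of 1] A(2)[of 2] A(2)[of 3]
         cf[of 1] cf[of 2] cf[of 3]
        by (elim disjE) (simp_all add: B_def y_def)
    qed
    then have "E (B y i) = E (\<lambda>j. c (A i j))" if "i \<in> letters" for i using that by (intro E_cong)
    moreover have "E (\<lambda>j. c (A i j)) \<le> E (A i)" for i
      unfolding c_def using E_clip_lower[of "\<lambda>j. min (A i j) M" m] E_clip_upper[of "A i" M] by linarith
    ultimately have "E (B y i) \<le> E (A i)" if "i \<in> letters" for i using that by metis
    from this[of 1] this[of 2] this[of 3] have "E (B y 1) + E (B y 2) + E (B y 3) \<le> E (A 1) + E (A 2) + E (A 3)" by simp
    then have "\<Phi> y \<le> \<rho> * (\<Sum>i\<in>letters. E (A i))"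
      unfolding \<Phi>_def sum_letters using rho by (intro mult_left_mono) auto
    then show ?thesis using xmin[OF y] by simp
  qed
  have diag: "B x i i = f i" for i by (simp add: B_def)
  have "\<Phi> x \<le> E f + e" if e: "0 < e" for e
  proof -
    from trace_approx[OF e, of f] obtain A where A: "\<forall>i\<in>letters. \<forall>j\<in>letters. A i j = A j i"
      "\<forall>i\<in>letters. A i i = f i" "\<rho> * (\<Sum>i\<in>letters. E (A i)) \<le> E f + e"
      by (elim exE conjE)
    have "\<Phi> x \<le> \<rho> * (\<Sum>i\<in>letters. E (A i))"
      by (rule le) (rule A(1)[rule_format] A(2)[rule_format]; assumption)+
    then show ?thesis using A(3) by (rule order_trans)
  qed
  then have "\<Phi> x \<le> E f" by (rule field_le_epsilon)
  then have "minimal (B x)"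
    by (intro minimalI B_sym) (simp only: \<Phi>_def sum_letters diag)
  then show ?thesis using diag by blast
qed

text \<open>Minimum and maximum of arbitrary minimizers are again minimizers: submodularity bounds
  the sum of their energies by the sum of the two minimal values, and their diagonals are still
  \<open>f\<close> and \<open>g\<close>.\<close>

lemma minimal_pair:
  assumes le_all: "\<forall>i\<in>letters. f i \<le> g i"
  shows "\<exists>A B. minimal A \<and> minimal B \<and> (\<forall>i\<in>letters. A i i = f i) \<and> (\<forall>i\<in>letters. B i i = g i) \<and>
    (\<forall>i\<in>letters. \<forall>j\<in>letters. A i j \<le> B i j)"
proof -
  note le = le_all[rule_format]
  obtain A0 where A0: "minimal A0" "\<And>i. i \<in> letters \<Longrightarrow> A0 i i = f i"
    using minimal_extension_exists[of f] by blast
  obtain B0 where B0: "minimal B0" "\<And>i. i \<in> letters \<Longrightarrow> B0 i i = g i"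
    using minimal_extension_exists[of g] by blast
  define A where "A = (\<lambda>i j. min (A0 i j) (B0 i j))"
  define B where "B = (\<lambda>i j. max (A0 i j) (B0 i j))"
  have sym: "A i j = A j i" "B i j = B j i" if "i \<in> letters" "j \<in> letters" for i j
    using minimal_sym[OF A0(1) that] minimal_sym[OF B0(1) that] by (auto simp: A_def B_def)
  have diag: "A i i = f i" "B i i = g i" if "i \<in> letters" for i
    using A0(2)[OF that] B0(2)[OF that] le[OF that] by (auto simp: A_def B_def)
  have "E (A i) + E (B i) \<le> E (A0 i) + E (B0 i)" for i
    unfolding A_def B_def by (rule E_min_max)
  from this[of 1] this[of 2] this[of 3]
  have "(\<Sum>i\<in>letters. E (A i)) + (\<Sum>i\<in>letters. E (B i)) \<le> (\<Sum>i\<in>letters. E (A0 i)) + (\<Sum>i\<in>letters. E (B0 i))"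
    unfolding sum_letters by simp
  then have "\<rho> * ((\<Sum>i\<in>letters. E (A i)) + (\<Sum>i\<in>letters. E (B i)))
      \<le> \<rho> * ((\<Sum>i\<in>letters. E (A0 i)) + (\<Sum>i\<in>letters. E (B0 i)))"
    using rho by (intro mult_left_mono) auto
  moreover have "\<rho> * (\<Sum>i\<in>letters. E (A0 i)) = E (\<lambda>i. A i i)"
    unfolding minimal_energy[OF A0(1)] using A0(2) diag(1) by (intro E_cong) (simp del: insert_iff)
  moreover have "\<rho> * (\<Sum>i\<in>letters. E (B0 i)) = E (\<lambda>i. B i i)"
    unfolding minimal_energy[OF B0(1)] using B0(2) diag(2) by (intro E_cong) (simp del: insert_iff)
  moreover have "E (\<lambda>i. A i i) \<le> \<rho> * (\<Sum>i\<in>letters. E (A i))" "E (\<lambda>i. B i i) \<le> \<rho> * (\<Sum>i\<in>letters. E (B i))"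
    using sym by (intro trace_le, blast)+
  ultimately have energy: "\<rho> * (\<Sum>i\<in>letters. E (A i)) \<le> E (\<lambda>i. A i i)" "\<rho> * (\<Sum>i\<in>letters. E (B i)) \<le> E (\<lambda>i. B i i)"
    unfolding distrib_left by linarith+
  have "minimal A" by (rule minimalI[OF _ energy(1)]) (rule sym(1))
  moreover have "minimal B" by (rule minimalI[OF _ energy(2)]) (rule sym(2))
  moreover have "A i j \<le> B i j" for i j by (simp add: A_def B_def)
  ultimately show ?thesis
    by (intro exI[of _ A] exI[of _ B] conjI ballI diag)
qed

text \<open>The weak equation of a minimizer, also for variations that move the outer values: the
  energy of \<open>A + t * h\<close> minus the energy of its diagonal is nonnegative and vanishes at
  \<open>t = 0\<close>.\<close>

lemma sum_D_minimal:
  assumes A: "minimal A" and h_sym: "\<And>i j. i \<in> letters \<Longrightarrow> j \<in> letters \<Longrightarrow> h i j = h j i"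
  shows "\<rho> * (\<Sum>i\<in>letters. D (A i) (h i)) = D (\<lambda>i. A i i) (\<lambda>i. h i i)"
proof -
  let ?G = "\<lambda>t. \<rho> * (\<Sum>i\<in>letters. E (\<lambda>j. A i j + t * h i j)) - E (\<lambda>i. A i i + t * h i i)"
  have "(?G has_real_derivative \<rho> * (\<Sum>i\<in>letters. D (A i) (h i)) - D (\<lambda>i. A i i) (\<lambda>i. h i i)) (at 0)"
    by (intro DERIV_diff DERIV_cmult DERIV_sum D_has_derivative)
  moreover have "?G 0 \<le> ?G t" for t
  proof -
    have "E (\<lambda>i. A i i + t * h i i) \<le> \<rho> * (\<Sum>i\<in>letters. E (\<lambda>j. A i j + t * h i j))"
      using minimal_sym[OF A] h_sym by (intro trace_le) (simp del: insert_iff)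
    moreover have "\<rho> * (\<Sum>i\<in>letters. E (\<lambda>j. A i j + 0 * h i j)) = E (\<lambda>i. A i i + 0 * h i i)"
      using minimal_energy[OF A] by simp
    ultimately show ?thesis by linarith
  qed
  ultimately have "\<rho> * (\<Sum>i\<in>letters. D (A i) (h i)) - D (\<lambda>i. A i i) (\<lambda>i. h i i) = 0"
    by (rule deriv_zero_of_min)
  then show ?thesis by simp
qed

lemma D_zero_right: "(\<And>i. i \<in> letters \<Longrightarrow> h i = 0) \<Longrightarrow> D f h = 0"
  using D_cong[of f f h "\<lambda>_. 0"] D_const_right[of f 0] by simp

text \<open>Kirchhoff's law at a midpoint: a variation at this single point occupies the entries
  \<open>(i, j)\<close> and \<open>(j, i)\<close>.\<close>

lemma minimal_interior:
  assumes A: "minimal A" and ij: "i \<in> letters" "j \<in> letters" "i \<noteq> j"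
  shows "D (A i) (unit_at j) + D (A j) (unit_at i) = 0"
proof -
  define h where "h = (\<lambda>k l. if k = i then unit_at j l else if k = j then unit_at i l else 0)"
  have h_sym: "h k l = h l k" for k l using ij(3) by (auto simp: h_def)
  have "\<rho> * (\<Sum>k\<in>letters. D (A k) (h k)) = D (\<lambda>i. A i i) (\<lambda>i. h i i)"
    by (rule sum_D_minimal[OF A h_sym])
  also have "\<dots> = 0" using ij(3) by (intro D_zero_right) (auto simp: h_def)
  finally have "(\<Sum>k\<in>letters. D (A k) (h k)) = 0" using rho by simp
  moreover obtain k where k: "k \<in> letters" "k \<noteq> i" "k \<noteq> j" "letters = {i, j, k}"
    using third_letter[OF ij] by (elim bexE conjE)
  moreover have "D (A k) (h k) = 0" using k(2,3) by (intro D_zero_right) (simp add: h_def)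
  moreover have "h i = unit_at j" "h j = unit_at i" using ij(3) by (auto simp: h_def)
  moreover have "(\<Sum>l\<in>{i, j, k}. D (A l) (h l)) = D (A i) (h i) + D (A j) (h j) + D (A k) (h k)"
    using ij(3) k(2,3) by simp
  ultimately show ?thesis by (simp only: add_0_right)
qed

text \<open>The outer vertex \<open>i\<close> belongs to cell \<open>i\<close> only, so a variation
  there involves one cell.\<close>

lemma minimal_boundary:
  assumes A: "minimal A" and i: "i \<in> letters"
  shows "D (\<lambda>i. A i i) (unit_at i) = \<rho> * D (A i) (unit_at i)"
proof -
  define h where "h = (\<lambda>k l. if k = i then unit_at i l else 0)"
  have "\<rho> * (\<Sum>k\<in>letters. D (A k) (h k)) = D (\<lambda>i. A i i) (\<lambda>i. h i i)"
    by (rule sum_D_minimal[OF A]) (auto simp: h_def)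
  moreover have "(\<lambda>i. h i i) = unit_at i" by (auto simp: h_def)
  moreover have "(\<Sum>k\<in>letters. D (A k) (h k)) = D (A i) (h i)"
  proof -
    have "(\<Sum>k\<in>letters. D (A k) (h k)) = (\<Sum>k\<in>{i}. D (A k) (h k))"
      using i by (intro sum.mono_neutral_right) (auto simp: h_def D_const_right)
    then show ?thesis by simp
  qed
  moreover have "h i = unit_at i" by (auto simp: h_def)
  ultimately show ?thesis by simp
qed

text \<open>Ordered contact gives the same one-sided inequality for the fluxes in both adjacent
  cells. Their sums vanish for \<open>A\<close> and for \<open>B\<close>, so both inequalities are
  equalities.\<close>

lemma minimal_contact_flux:
  assumes A: "minimal A" and B: "minimal B"
    and le_all: "\<forall>i\<in>letters. \<forall>j\<in>letters. A i j \<le> B i j"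
    and ij: "i \<in> letters" "j \<in> letters" "i \<noteq> j" and eq: "A i j = B i j"
  shows "D (A i) (unit_at j) = D (B i) (unit_at j)"
proof -
  note le = le_all[rule_format]
  have "D (B i) (unit_at j) \<le> D (A i) (unit_at j)"
    using le[OF ij(1)] eq by (intro D_antimono) (auto split: if_splits simp del: insert_iff)
  moreover have "D (B j) (unit_at i) \<le> D (A j) (unit_at i)"
    using le[OF ij(2)] eq minimal_sym[OF A ij(1,2)] minimal_sym[OF B ij(1,2)]
    by (intro D_antimono) (auto split: if_splits simp del: insert_iff)
  ultimately show ?thesis
    using minimal_interior[OF A ij] minimal_interior[OF B ij] by linarith
qed

text \<open>On the triangle itself, equal fluxes at \<open>i\<close> give one further contact, with
  an unknown flux there. The first level helps because at its interior contacts the fluxes agree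
  automatically.\<close>

lemma D_strong_comparison:
  assumes le: "\<forall>i\<in>letters. f i \<le> g i"
    and i: "i \<in> letters" and eq: "f i = g i" and flux: "D f (unit_at i) = D g (unit_at i)"
    and l: "l \<in> letters"
  shows "f l = g l"
proof -
  from minimal_pair[OF le] obtain A B where A: "minimal A" and B: "minimal B"
    and diagA_all: "\<forall>i\<in>letters. A i i = f i" and diagB_all: "\<forall>i\<in>letters. B i i = g i"
    and AB_all: "\<forall>i\<in>letters. \<forall>j\<in>letters. A i j \<le> B i j"
    by (elim exE conjE)
  note diagA = diagA_all[rule_format] and diagB = diagB_all[rule_format] and AB = bspec[OF AB_all]
  note contact = minimal_contact_flux[OF A B AB_all]
  have "D (\<lambda>i. A i i) (unit_at i) = D f (unit_at i)" "D (\<lambda>i. B i i) (unit_at i) = D g (unit_at i)"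
    using diagA diagB by (intro D_cong; simp del: insert_iff)+
  then have "\<rho> * D (A i) (unit_at i) = \<rho> * D (B i) (unit_at i)"
    using minimal_boundary[OF A i] minimal_boundary[OF B i] flux by (simp only:)
  then have flux_i: "D (A i) (unit_at i) = D (B i) (unit_at i)" using rho by simp
  have eq_i: "A i i = B i i" using diagA[OF i] diagB[OF i] eq by simp
  obtain j where j: "j \<in> letters" "j \<noteq> i" "A i j = B i j"
    using equal_flux_imp_contact[OF AB[OF i] i eq_i flux_i] by (elim bexE conjE)
  have cell_i: "A i l = B i l" if "l \<in> letters" for l
    by (rule two_contacts_imp_equal[OF AB[OF i] i j(1) j(2)[symmetric] eq_i j(3) flux_i
          contact[OF i j(1) j(2)[symmetric] j(3)] that])
  have other: "f k = g k" if k: "k \<in> letters" "k \<noteq> i" for k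
  proof -
    have ki: "A k i = B k i"
      using cell_i[OF k(1)] minimal_sym[OF A i k(1)] minimal_sym[OF B i k(1)] by simp
    have flux_k: "D (A k) (unit_at i) = D (B k) (unit_at i)" by (rule contact[OF k(1) i k(2) ki])
    obtain m where m: "m \<in> letters" "m \<noteq> i" "A k m = B k m"
      using equal_flux_imp_contact[OF AB[OF k(1)] i ki flux_k] by (elim bexE conjE)
    have "A k k = B k k"
    \<comment> \<open>In cell \<open>k\<close> the second contact is either the outer vertex
      \<open>k\<close>, as claimed, or the midpoint shared with the third cell, where
      \<open>contact\<close> supplies equal fluxes.\<close>
    proof (cases "m = k")
      case False
      show ?thesis
        by (rule two_contacts_imp_equal[OF AB[OF k(1)] i m(1) m(2)[symmetric] ki m(3) flux_k
          contact[OF k(1) m(1) False[symmetric] m(3)] k(1)])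
    qed (use m in simp)
    then show ?thesis using diagA[OF k(1)] diagB[OF k(1)] by simp
  qed
  show ?thesis by (cases "l = i") (use eq other l in auto)
qed

text \<open>In cell 1 the minimal extension of \<open>unit_at 1\<close> lies above
  \<open>unit_at 1\<close> and touches it at vertex 1, so its flux there is at most
  \<open>D ?u ?u\<close>. By \<open>minimal_boundary\<close> the latter is \<rho> times this flux,
  and the strong comparison excludes equality.\<close>

lemma rho_gt_1: "1 < \<rho>"
proof -
  have one: "(1::nat) \<in> letters" and two: "(2::nat) \<in> letters" by simp_all
  have le0: "\<forall>i\<in>letters. (0::real) \<le> unit_at 1 i" by simp
  from minimal_pair[OF le0] obtain A0 A
    where A0: "minimal A0" and A: "minimal A" and diag0_all: "\<forall>i\<in>letters. A0 i i = 0"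
    and diag_all: "\<forall>i\<in>letters. A i i = unit_at 1 i"
    and ge_all: "\<forall>i\<in>letters. \<forall>j\<in>letters. A0 i j \<le> A i j"
    by (elim exE conjE)
  note diag0 = diag0_all[rule_format] and diag = diag_all[rule_format] and ge = ge_all[rule_format]
  have zero: "A0 i j = 0" if ij: "i \<in> letters" "j \<in> letters" for i j
  proof -
    have "E (\<lambda>i. A0 i i) = E (\<lambda>_. 0)" using diag0 by (intro E_cong)
    then have "(\<Sum>i\<in>letters. E (A0 i)) = 0" using minimal_energy[OF A0] rho by (simp add: E_const)
    then have "E (A0 i) = 0" using E_nonneg ij(1) by (subst (asm) sum_nonneg_eq_0_iff) (blast | simp)+
    then obtain c where c: "\<And>l. l \<in> letters \<Longrightarrow> A0 i l = c" unfolding E_eq_0_iff by blast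
    then show ?thesis using c[OF ij(1)] c[OF ij(2)] diag0[OF ij(1)] by simp
  qed
  have nonneg: "0 \<le> A i j" if "i \<in> letters" "j \<in> letters" for i j
    using ge[OF that] zero[OF that] by simp
  let ?u = "unit_at 1"
  have "D (\<lambda>i. A i i) ?u = D ?u ?u" by (rule D_cong[OF diag refl])
  then have eq: "D ?u ?u = \<rho> * D (A 1) ?u" using minimal_boundary[OF A one] by simp
  have pos: "0 < D ?u ?u"
  proof -
    have "E ?u + D ?u (\<lambda>i. - 1 * ?u i) \<le> E (\<lambda>i. ?u i + - 1 * ?u i)" by (rule E_tangent)
    then have "E ?u \<le> D ?u ?u" unfolding D_scale by (simp add: E_const)
    moreover have "0 < E ?u" using E_unit_at[OF one] E_nonneg[of ?u] by linarith
    ultimately show ?thesis by linarith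
  qed
  have A11: "A 1 1 = 1" using diag[OF one] by simp
  have ge_u: "\<forall>i\<in>letters. ?u i \<le> A 1 i"
  proof
    fix i assume "i \<in> letters"
    then show "?u i \<le> A 1 i" using nonneg[OF one, of i] A11 by simp
  qed
  have le: "D (A 1) ?u \<le> D ?u ?u"
  proof (rule D_antimono)
    fix i assume i: "i \<in> letters"
    show "?u i \<le> A 1 i" using ge_u i by (rule bspec)
    show "0 \<le> ?u i" by simp
    show "?u i = A 1 i" if "?u i \<noteq> 0" using that A11 by (cases "i = 1") auto
  qed
  have ne: "D (A 1) ?u \<noteq> D ?u ?u"
  proof
    \<comment> \<open>Equal fluxes would make \<open>A\<close> vanish at the midpoint of 1 and 2,
      hence touch the zero extension \<open>A0\<close> there; flux balance and a second comparison
      would then give \<open>A 1 1 = 0\<close>.\<close>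
    assume flux: "D (A 1) ?u = D ?u ?u"
    have "?u 2 = A 1 2" by (rule D_strong_comparison[OF ge_u one _ flux[symmetric] two]) (simp_all add: A11 del: One_nat_def)
    then have contact: "A0 1 2 = A 1 2" using zero[OF one two] by simp
    have f0: "D (A0 1) (unit_at 2) = D (A 1) (unit_at 2)"
      by (rule minimal_contact_flux[OF A0 A ge_all one two _ contact]) simp
    have "A0 1 1 = A 1 1" by (rule D_strong_comparison[OF bspec[OF ge_all one] two contact f0 one])
    then show False using A11 zero[OF one one] by simp
  qed
  have "0 < D (A 1) ?u" using eq pos rho by (metis zero_less_mult_pos)
  moreover have "D (A 1) ?u < \<rho> * D (A 1) ?u" using le ne eq by linarith
  ultimately show ?thesis by (simp add: mult_less_cancel_right2)
qed

end

section \<open>Cells of the gasket\<close>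

lemma contr_word_Nil [simp]: "contr_word q [] = id"
  by (simp add: contr_word_def)

lemma contr_word_Cons: "contr_word q (i # w) x = contr q i (contr_word q w x)"
  by (simp add: contr_word_def)

lemma contr_word_append: "contr_word q (v @ w) x = contr_word q v (contr_word q w x)"
  by (induction v) (simp_all add: contr_word_Cons)

lemma contr_self [simp]: "contr q i (q i) = q i"
  by (simp add: contr_def)

text \<open>The reason why functions on the first level vertices are symmetric matrices.\<close>

lemma contr_vertex_commute: "contr q i (q j) = contr q j (q i)"
  by (simp add: vec_eq_iff contr_def field_simps)

lemma contr_inverse: "2 *\<^sub>R contr q i x - q i = x"
  by (simp add: contr_def algebra_simps scaleR_2)

lemma contr_inj: "contr q i x = contr q i y \<Longrightarrow> x = y"
  by (metis contr_inverse)

lemma contr_word_inj: "contr_word q w x = contr_word q w y \<Longrightarrow> x = y"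
  by (induction w) (auto simp: contr_word_Cons dest: contr_inj)

lemma dist_contr: "dist (contr q i x) (contr q i y) = dist x y / 2"
proof -
  have "contr q i x - contr q i y = (1/2) *\<^sub>R (x - y)" by (simp add: contr_def algebra_simps)
  then show ?thesis by (simp add: dist_norm)
qed

lemma dist_contr_word: "dist (contr_word q w x) (contr_word q w y) = dist x y / 2 ^ length w"
  by (induction w) (simp_all add: contr_word_Cons dist_contr)

lemma continuous_on_contr: "continuous_on S (contr q i)"
  unfolding contr_def by (intro continuous_intros)

lemma continuous_on_contr_word: "continuous_on S (contr_word q w)"
proof (induction w)
  case (Cons i w)
  have eq: "contr_word q (i # w) = contr q i \<circ> contr_word q w" by (auto simp: contr_word_Cons)
  show ?case unfolding eq by (rule continuous_on_compose[OF Cons.IH continuous_on_contr])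
qed (simp add: id_def)

lemma words_0: "words 0 = {[]}" by (auto simp: words_def)

lemma words_Suc: "words (Suc n) = (\<lambda>(i, w). i # w) ` (letters \<times> words n)"
  by (auto simp: words_def length_Suc_conv image_iff)

lemma words_SucD: "w \<in> words (Suc n) \<Longrightarrow> \<exists>i v. w = i # v \<and> i \<in> letters \<and> v \<in> words n"
  unfolding words_Suc by (elim imageE) (simp add: case_prod_unfold mem_Times_iff del: insert_iff)

lemma finite_words: "finite (words n)"
proof (induction n)
  case (Suc n)
  then show ?case unfolding words_Suc by (intro finite_imageI finite_cartesian_product) auto
qed (simp add: words_0)

lemma words_append: "words (m + n) = (\<lambda>(v, w). v @ w) ` (words m \<times> words n)"
proof (intro equalityI subsetI)
  fix u assume u: "u \<in> words (m + n)"
  have "set (take m u) \<subseteq> set u" "set (drop m u) \<subseteq> set u" by (rule set_take_subset set_drop_subset)+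
  then have "take m u \<in> words m" "drop m u \<in> words n" using u by (auto simp: words_def simp del: insert_iff)
  moreover have "u = take m u @ drop m u" by simp
  ultimately show "u \<in> (\<lambda>(v, w). v @ w) ` (words m \<times> words n)" by (metis (mono_tags) SigmaI case_prod_conv image_eqI)
qed (auto simp: words_def)

lemma sum_words_append: "(\<Sum>u\<in>words (m + n). f u) = (\<Sum>v\<in>words m. \<Sum>w\<in>words n. f (v @ w))"
proof -
  have "inj_on (\<lambda>(v, w). v @ w) (words m \<times> words n)" by (auto simp: inj_on_def words_def)
  then have "(\<Sum>u\<in>words (m + n). f u) = (\<Sum>(v, w)\<in>words m \<times> words n. f (v @ w))"
    unfolding words_append by (simp add: sum.reindex case_prod_unfold)
  then show ?thesis by (simp add: sum.cartesian_product)
qed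

lemma words_1: "words (Suc 0) = (\<lambda>i. [i]) ` letters"
  unfolding words_Suc words_0 by auto

section \<open>Barycentric coordinates and the intersection of cells\<close>

locale gasket =
  fixes q :: "nat \<Rightarrow> real^2" and K :: "(real^2) set"
  assumes triangle: "equilateral q" and gasket: "is_gasket q K"
begin

text \<open>A barycentric coordinate, expressed through the centroid: relative to it the vertices
  have inner products \<open>d / 3\<close> with themselves and \<open>- d / 6\<close> with each
  other, where \<open>d\<close> is the squared side length; this gives the values 1 and 0 at the
  vertices.\<close>

definition bary :: "nat \<Rightarrow> real^2 \<Rightarrow> real" where
  "bary i x = 1 / 3 + 2 * ((x - (1/3) *\<^sub>R (q 1 + q 2 + q 3)) \<bullet> (q i - (1/3) *\<^sub>R (q 1 + q 2 + q 3))) / (dist (q 1) (q 2))\<^sup>2"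

lemma bary_vertex:
  assumes "i \<in> letters" "j \<in> letters"
  shows "bary i (q j) = (if i = j then 1 else 0)"
proof -
  define g where "g = (1/3) *\<^sub>R (q 1 + q 2 + q 3)"
  define v where "v = (\<lambda>i. q i - g)"
  define d where "d = (dist (q 1) (q 2))\<^sup>2"
  have d: "0 < d" using equilateral_distinct(1)[OF triangle] by (simp add: d_def)
  have "v 1 + v 2 + v 3 = 0"
    by (simp add: vec_eq_iff v_def g_def field_simps)
  then have s: "v l \<bullet> v 1 + v l \<bullet> v 2 + v l \<bullet> v 3 = 0" for l by (metis inner_add_right inner_zero_right)
  have "(dist (q k) (q l))\<^sup>2 = v k \<bullet> v k - 2 * (v k \<bullet> v l) + v l \<bullet> v l" for k l
  proof -
    have "q k - q l = v k - v l" by (simp add: v_def)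
    then show ?thesis by (simp add: dist_norm power2_norm_eq_inner inner_diff_left inner_diff_right inner_commute)
  qed
  moreover have "(dist (q 2) (q 3))\<^sup>2 = d" "(dist (q 3) (q 1))\<^sup>2 = d" "(dist (q 1) (q 2))\<^sup>2 = d"
    using triangle by (simp_all add: d_def equilateral_def)
  ultimately have e: "v 1 \<bullet> v 1 - 2 * (v 1 \<bullet> v 2) + v 2 \<bullet> v 2 = d"
     "v 2 \<bullet> v 2 - 2 * (v 2 \<bullet> v 3) + v 3 \<bullet> v 3 = d" "v 3 \<bullet> v 3 - 2 * (v 3 \<bullet> v 1) + v 1 \<bullet> v 1 = d"
    by metis+
  have c: "v 2 \<bullet> v 1 = v 1 \<bullet> v 2" "v 3 \<bullet> v 2 = v 2 \<bullet> v 3" "v 1 \<bullet> v 3 = v 3 \<bullet> v 1"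
    by (simp_all only: inner_commute)
  \<comment> \<open>The relations \<open>s\<close> for the three vertices and the three side lengths
    form a linear system that determines the six inner products.\<close>
  have vals: "3 * (v 1 \<bullet> v 1) = d" "3 * (v 2 \<bullet> v 2) = d" "3 * (v 3 \<bullet> v 3) = d"
    "6 * (v 1 \<bullet> v 2) = - d" "6 * (v 2 \<bullet> v 3) = - d" "6 * (v 3 \<bullet> v 1) = - d"
    using s[of 1] s[of 2] s[of 3] e unfolding c by linarith+
  have "v j \<bullet> v i = (if i = j then d / 3 else - d / 6)"
  proof -
    have ij: "i = 1 \<or> i = 2 \<or> i = 3" "j = 1 \<or> j = 2 \<or> j = 3" using assms by simp_all
    have "v 1 \<bullet> v 1 = d / 3" "v 2 \<bullet> v 2 = d / 3" "v 3 \<bullet> v 3 = d / 3"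
      "v 1 \<bullet> v 2 = - d / 6" "v 2 \<bullet> v 3 = - d / 6" "v 3 \<bullet> v 1 = - d / 6"
      "v 2 \<bullet> v 1 = - d / 6" "v 3 \<bullet> v 2 = - d / 6" "v 1 \<bullet> v 3 = - d / 6"
      using vals c by simp_all
    then show ?thesis using ij by (elim disjE) (simp_all del: One_nat_def)
  qed
  then have "bary i (q j) = 1 / 3 + 2 * (if i = j then d / 3 else - d / 6) / d"
    by (simp add: bary_def v_def g_def d_def)
  then show ?thesis using d by (simp split: if_splits)
qed

lemma bary_contr:
  assumes "i \<in> letters" "j \<in> letters"
  shows "bary i (contr q j x) = (bary i x + (if i = j then 1 else 0)) / 2"
proof -
  define g where "g = (1/3) *\<^sub>R (q 1 + q 2 + q 3)"
  define v where "v = q i - g"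
  define d where "d = (dist (q 1) (q 2))\<^sup>2"
  have bary_eq: "bary i y = 1 / 3 + 2 * ((y - g) \<bullet> v) / d" for y
    by (simp only: bary_def g_def v_def d_def)
  have "contr q j x - g = (1/2) *\<^sub>R ((x - g) + (q j - g))"
    by (simp add: vec_eq_iff contr_def field_simps)
  then have "(contr q j x - g) \<bullet> v = ((x - g) \<bullet> v + (q j - g) \<bullet> v) / 2"
    by (simp only: inner_scaleR_left inner_add_left)
  then have "bary i (contr q j x) = (bary i x + bary i (q j)) / 2"
    unfolding bary_eq by (simp add: add_divide_distrib)
  then show ?thesis using bary_vertex[OF assms] by simp
qed

lemma bary_sum: "(\<Sum>i\<in>letters. bary i x) = 1"
proof -
  define g where "g = (1/3) *\<^sub>R (q 1 + q 2 + q 3)"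
  define d where "d = (dist (q 1) (q 2))\<^sup>2"
  have "(q 1 - g) + (q 2 - g) + (q 3 - g) = 0" by (simp add: vec_eq_iff g_def field_simps)
  then have "(x - g) \<bullet> (q 1 - g) + (x - g) \<bullet> (q 2 - g) + (x - g) \<bullet> (q 3 - g) = 0"
    by (simp only: inner_add_right[symmetric] inner_zero_right)
  moreover have "(1 / 3 + 2 * a / d) + (1 / 3 + 2 * b / d) + (1 / 3 + 2 * c / d) = 1 + 2 * (a + b + c) / d"
    for a b c by (simp add: add_divide_distrib distrib_left)
  moreover have "bary i x = 1 / 3 + 2 * ((x - g) \<bullet> (q i - g)) / d" for i
    by (simp only: bary_def g_def d_def)
  ultimately show ?thesis by (simp only: sum_letters)
qed

lemma continuous_on_bary: "continuous_on S (bary i)"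
  unfolding bary_def by (intro continuous_intros) (use triangle in \<open>auto simp: equilateral_def\<close>)

lemma compact_K: "compact K" and K_nonempty: "K \<noteq> {}" and K_eq: "K = (\<Union>i\<in>letters. contr q i ` K)"
  using gasket unfolding is_gasket_def by blast+

lemma contr_in_K: "i \<in> letters \<Longrightarrow> x \<in> K \<Longrightarrow> contr q i x \<in> K"
  using K_eq by blast

lemma contr_word_in_K: "w \<in> words n \<Longrightarrow> x \<in> K \<Longrightarrow> contr_word q w x \<in> K"
proof (induction w arbitrary: n)
  case (Cons i w)
  then have "i \<in> letters" "w \<in> words (length w)" by (auto simp: words_def)
  then show ?case using Cons by (simp only: contr_word_Cons contr_in_K)
qed simp

lemma K_split:
  assumes "x \<in> K"
  shows "\<exists>i\<in>letters. \<exists>y\<in>K. x = contr q i y"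
  using assms K_eq by blast

lemma K_split_words:
  assumes "x \<in> K"
  shows "\<exists>w\<in>words n. \<exists>y\<in>K. x = contr_word q w y"
  using assms
proof (induction n arbitrary: x)
  case (Suc n)
  from K_split[OF Suc.prems] obtain i y where i: "i \<in> letters" "y \<in> K" "x = contr q i y" by (elim bexE)
  from Suc.IH[OF i(2)] obtain w z where w: "w \<in> words n" "z \<in> K" "y = contr_word q w z" by (elim bexE)
  have "i # w \<in> words (Suc n)" using i(1) w(1) by (auto simp: words_Suc)
  then show ?case using w i by (metis contr_word_Cons)
qed (simp add: words_0)

lemma vertex_in_K:
  assumes i: "i \<in> letters"
  shows "q i \<in> K"
proof -
  obtain x where x: "x \<in> K" using K_nonempty by blast
  define s where "s = (\<lambda>n. contr_word q (replicate n i) x)"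
  have fix': "contr_word q (replicate n i) (q i) = q i" for n
    by (induction n) (simp_all add: contr_word_Cons)
  have "dist (s n) (q i) = dist x (q i) / 2 ^ n" for n
    using dist_contr_word[of q "replicate n i" x "q i"] by (simp add: s_def fix')
  moreover have "(\<lambda>n. dist x (q i) / 2 ^ n) \<longlonglongrightarrow> 0"
    using LIMSEQ_divide_realpow_zero[of 2 "dist x (q i)"] by simp
  ultimately have "(\<lambda>n. dist (s n) (q i)) \<longlonglongrightarrow> 0" by simp
  then have "s \<longlonglongrightarrow> q i" using tendsto_dist_iff by blast
  moreover have "s n \<in> K" for n
    unfolding s_def using i x by (intro contr_word_in_K[of _ n]) (auto simp: words_def simp del: insert_iff)
  ultimately show ?thesis using closed_sequentially[OF compact_imp_closed[OF compact_K]] by blast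
qed

text \<open>A minimum point on \<open>K\<close> is the image of some \<open>y\<close> in
  \<open>K\<close>, and its coordinate is at least half that of \<open>y\<close>; so the minimum is
  at least half of itself.\<close>

lemma bary_nonneg:
  assumes i: "i \<in> letters" and x: "x \<in> K"
  shows "0 \<le> bary i x"
proof -
  obtain z where z: "z \<in> K" "\<And>y. y \<in> K \<Longrightarrow> bary i z \<le> bary i y"
    using continuous_attains_inf[OF compact_K K_nonempty continuous_on_bary] by blast
  from K_split[OF z(1)] obtain j y where j: "j \<in> letters" "y \<in> K" "z = contr q j y" by (elim bexE)
  have "bary i z \<ge> bary i y / 2" using bary_contr[OF i j(1), of y] j(3) by auto
  then have "0 \<le> bary i z" using z(2)[OF j(2)] by linarith
  then show ?thesis using z(2)[OF x] by linarith
qed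

lemma bary_le_1:
  assumes i: "i \<in> letters" and x: "x \<in> K"
  shows "bary i x \<le> 1"
proof -
  obtain z where z: "z \<in> K" "\<And>y. y \<in> K \<Longrightarrow> bary i y \<le> bary i z"
    using continuous_attains_sup[OF compact_K K_nonempty continuous_on_bary] by blast
  from K_split[OF z(1)] obtain j y where j: "j \<in> letters" "y \<in> K" "z = contr q j y" by (elim bexE)
  have "bary i z \<le> (bary i y + 1) / 2" using bary_contr[OF i j(1), of y] j(3) by auto
  then have "bary i z \<le> 1" using z(2)[OF j(2)] by (simp add: field_simps)
  then show ?thesis using z(2)[OF x] by linarith
qed

lemma bary_contr_eq_1:
  assumes "i \<in> letters" "j \<in> letters" "y \<in> K" "bary i (contr q j y) = 1"
  shows "j = i" "bary i y = 1"
  using bary_contr[OF assms(1,2), of y] bary_le_1[OF assms(1,3)] assms(4) by (auto split: if_splits)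

text \<open>A point with coordinate 1 can only lie in cell \<open>i\<close>, and its preimage has
  coordinate 1 again; thus it is an image under every iterate of the contraction towards
  \<open>q i\<close>.\<close>

lemma bary_eq_1_word:
  assumes i: "i \<in> letters"
  shows "x \<in> K \<Longrightarrow> bary i x = 1 \<Longrightarrow> \<exists>y\<in>K. dist x (q i) = dist y (q i) / 2 ^ n"
proof (induction n arbitrary: x)
  case (Suc n)
  from K_split[OF Suc.prems(1)] obtain j y where j: "j \<in> letters" "y \<in> K" "x = contr q j y" by (elim bexE)
  have "j = i" "bary i y = 1" using bary_contr_eq_1[OF i j(1,2)] Suc.prems(2) j(3) by auto
  then have "dist x (q i) = dist y (q i) / 2" using dist_contr[of q i y "q i"] j(3) by simp
  moreover obtain z where "z \<in> K" "dist y (q i) = dist z (q i) / 2 ^ n"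
    using Suc.IH[OF j(2) \<open>bary i y = 1\<close>] by blast
  ultimately show ?case by (intro bexI[of _ z]) auto
qed auto

lemma dist_K_bounded: "\<exists>M>0. \<forall>x\<in>K. \<forall>y\<in>K. dist x y \<le> M"
proof -
  obtain M where M: "\<And>x y. x \<in> K \<Longrightarrow> y \<in> K \<Longrightarrow> dist x y \<le> M"
    using compact_imp_bounded[OF compact_K] unfolding bounded_two_points by blast
  then show ?thesis by (intro exI[of _ "max M 1"]) (force simp: le_max_iff_disj)
qed

lemma bary_eq_1:
  assumes i: "i \<in> letters" and x: "x \<in> K" "bary i x = 1"
  shows "x = q i"
proof -
  obtain M where M: "0 < M" "\<forall>x\<in>K. \<forall>y\<in>K. dist x y \<le> M" using dist_K_bounded by blast
  have "dist x (q i) \<le> M / 2 ^ n" for n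
  proof -
    obtain y where "y \<in> K" "dist x (q i) = dist y (q i) / 2 ^ n" using bary_eq_1_word[OF i x] by blast
    then show ?thesis using M vertex_in_K[OF i] by (simp add: divide_right_mono)
  qed
  moreover have "(\<lambda>n. M / 2 ^ n) \<longlonglongrightarrow> 0" using LIMSEQ_divide_realpow_zero[of 2 M] by simp
  ultimately have "dist x (q i) \<le> 0" by (intro LIMSEQ_le_const) auto
  then show ?thesis by simp
qed

lemma vertex_inj:
  assumes "i \<in> letters" "j \<in> letters" "q i = q j"
  shows "i = j"
  using bary_vertex[OF assms(1,1)] bary_vertex[OF assms(1,2)] assms(3) by (auto split: if_splits)

text \<open>Coordinate \<open>j\<close> is at most 1/2 on cell \<open>i\<close> and at least 1/2 on
  cell \<open>j\<close>. At a common point it is 1/2, so its preimage in the first cell has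
  coordinate 1.\<close>

lemma contr_overlap:
  assumes ij: "i \<in> letters" "j \<in> letters" "i \<noteq> j" and xy: "x \<in> K" "y \<in> K"
    and eq: "contr q i x = contr q j y"
  shows "x = q j" "y = q i"
proof -
  have *: "x = q j" if ij: "i \<in> letters" "j \<in> letters" "i \<noteq> j" and xy: "x \<in> K" "y \<in> K"
    and eq: "contr q i x = contr q j y" for i j x y
  proof -
    have "bary j x / 2 = (bary j y + 1) / 2"
      using bary_contr[OF ij(2,1), of x] bary_contr[OF ij(2,2), of y] eq ij(3) by simp
    then have "bary j x = 1" using bary_nonneg[OF ij(2) xy(2)] bary_le_1[OF ij(2) xy(1)] by simp
    then show ?thesis by (rule bary_eq_1[OF ij(2) xy(1)])
  qed
  show "x = q j" by (rule *[OF ij xy eq])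
  show "y = q i" by (rule *[OF ij(2,1) ij(3)[symmetric] xy(2,1) eq[symmetric]])
qed

lemma contr_word_eq_vertex:
  assumes j: "j \<in> letters"
  shows "w \<in> words n \<Longrightarrow> x \<in> K \<Longrightarrow> contr_word q w x = q j \<Longrightarrow> x = q j"
proof (induction w arbitrary: n)
  case (Cons i w)
  have w: "i \<in> letters" "w \<in> words (length w)" using Cons.prems(1) by (auto simp: words_def)
  have wK: "contr_word q w x \<in> K" by (rule contr_word_in_K[OF w(2) Cons.prems(2)])
  have "bary j (contr q i (contr_word q w x)) = 1"
    using Cons.prems(3) bary_vertex[OF j j] by (simp add: contr_word_Cons)
  then have "bary j (contr_word q w x) = 1" by (rule bary_contr_eq_1(2)[OF j w(1) wK])
  then have "contr_word q w x = q j" by (rule bary_eq_1[OF j wK])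
  then show ?case by (rule Cons.IH[OF w(2) Cons.prems(2)])
qed simp

text \<open>At the first letter where the words differ the cells meet in the image of a vertex, and
  a vertex lies in a cell only as the image of itself.\<close>

lemma cell_overlap:
  assumes "v \<in> words n" "w \<in> words n" "v \<noteq> w" "x \<in> K" "y \<in> K" "contr_word q v x = contr_word q w y"
  shows "x \<in> q ` letters"
  using assms
proof (induction n arbitrary: v w)
  case (Suc n)
  obtain i v' where v: "v = i # v'" "i \<in> letters" "v' \<in> words n" using words_SucD[OF Suc.prems(1)] by (elim exE conjE)
  obtain j w' where w: "w = j # w'" "j \<in> letters" "w' \<in> words n" using words_SucD[OF Suc.prems(2)] by (elim exE conjE)
  have eq: "contr q i (contr_word q v' x) = contr q j (contr_word q w' y)"
    using Suc.prems(6) by (simp add: v(1) w(1) contr_word_Cons)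
  show ?case
  proof (cases "i = j")
    case True
    then have "contr_word q v' x = contr_word q w' y" using eq by (simp add: contr_inj)
    moreover have "v' \<noteq> w'" using Suc.prems(3) True v w by simp
    ultimately show ?thesis using Suc.IH v(3) w(3) Suc.prems(4,5) by blast
  next
    case False
    have "contr_word q v' x = q j"
      by (rule contr_overlap(1)[OF v(2) w(2) False contr_word_in_K[OF v(3) Suc.prems(4)]
            contr_word_in_K[OF w(3) Suc.prems(5)] eq])
    then have "x = q j" by (rule contr_word_eq_vertex[OF w(2) v(3) Suc.prems(4)])
    then show ?thesis using w(2) by blast
  qed
qed (simp add: words_0)

section \<open>Gluing continuous functions along cells\<close>

definition glue :: "(nat \<Rightarrow> real^2 \<Rightarrow> real) \<Rightarrow> real^2 \<Rightarrow> real" where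
  "glue f x = (let i = SOME i. i \<in> letters \<and> x \<in> contr q i ` K in f i (2 *\<^sub>R x - q i))"

text \<open>Distinct cells meet at most in the point \<open>contr q i (q j)\<close>, so agreement
  there makes the cell picked by \<open>SOME\<close> irrelevant.\<close>

lemma glue_contr:
  assumes compat: "\<And>i j. i \<in> letters \<Longrightarrow> j \<in> letters \<Longrightarrow> f i (q j) = f j (q i)"
    and i: "i \<in> letters" and x: "x \<in> K"
  shows "glue f (contr q i x) = f i x"
proof -
  define j where "j = (SOME j. j \<in> letters \<and> contr q i x \<in> contr q j ` K)"
  have "j \<in> letters \<and> contr q i x \<in> contr q j ` K"
    unfolding j_def by (rule someI[of _ i]) (use i x in blast)
  then obtain y where j: "j \<in> letters" and y: "y \<in> K" "contr q i x = contr q j y" by blast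
  have "glue f (contr q i x) = f j (2 *\<^sub>R contr q i x - q j)" by (simp add: glue_def j_def Let_def)
  also have "\<dots> = f j y" by (simp add: y(2) contr_inverse)
  also have "\<dots> = f i x"
  proof (cases "i = j")
    case True
    then show ?thesis using contr_inj[of q i x y] y(2) by simp
  next
    case False
    show ?thesis using contr_overlap[OF i j False x y] compat[OF i j] by simp
  qed
  finally show ?thesis .
qed

lemma continuous_on_glue:
  assumes compat: "\<And>i j. i \<in> letters \<Longrightarrow> j \<in> letters \<Longrightarrow> f i (q j) = f j (q i)"
    and cont: "\<And>i. i \<in> letters \<Longrightarrow> continuous_on K (f i)"
  shows "continuous_on K (glue f)"
proof -
  have "continuous_on (\<Union>i\<in>letters. contr q i ` K) (glue f)"
  proof (rule continuous_on_closed_Union)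
    fix i assume i: "i \<in> letters"
    show "closed (contr q i ` K)"
      by (intro compact_imp_closed compact_continuous_image continuous_on_contr compact_K)
    have "continuous_on (contr q i ` K) (f i \<circ> (\<lambda>x. 2 *\<^sub>R x - q i))"
    proof (rule continuous_on_compose)
      have "(\<lambda>x. 2 *\<^sub>R x - q i) ` contr q i ` K = K" by (simp add: image_image contr_inverse)
      then show "continuous_on ((\<lambda>x. 2 *\<^sub>R x - q i) ` contr q i ` K) (f i)" using cont[OF i] by simp
    qed (intro continuous_intros)
    moreover have "glue f (contr q i x) = f i x" if "x \<in> K" for x
      by (rule glue_contr[OF _ i that]) (rule compat)
    ultimately show "continuous_on (contr q i ` K) (glue f)"
      by (elim continuous_on_eq) (auto simp: contr_inverse)
  qed auto
  then show ?thesis using K_eq by simp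
qed

lemma contr_word_replicate_vertex: "contr_word q (replicate n i) (q i) = q i"
  by (induction n) (simp_all add: contr_word_Cons)

text \<open>Compatibility is phrased by one function \<open>c\<close> prescribing all corner values,
  a form that passes to cell \<open>i\<close> as \<open>c \<circ> contr q i\<close>.\<close>

lemma glue_words:
  fixes f :: "nat list \<Rightarrow> real^2 \<Rightarrow> real"
  assumes "\<And>w. w \<in> words n \<Longrightarrow> continuous_on K (f w)"
    and "\<And>w i. w \<in> words n \<Longrightarrow> i \<in> letters \<Longrightarrow> f w (q i) = c (contr_word q w (q i))"
  shows "\<exists>g. continuous_on K g \<and> (\<forall>w\<in>words n. \<forall>x\<in>K. g (contr_word q w x) = f w x)"
  using assms
proof (induction n arbitrary: f c)
  case 0
  then show ?case by (intro exI[of _ "f []"]) (simp add: words_0)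
next
  case (Suc n)
  have mem: "i # w \<in> words (Suc n)" if "i \<in> letters" "w \<in> words n" for i w
    using that by (auto simp: words_Suc)
  have "\<exists>g. continuous_on K g \<and> (\<forall>w\<in>words n. \<forall>x\<in>K. g (contr_word q w x) = f (i # w) x)"
    if i: "i \<in> letters" for i
  proof (rule Suc.IH)
    fix w assume w: "w \<in> words n"
    show "continuous_on K (f (i # w))" by (rule Suc.prems(1)[OF mem[OF i w]])
    show "f (i # w) (q j) = (c \<circ> contr q i) (contr_word q w (q j))" if "j \<in> letters" for j
      using Suc.prems(2)[OF mem[OF i w] that] by (simp add: contr_word_Cons)
  qed
  then obtain g where g: "\<And>i. i \<in> letters \<Longrightarrow> continuous_on K (g i)"
    "\<And>i w x. i \<in> letters \<Longrightarrow> w \<in> words n \<Longrightarrow> x \<in> K \<Longrightarrow> g i (contr_word q w x) = f (i # w) x"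
    by metis
  have corner: "g i (q j) = c (contr q i (q j))" if ij: "i \<in> letters" "j \<in> letters" for i j
  proof -
    \<comment> \<open>Repeating \<open>j\<close> addresses the level \<open>n\<close> cell at the
      fixed point \<open>q j\<close>, so the value of \<open>g i\<close> at \<open>q j\<close> can
      be read off from \<open>f\<close>.\<close>
    have w: "replicate n j \<in> words n" using ij by (auto simp: words_def simp del: insert_iff)
    have "g i (q j) = f (i # replicate n j) (q j)"
      using g(2)[OF ij(1) w vertex_in_K[OF ij(2)]] by (simp add: contr_word_replicate_vertex)
    also have "\<dots> = c (contr q i (q j))"
      using Suc.prems(2)[OF mem[OF ij(1) w] ij(2)] by (simp add: contr_word_Cons contr_word_replicate_vertex)
    finally show ?thesis .
  qed
  have compat: "g i (q j) = g j (q i)" if "i \<in> letters" "j \<in> letters" for i j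
    using corner[OF that] corner[OF that(2,1)] contr_vertex_commute[of q i j] by simp
  show ?case
  proof (intro exI[of _ "glue g"] conjI ballI)
    show "continuous_on K (glue g)" by (rule continuous_on_glue[of g, OF compat g(1)])
    fix w x assume w: "w \<in> words (Suc n)" and x: "x \<in> K"
    obtain i w' where w': "w = i # w'" "i \<in> letters" "w' \<in> words n" using words_SucD[OF w] by (elim exE conjE)
    show "glue g (contr_word q w x) = f w x"
      using glue_contr[of g, OF compat w'(2) contr_word_in_K[OF w'(3) x]] g(2)[OF w'(2,3) x]
      by (simp add: w'(1) contr_word_Cons)
  qed
qed

lemma vertices_dense:
  fixes f g :: "real^2 \<Rightarrow> real"
  assumes cont: "continuous_on K f" "continuous_on K g" and x: "x \<in> K"
    and eq: "\<And>n w i. w \<in> words n \<Longrightarrow> i \<in> letters \<Longrightarrow> f (contr_word q w (q i)) = g (contr_word q w (q i))"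
  shows "f x = g x"
proof -
  obtain M where M: "0 < M" "\<forall>x\<in>K. \<forall>y\<in>K. dist x y \<le> M" using dist_K_bounded by blast
  have "\<exists>w\<in>words n. \<exists>y\<in>K. x = contr_word q w y" for n by (rule K_split_words[OF x])
  then obtain w y where wy: "\<And>n. w n \<in> words n" "\<And>n. y n \<in> K" "\<And>n. x = contr_word q (w n) (y n)"
    by metis
  have one: "(1::nat) \<in> letters" by simp
  define s where "s = (\<lambda>n. contr_word q (w n) (q 1))"
  have sK: "s n \<in> K" for n unfolding s_def by (rule contr_word_in_K[OF wy(1) vertex_in_K[OF one]])
  have "norm (dist (s n) x) \<le> M / 2 ^ n" for n
  proof -
    have "dist (s n) x = dist (q 1) (y n) / 2 ^ n"
      using dist_contr_word[of q "w n" "q 1" "y n"] wy(1)[of n] wy(3)[of n] by (simp add: s_def words_def)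
    then show ?thesis using M(2) vertex_in_K[OF one] wy(2)[of n] by (simp add: divide_right_mono)
  qed
  moreover have "(\<lambda>n. M / 2 ^ n) \<longlonglongrightarrow> 0" using LIMSEQ_divide_realpow_zero[of 2 M] by simp
  ultimately have "(\<lambda>n. dist (s n) x) \<longlonglongrightarrow> 0" by (intro Lim_null_comparison[of "\<lambda>n. dist (s n) x"]) auto
  then have s: "s \<longlonglongrightarrow> x" using tendsto_dist_iff by blast
  have "(\<lambda>n. f (s n)) \<longlonglongrightarrow> f x" "(\<lambda>n. g (s n)) \<longlonglongrightarrow> g x"
    using cont s x sK by (auto intro: continuous_on_tendsto_compose)
  moreover have "(\<lambda>n. f (s n)) = (\<lambda>n. g (s n))"
    unfolding s_def by (rule ext) (rule eq[OF wy(1) one])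
  ultimately show ?thesis by (metis LIMSEQ_unique)
qed

end

section \<open>Level energies and harmonic extension\<close>

text \<open>\<open>oscillation\<close> is RF4 for the three vertices with one constant; it converts
  decay of energy into decay of oscillation.\<close>

locale gasket_form = gasket q K + renormalized_form p E \<kappa> \<epsilon> \<rho>
  for q :: "nat \<Rightarrow> real^2" and K :: "(real^2) set" and p :: real and E :: "(nat \<Rightarrow> real) \<Rightarrow> real"
    and \<kappa> \<epsilon> \<rho> :: real +
  assumes oscillation: "\<exists>C. \<forall>f. \<forall>i\<in>letters. \<forall>j\<in>letters. \<bar>f i - f j\<bar> powr p \<le> C * E f"
begin

section \<open>Energies of the levels and their limit\<close>

definition cell :: "(real^2 \<Rightarrow> real) \<Rightarrow> nat list \<Rightarrow> nat \<Rightarrow> real" where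
  "cell u w = (\<lambda>i. u (contr_word q w (q i)))"

definition energy :: "(real^2 \<Rightarrow> real) \<Rightarrow> nat \<Rightarrow> real" where
  "energy u n = \<rho> ^ n * (\<Sum>w\<in>words n. E (cell u w))"

lemma cell_append: "cell u (v @ w) = cell (u \<circ> contr_word q v) w"
  by (simp add: cell_def contr_word_append)

lemma energy_nonneg: "0 \<le> energy u n"
  unfolding energy_def using rho by (intro mult_nonneg_nonneg sum_nonneg E_nonneg) auto

lemma energy_append: "energy u (m + n) = \<rho> ^ m * (\<Sum>v\<in>words m. energy (u \<circ> contr_word q v) n)"
  by (simp add: energy_def sum_words_append cell_append sum_distrib_left power_add mult.assoc)

lemma energy_0: "energy u 0 = E (\<lambda>i. u (q i))"
  by (simp add: energy_def words_0 cell_def)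

lemma energy_1: "energy u 1 = \<rho> * (\<Sum>i\<in>letters. E (\<lambda>j. u (contr q i (q j))))"
proof -
  have "(\<Sum>w\<in>words (Suc 0). E (cell u w)) = (\<Sum>i\<in>letters. E (cell u [i]))"
    unfolding words_1 by (subst sum.reindex) (auto simp: inj_on_def)
  then show ?thesis by (simp add: energy_def cell_def contr_word_Cons del: sum.insert sum.insert_if)
qed

lemma energy_Suc: "energy u (Suc n) = \<rho> * (\<Sum>i\<in>letters. energy (u \<circ> contr q i) n)"
proof -
  have "energy u (1 + n) = \<rho> ^ 1 * (\<Sum>v\<in>words 1. energy (u \<circ> contr_word q v) n)" by (rule energy_append)
  also have "(\<Sum>v\<in>words 1. energy (u \<circ> contr_word q v) n) = (\<Sum>i\<in>letters. energy (u \<circ> contr_word q [i]) n)"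
    unfolding One_nat_def words_1 by (subst sum.reindex) (auto simp: inj_on_def)
  also have "\<dots> = (\<Sum>i\<in>letters. energy (u \<circ> contr q i) n)"
  proof (rule sum.cong)
    fix i
    have "contr_word q [i] = contr q i" by (rule HOL.ext) (simp add: contr_word_Cons)
    then show "energy (u \<circ> contr_word q [i]) n = energy (u \<circ> contr q i) n" by (simp only:)
  qed simp
  finally show ?thesis by (simp only: power_one_right plus_1_eq_Suc)
qed

lemma energy_0_le_1: "energy u 0 \<le> energy u 1"
proof -
  have "E (\<lambda>i. u (contr q i (q i))) \<le> \<rho> * (\<Sum>i\<in>letters. E (\<lambda>j. u (contr q i (q j))))"
    by (rule trace_le) (simp only: contr_vertex_commute)
  then show ?thesis unfolding energy_0 energy_1 by (simp only: contr_self)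
qed

lemma energy_le_Suc: "energy u n \<le> energy u (Suc n)"
proof -
  have "\<rho> ^ n * (\<Sum>v\<in>words n. energy (u \<circ> contr_word q v) 0)
      \<le> \<rho> ^ n * (\<Sum>v\<in>words n. energy (u \<circ> contr_word q v) 1)"
    using rho by (intro mult_left_mono sum_mono energy_0_le_1) auto
  then show ?thesis using energy_append[of u n 0] energy_append[of u n 1] by simp
qed

lemma incseq_energy: "incseq (energy u)"
  by (rule incseq_SucI) (rule energy_le_Suc)

lemma vertex_word_in_K: "w \<in> words n \<Longrightarrow> i \<in> letters \<Longrightarrow> contr_word q w (q i) \<in> K"
  by (rule contr_word_in_K[OF _ vertex_in_K])

lemma E_cell_cong:
  assumes "\<And>x. x \<in> K \<Longrightarrow> u x = v x" "w \<in> words n"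
  shows "E (cell u w) = E (cell v w)"
  unfolding cell_def using assms(1) vertex_word_in_K[OF assms(2)] by (intro E_cong) blast

lemma energy_cong:
  assumes "\<And>x. x \<in> K \<Longrightarrow> u x = v x"
  shows "energy u n = energy v n"
  unfolding energy_def using E_cell_cong[of u v, OF assms] by simp

text \<open>Membership depends on the values in \<open>K\<close> only, so test functions may be
  arbitrary elsewhere; the canonical domain is recovered as the intersection with
  \<open>funs K\<close>.\<close>

definition fdom :: "(real^2 \<Rightarrow> real) set" where
  "fdom = {u. continuous_on K u \<and> convergent (energy u)}"

definition En :: "(real^2 \<Rightarrow> real) \<Rightarrow> real" where
  "En u = lim (energy u)"

lemma En_limit: "u \<in> fdom \<Longrightarrow> energy u \<longlonglongrightarrow> En u"
  by (simp add: fdom_def En_def convergent_LIMSEQ_iff)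

lemma energy_le_En: "u \<in> fdom \<Longrightarrow> energy u n \<le> En u"
  by (rule incseq_le[OF incseq_energy En_limit])

lemma fdomI:
  assumes "continuous_on K u" "\<And>n. N \<le> n \<Longrightarrow> energy u n \<le> C"
  shows "u \<in> fdom" "En u \<le> C"
proof -
  have "energy u n \<le> C" for n
    using incseqD[OF incseq_energy, of n "max n N" u] assms(2)[of "max n N"] by simp
  then obtain L where "energy u \<longlonglongrightarrow> L" using incseq_convergent[OF incseq_energy, of u C] by blast
  then show u: "u \<in> fdom" using assms(1) by (auto simp: fdom_def convergent_def)
  show "En u \<le> C" by (rule LIMSEQ_le_const2[OF En_limit[OF u]]) (use assms(2) in blast)
qed

lemma En_cong:
  assumes "\<And>x. x \<in> K \<Longrightarrow> u x = v x"
  shows "u \<in> fdom \<longleftrightarrow> v \<in> fdom" "En u = En v"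
proof -
  have "energy u = energy v" by (rule HOL.ext) (rule energy_cong[OF assms])
  moreover have "continuous_on K u \<longleftrightarrow> continuous_on K v" using assms by (intro continuous_on_cong) auto
  ultimately show "u \<in> fdom \<longleftrightarrow> v \<in> fdom" "En u = En v" by (simp_all add: fdom_def En_def)
qed

section \<open>Harmonic extension of corner values to the whole gasket\<close>

definition ext :: "(nat \<Rightarrow> real) \<Rightarrow> nat \<Rightarrow> nat \<Rightarrow> real" where
  "ext a = (SOME A. minimal A \<and> (\<forall>i\<in>letters. A i i = a i))"

lemma ext_minimal: "minimal (ext a)" and ext_diag: "i \<in> letters \<Longrightarrow> ext a i i = a i"
proof -
  have "minimal (ext a) \<and> (\<forall>i\<in>letters. ext a i i = a i)"
    unfolding ext_def by (rule someI_ex[OF minimal_extension_exists])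
  then show "minimal (ext a)" "i \<in> letters \<Longrightarrow> ext a i i = a i" by blast+
qed

lemma ext_sym: "i \<in> letters \<Longrightarrow> j \<in> letters \<Longrightarrow> ext a i j = ext a j i"
  by (rule minimal_sym[OF ext_minimal])

lemma ext_energy: "\<rho> * (\<Sum>i\<in>letters. E (ext a i)) = E a"
proof -
  have "E (\<lambda>i. ext a i i) = E a" by (rule E_cong) (rule ext_diag)
  then show ?thesis using minimal_energy[OF ext_minimal, of a] by simp
qed

lemma E_ext_le:
  assumes "i \<in> letters"
  shows "E (ext a i) \<le> E a / \<rho>"
proof -
  have "E (ext a i) \<le> (\<Sum>i\<in>letters. E (ext a i))"
    using assms E_nonneg by (intro member_le_sum) auto
  then have "\<rho> * E (ext a i) \<le> E a"
    using ext_energy[of a] rho mult_left_mono[of "E (ext a i)" "\<Sum>i\<in>letters. E (ext a i)" \<rho>] by linarith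
  then show ?thesis using rho by (simp add: pos_le_divide_eq mult.commute)
qed

text \<open>Corner values are carried through \<open>n\<close> levels by minimal extension and then
  interpolated affinely inside each level \<open>n\<close> cell.\<close>

primrec approx :: "nat \<Rightarrow> (nat \<Rightarrow> real) \<Rightarrow> real^2 \<Rightarrow> real" where
  "approx 0 a = (\<lambda>x. \<Sum>i\<in>letters. a i * bary i x)"
| "approx (Suc n) a = glue (\<lambda>i. approx n (ext a i))"

lemma approx_vertex: "j \<in> letters \<Longrightarrow> approx n a (q j) = a j"
proof (induction n arbitrary: a j)
  case 0
  have "(\<Sum>i\<in>letters. a i * bary i (q j)) = (\<Sum>i\<in>letters. if i = j then a i else 0)"
    using bary_vertex[OF _ 0] by (intro sum.cong) auto
  also have "\<dots> = a j" using 0 by (subst sum.delta) auto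
  finally show ?case by (simp only: approx.simps)
next
  case (Suc n)
  have "glue (\<lambda>i. approx n (ext a i)) (contr q j (q j)) = approx n (ext a j) (q j)"
    by (rule glue_contr[OF _ Suc.prems vertex_in_K[OF Suc.prems]]) (simp only: Suc.IH ext_sym)
  then show ?case using Suc.IH[OF Suc.prems] ext_diag[OF Suc.prems] by simp
qed

lemma approx_compat: "i \<in> letters \<Longrightarrow> j \<in> letters \<Longrightarrow> approx n (ext a i) (q j) = approx n (ext a j) (q i)"
  by (simp only: approx_vertex ext_sym)

lemma approx_Suc_contr:
  assumes "i \<in> letters" "x \<in> K"
  shows "approx (Suc n) a (contr q i x) = approx n (ext a i) x"
proof -
  have "glue (\<lambda>i. approx n (ext a i)) (contr q i x) = approx n (ext a i) x"
    by (rule glue_contr[OF _ assms]) (rule approx_compat)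
  then show ?thesis by simp
qed

lemma continuous_on_approx: "continuous_on K (approx n a)"
proof (induction n arbitrary: a)
  case 0
  show ?case unfolding approx.simps by (intro continuous_on_sum continuous_on_mult continuous_on_const continuous_on_bary)
next
  case (Suc n)
  have "continuous_on K (glue (\<lambda>i. approx n (ext a i)))"
    by (rule continuous_on_glue) (rule approx_compat Suc.IH; assumption?)+
  then show ?case by simp
qed

abbreviation N :: "(nat \<Rightarrow> real) \<Rightarrow> real" where
  "N f \<equiv> E f powr (1 / p)"

lemma N_oscillation: "\<exists>C\<ge>0. \<forall>f. \<forall>i\<in>letters. \<forall>j\<in>letters. \<bar>f i - f j\<bar> \<le> C * N f"
proof -
  obtain C where C: "\<forall>f. \<forall>i\<in>letters. \<forall>j\<in>letters. \<bar>f i - f j\<bar> powr p \<le> C * E f" using oscillation by blast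
  show ?thesis
  proof (intro exI[of _ "\<bar>C\<bar> powr (1 / p)"] conjI allI ballI)
    fix f i j assume ij: "i \<in> letters" "j \<in> letters"
    have "\<bar>f i - f j\<bar> powr p \<le> \<bar>C\<bar> * E f"
      using C ij E_nonneg[of f] by (meson abs_ge_self mult_right_mono order_trans)
    then have "(\<bar>f i - f j\<bar> powr p) powr (1 / p) \<le> (\<bar>C\<bar> * E f) powr (1 / p)"
      using p by (intro powr_mono2) auto
    then show "\<bar>f i - f j\<bar> \<le> \<bar>C\<bar> powr (1 / p) * N f"
      using p E_nonneg by (simp add: powr_powr powr_mult)
  qed simp
qed

lemma approx_0_deviation:
  assumes C: "\<forall>f. \<forall>i\<in>letters. \<forall>j\<in>letters. \<bar>f i - f j\<bar> \<le> C * N f"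
    and x: "x \<in> K" and i: "i \<in> letters"
  shows "\<bar>approx 0 a x - a i\<bar> \<le> C * N a"
proof -
  have "approx 0 a x - a i = (\<Sum>j\<in>letters. a j * bary j x) - a i * (\<Sum>j\<in>letters. bary j x)"
    by (simp only: approx.simps bary_sum mult_1_right)
  also have "\<dots> = (\<Sum>j\<in>letters. (a j - a i) * bary j x)"
    by (simp only: sum_distrib_left sum_subtractf[symmetric] left_diff_distrib)
  finally have "\<bar>approx 0 a x - a i\<bar> \<le> (\<Sum>j\<in>letters. \<bar>(a j - a i) * bary j x\<bar>)"
    by (simp only: sum_abs)
  also have "\<dots> \<le> (\<Sum>j\<in>letters. (C * N a) * bary j x)"
  proof (rule sum_mono)
    fix j assume j: "j \<in> letters"
    have "\<bar>a j - a i\<bar> \<le> C * N a" using C i j by blast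
    then show "\<bar>(a j - a i) * bary j x\<bar> \<le> (C * N a) * bary j x"
      using bary_nonneg[OF j x] by (simp add: abs_mult mult_right_mono)
  qed
  also have "\<dots> = C * N a" by (simp only: sum_distrib_left[symmetric] bary_sum mult_1_right)
  finally show ?thesis .
qed

text \<open>The factor by which the seminorm \<open>N\<close> shrinks per level, since a subcell
  carries energy at most \<open>E a / \<rho>\<close>.\<close>

definition ratio :: real where
  "ratio = (1 / \<rho>) powr (1 / p)"

lemma ratio: "0 < ratio" "ratio < 1"
proof -
  show "0 < ratio" using rho by (simp add: ratio_def)
  have "(1 / \<rho>) powr (1 / p) < 1 powr (1 / p)"
    using rho_gt_1 p by (intro powr_less_mono2) auto
  then show "ratio < 1" by (simp add: ratio_def)
qed

lemma N_ext_le: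
  assumes "i \<in> letters"
  shows "N (ext a i) \<le> ratio * N a"
proof -
  have "N (ext a i) \<le> (E a / \<rho>) powr (1 / p)"
    using E_ext_le[OF assms] E_nonneg p by (intro powr_mono2) auto
  also have "\<dots> = ratio * N a" using rho E_nonneg by (simp add: ratio_def powr_divide)
  finally show ?thesis .
qed

text \<open>Passing to a subcell lowers the level and contracts \<open>N\<close> by
  \<open>ratio\<close>. At the bottom both stages lie within \<open>C * N a\<close> of the corner
  value \<open>a i\<close>, whence the factor 2.\<close>

lemma approx_increment:
  assumes C0: "0 \<le> C" and C: "\<forall>f. \<forall>i\<in>letters. \<forall>j\<in>letters. \<bar>f i - f j\<bar> \<le> C * N f"
  shows "x \<in> K \<Longrightarrow> \<bar>approx (Suc n) a x - approx n a x\<bar> \<le> 2 * C * ratio ^ n * N a"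
proof (induction n arbitrary: a x)
  case 0
  from K_split[OF 0] obtain i y where i: "i \<in> letters" "y \<in> K" "x = contr q i y" by (elim bexE)
  have "\<bar>approx 0 (ext a i) y - ext a i i\<bar> \<le> C * N (ext a i)" by (rule approx_0_deviation[OF C i(2,1)])
  also have "\<dots> \<le> C * N a"
    using N_ext_le[OF i(1), of a] ratio mult_right_mono[of ratio 1 "N a"] C0
    by (intro mult_left_mono) auto
  finally have "\<bar>approx (Suc 0) a x - a i\<bar> \<le> C * N a"
    using approx_Suc_contr[OF i(1,2), of 0 a] ext_diag[OF i(1), of a] i(3) by simp
  moreover have "\<bar>approx 0 a x - a i\<bar> \<le> C * N a" by (rule approx_0_deviation[OF C 0 i(1)])
  moreover have "2 * C * ratio ^ 0 * N a = C * N a + C * N a" by simp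
  ultimately show ?case by linarith
next
  case (Suc n)
  from K_split[OF Suc.prems] obtain i y where i: "i \<in> letters" "y \<in> K" "x = contr q i y" by (elim bexE)
  have "\<bar>approx (Suc (Suc n)) a x - approx (Suc n) a x\<bar> = \<bar>approx (Suc n) (ext a i) y - approx n (ext a i) y\<bar>"
    by (simp only: i(3) approx_Suc_contr[OF i(1,2)])
  also have "\<dots> \<le> 2 * C * ratio ^ n * N (ext a i)" by (rule Suc.IH[OF i(2)])
  also have "\<dots> \<le> 2 * C * ratio ^ n * (ratio * N a)"
    using N_ext_le[OF i(1)] C0 ratio by (intro mult_left_mono) auto
  finally show ?case by (simp only: power_Suc mult_ac)
qed

definition harm :: "(nat \<Rightarrow> real) \<Rightarrow> real^2 \<Rightarrow> real" where
  "harm a x = lim (\<lambda>n. approx n a x)"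

lemma uniform_limit_approx: "uniform_limit K (\<lambda>n. approx n a) (harm a) sequentially"
proof -
  obtain C where C: "0 \<le> C" "\<forall>f. \<forall>i\<in>letters. \<forall>j\<in>letters. \<bar>f i - f j\<bar> \<le> C * N f"
    using N_oscillation by (elim exE conjE)
  define d where "d = (\<lambda>n x. approx (Suc n) a x - approx n a x)"
  have "uniform_limit K (\<lambda>n x. \<Sum>i<n. d i x) (\<lambda>x. suminf (\<lambda>i. d i x)) sequentially"
  proof (rule Weierstrass_m_test)
    show "norm (d n x) \<le> 2 * C * N a * ratio ^ n" if "x \<in> K" for n x
      using approx_increment[OF C that, of n a] by (simp add: d_def mult_ac)
    show "summable (\<lambda>n. 2 * C * N a * ratio ^ n)"
      using ratio by (intro summable_mult summable_geometric) auto
  qed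
  then have "uniform_limit K (\<lambda>n x. approx 0 a x + (\<Sum>i<n. d i x)) (\<lambda>x. approx 0 a x + suminf (\<lambda>i. d i x)) sequentially"
    by (intro uniform_limit_add uniform_limit_const)
  moreover have "approx 0 a x + (\<Sum>i<n. d i x) = approx n a x" for n x
    unfolding d_def sum_lessThan_telescope[of "\<lambda>n. approx n a x"] by simp
  ultimately have lim: "uniform_limit K (\<lambda>n. approx n a) (\<lambda>x. approx 0 a x + suminf (\<lambda>i. d i x)) sequentially"
    by simp
  have "harm a x = approx 0 a x + suminf (\<lambda>i. d i x)" if "x \<in> K" for x
    unfolding harm_def by (rule limI) (rule tendsto_uniform_limitI[OF lim that])
  then show ?thesis using lim by (simp cong: uniform_limit_cong')
qed

lemma harm_limit: "x \<in> K \<Longrightarrow> (\<lambda>n. approx n a x) \<longlonglongrightarrow> harm a x"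
  by (rule tendsto_uniform_limitI[OF uniform_limit_approx])

lemma continuous_on_harm: "continuous_on K (harm a)"
  by (rule uniform_limit_theorem[OF _ uniform_limit_approx]) (simp_all add: continuous_on_approx)

lemma harm_vertex:
  assumes "i \<in> letters"
  shows "harm a (q i) = a i"
  unfolding harm_def by (rule limI) (simp add: approx_vertex[OF assms])

lemma harm_contr:
  assumes "i \<in> letters" "x \<in> K"
  shows "harm a (contr q i x) = harm (ext a i) x"
proof -
  have "(\<lambda>n. approx (Suc n) a (contr q i x)) \<longlonglongrightarrow> harm a (contr q i x)"
    using harm_limit[OF contr_in_K[OF assms]] by (rule LIMSEQ_Suc)
  then have "(\<lambda>n. approx n (ext a i) x) \<longlonglongrightarrow> harm a (contr q i x)"
    by (simp only: approx_Suc_contr[OF assms])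
  then show ?thesis using harm_limit[OF assms(2)] by (rule LIMSEQ_unique)
qed

text \<open>Every subdivision is a minimal extension, which preserves the energy
  (\<open>ext_energy\<close>).\<close>

lemma energy_harm: "energy (harm a) n = E a"
proof (induction n arbitrary: a)
  case 0
  show ?case unfolding energy_0 by (rule E_cong) (rule harm_vertex)
next
  case (Suc n)
  have "energy (harm a \<circ> contr q i) n = E (ext a i)" if i: "i \<in> letters" for i
  proof -
    have "energy (harm a \<circ> contr q i) n = energy (harm (ext a i)) n"
      by (rule energy_cong) (simp add: harm_contr[OF i])
    then show ?thesis by (simp only: Suc.IH)
  qed
  then have "(\<Sum>i\<in>letters. energy (harm a \<circ> contr q i) n) = (\<Sum>i\<in>letters. E (ext a i))"
    by (intro sum.cong refl)
  then show ?case unfolding energy_Suc by (simp only: ext_energy)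
qed

end

section \<open>Weak comparison\<close>

text \<open>The vector \<open>(a w, sqrt k * b w)\<close> has Euclidean norm at most
  \<open>c w\<close>; the triangle inequality, taken in the complex plane, adds this up.\<close>

lemma sum_power2_mono:
  fixes a b c :: "'a \<Rightarrow> real"
  assumes "\<And>w. w \<in> S \<Longrightarrow> (a w)\<^sup>2 + k * (b w)\<^sup>2 \<le> (c w)\<^sup>2" "\<And>w. w \<in> S \<Longrightarrow> 0 \<le> c w" "0 \<le> k"
  shows "(sum a S)\<^sup>2 + k * (sum b S)\<^sup>2 \<le> (sum c S)\<^sup>2"
proof -
  define z where "z = (\<lambda>w. Complex (a w) (sqrt k * b w))"
  have z: "(cmod (z w))\<^sup>2 = (a w)\<^sup>2 + k * (b w)\<^sup>2" for w
    using assms(3) by (simp add: z_def cmod_power2 power_mult_distrib)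
  have "Re (sum z S) = sum a S" "Im (sum z S) = sqrt k * sum b S"
    by (simp_all add: z_def sum_distrib_left)
  then have "(cmod (sum z S))\<^sup>2 = (sum a S)\<^sup>2 + k * (sum b S)\<^sup>2"
    using assms(3) by (simp add: cmod_power2 power_mult_distrib)
  moreover have "cmod (sum z S) \<le> sum c S"
  proof -
    have "cmod (z w) \<le> c w" if "w \<in> S" for w
      by (rule power2_le_imp_le) (simp_all add: z assms(1,2)[OF that])
    then have "(\<Sum>w\<in>S. cmod (z w)) \<le> sum c S" by (rule sum_mono)
    then show ?thesis using norm_sum[of z S] by linarith
  qed
  then have "(cmod (sum z S))\<^sup>2 \<le> (sum c S)\<^sup>2" by (intro power_mono) auto
  ultimately show ?thesis by simp
qed

section \<open>Small cells and the topology of cell interiors\<close>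

context gasket
begin

lemma small_cells:
  assumes "0 < d"
  shows "\<exists>N. \<forall>n\<ge>N. \<forall>w\<in>words n. \<forall>x\<in>K. \<forall>y\<in>K. dist (contr_word q w x) (contr_word q w y) < d"
proof -
  obtain M where M: "0 < M" "\<forall>x\<in>K. \<forall>y\<in>K. dist x y \<le> M" using dist_K_bounded by blast
  have "(\<lambda>n. M / 2 ^ n) \<longlonglongrightarrow> 0" using LIMSEQ_divide_realpow_zero[of 2 M] by simp
  then have "\<forall>\<^sub>F n in sequentially. M / 2 ^ n < d" using assms by (rule order_tendstoD)
  then obtain N where N: "\<And>n. N \<le> n \<Longrightarrow> M / 2 ^ n < d" unfolding eventually_sequentially by blast
  show ?thesis
  proof (intro exI[of _ N] allI impI ballI)
    fix n w x y assume n: "N \<le> n" and w: "w \<in> words n" and xy: "x \<in> K" "y \<in> K"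
    have "dist (contr_word q w x) (contr_word q w y) = dist x y / 2 ^ n"
      using dist_contr_word[of q w x y] w by (simp add: words_def)
    also have "\<dots> \<le> M / 2 ^ n" using M(2) xy by (simp add: divide_right_mono)
    finally show "dist (contr_word q w x) (contr_word q w y) < d" using N[OF n] by simp
  qed
qed

definition corners :: "nat list \<Rightarrow> (real^2) set" where
  "corners w = contr_word q w ` q ` letters"

lemma cornersE: "y \<in> corners w \<Longrightarrow> \<exists>i\<in>letters. y = contr_word q w (q i)"
  unfolding corners_def by blast

lemma cornersI: "i \<in> letters \<Longrightarrow> contr_word q w (q i) \<in> corners w"
  unfolding corners_def by blast

lemma finite_corners: "finite (corners w)"
  unfolding corners_def by (intro finite_imageI) simp

lemma corners_subset: "corners w \<subseteq> contr_word q w ` K"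
  unfolding corners_def using vertex_in_K by blast

lemma cell_subset_K: "w \<in> words n \<Longrightarrow> contr_word q w ` K \<subseteq> K"
  using contr_word_in_K by blast

lemma compact_cell: "compact (contr_word q w ` K)"
  by (intro compact_continuous_image continuous_on_contr_word compact_K)

text \<open>By \<open>cell_overlap\<close> the complement in \<open>K\<close> is given by the other
  cells of the same level and the corners of this one, finitely many closed sets.\<close>

lemma openin_cell_interior:
  assumes w: "w \<in> words n"
  shows "openin (top_of_set K) (contr_word q w ` K - corners w)"
proof -
  define T where "T = (\<Union>v\<in>words n - {w}. contr_word q v ` K) \<union> corners w"
  have "closed T" unfolding T_def
    by (intro closed_Un closed_UN finite_Diff finite_words ballI compact_imp_closed compact_cell
        finite_imp_compact finite_corners)
  moreover have "contr_word q w ` K - corners w = K \<inter> - T"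
  proof (intro equalityI subsetI)
    fix x assume x: "x \<in> contr_word q w ` K - corners w"
    then obtain y where y: "y \<in> K" "x = contr_word q w y" by blast
    have "x \<notin> contr_word q v ` K" if v: "v \<in> words n - {w}" for v
    proof
      assume "x \<in> contr_word q v ` K"
      then obtain z where z: "z \<in> K" "x = contr_word q v z" by blast
      have "y \<in> q ` letters" using v y z by (intro cell_overlap[OF w _ _ y(1) z(1)]) auto
      then show False using x y(2) unfolding corners_def by blast
    qed
    then have "x \<notin> T" using x unfolding T_def by (simp only: Un_iff UN_iff DiffE) blast
    then show "x \<in> K \<inter> - T" using y(2) contr_word_in_K[OF w y(1)] by simp
  next
    fix x assume x: "x \<in> K \<inter> - T"
    then obtain v y where v: "v \<in> words n" "y \<in> K" "x = contr_word q v y"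
      using K_split_words[of x n] by blast
    then have "v = w" using x unfolding T_def by blast
    then show "x \<in> contr_word q w ` K - corners w" using v x unfolding T_def by blast
  qed
  ultimately show ?thesis by (simp add: openin_open_Int open_Compl)
qed

lemma frontier_cell_interior:
  assumes w: "w \<in> words n"
  shows "(top_of_set K) frontier_of (contr_word q w ` K - corners w) \<subseteq> corners w"
proof -
  have "closedin (top_of_set K) (contr_word q w ` K)"
    using cell_subset_K[OF w] compact_imp_closed[OF compact_cell] by (intro closed_subset)
  then have "(top_of_set K) closure_of (contr_word q w ` K - corners w) \<subseteq> contr_word q w ` K"
    by (intro closure_of_minimal) auto
  then show ?thesis
    using interior_of_openin[OF openin_cell_interior[OF w]] unfolding frontier_of_def by auto
qed

end

section \<open>Uniqueness of minimizers and comparison through boundary values\<close>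

context gasket_form
begin

lemma energy_convex:
  "(energy f n)\<^sup>2 + \<kappa> * (energy g n)\<^sup>2
    \<le> ((energy (\<lambda>x. f x + g x) n + energy (\<lambda>x. f x - g x) n) / 2)\<^sup>2"
proof -
  define c where "c = (\<lambda>w. (E (cell (\<lambda>x. f x + g x) w) + E (cell (\<lambda>x. f x - g x) w)) / 2)"
  have sq: "(\<Sum>w\<in>words n. E (cell f w))\<^sup>2 + \<kappa> * (\<Sum>w\<in>words n. E (cell g w))\<^sup>2 \<le> (sum c (words n))\<^sup>2"
  proof (rule sum_power2_mono)
    fix w
    show "(E (cell f w))\<^sup>2 + \<kappa> * (E (cell g w))\<^sup>2 \<le> (c w)\<^sup>2"
      using E_convex[of "cell f w" "cell g w"] by (simp add: c_def cell_def)
    show "0 \<le> c w" unfolding c_def using E_nonneg by (simp add: add_nonneg_nonneg)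
  qed (use kappa in simp)
  have "(energy (\<lambda>x. f x + g x) n + energy (\<lambda>x. f x - g x) n) / 2 = \<rho> ^ n * sum c (words n)"
    by (simp add: energy_def c_def sum.distrib sum_divide_distrib[symmetric] distrib_left)
  moreover have "(energy f n)\<^sup>2 + \<kappa> * (energy g n)\<^sup>2
    = (\<rho> ^ n)\<^sup>2 * ((\<Sum>w\<in>words n. E (cell f w))\<^sup>2 + \<kappa> * (\<Sum>w\<in>words n. E (cell g w))\<^sup>2)"
    by (simp add: energy_def power_mult_distrib distrib_left)
  ultimately show ?thesis using sq by (simp add: power_mult_distrib mult_left_mono)
qed

text \<open>The function is constant on the corners of each cell, and the cell
  \<open>w @ [j]\<close> shares corner \<open>j\<close> with its parent \<open>w\<close>; so one
  constant is handed down to all vertices, which are dense.\<close>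

lemma energy_zero_imp_const:
  assumes cont: "continuous_on K f" and zero: "\<And>n. energy f n = 0" and x: "x \<in> K"
  shows "f x = f (q 1)"
proof (rule vertices_dense[of f "\<lambda>_. f (q 1)", OF cont continuous_on_const x])
  have const: "\<exists>c. \<forall>i\<in>letters. f (contr_word q w (q i)) = c" if w: "w \<in> words n" for n w
  proof -
    have "(\<Sum>w\<in>words n. E (cell f w)) = 0" using zero[of n] rho by (simp add: energy_def)
    then have "E (cell f w) = 0" using w finite_words E_nonneg by (simp add: sum_nonneg_eq_0_iff)
    then show ?thesis unfolding E_eq_0_iff cell_def .
  qed
  fix n w i assume "w \<in> words n" "i \<in> letters"
  then show "f (contr_word q w (q i)) = f (q 1)"
  proof (induction w arbitrary: n i rule: rev_induct)
    case Nil
    have "[] \<in> words 0" by (simp add: words_0)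
    from const[OF this] obtain c where c: "\<forall>i\<in>letters. f (contr_word q [] (q i)) = c" ..
    then show ?case using bspec[OF c Nil(2)] by simp
  next
    case (snoc j w)
    have j: "j \<in> letters" "w \<in> words (length w)" using snoc.prems(1) by (auto simp: words_def)
    from const[OF snoc.prems(1)] obtain c where c: "\<forall>i\<in>letters. f (contr_word q (w @ [j]) (q i)) = c" ..
    have "f (contr_word q (w @ [j]) (q i)) = f (contr_word q (w @ [j]) (q j))"
      using bspec[OF c snoc.prems(2)] bspec[OF c j(1)] by simp
    also have "\<dots> = f (contr_word q w (q j))" by (simp add: contr_word_append contr_word_Cons)
    also have "\<dots> = f (q 1)" by (rule snoc.IH[OF j(2,1)])
    finally show ?case .
  qed
qed

definition minimizer :: "(real^2) set \<Rightarrow> (real^2 \<Rightarrow> real) \<Rightarrow> bool" where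
  "minimizer U u \<longleftrightarrow> u \<in> fdom \<and> (\<forall>w\<in>fdom. (\<forall>x\<in>K - U. w x = u x) \<longrightarrow> En u \<le> En w)"

lemma minimizer_le: "minimizer U u \<Longrightarrow> w \<in> fdom \<Longrightarrow> (\<And>x. x \<in> K - U \<Longrightarrow> w x = u x) \<Longrightarrow> En u \<le> En w"
  unfolding minimizer_def by blast

lemma minimizer_fdom: "minimizer U u \<Longrightarrow> u \<in> fdom"
  unfolding minimizer_def by blast

lemma minimizer_continuous: "minimizer U u \<Longrightarrow> continuous_on K u"
  unfolding minimizer_def fdom_def by blast

lemma minimizer_subset: "minimizer U u \<Longrightarrow> V \<subseteq> U \<Longrightarrow> minimizer V u"
  unfolding minimizer_def by blast

lemma fdom_add_const:
  assumes "u \<in> fdom" shows "(\<lambda>x. u x + c) \<in> fdom" "En (\<lambda>x. u x + c) = En u"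
proof -
  have "E (cell (\<lambda>x. u x + c) w) = E (cell u w)" for w
    using E_add_const[of "cell u w" c] by (simp add: cell_def)
  then have "energy (\<lambda>x. u x + c) = energy u" by (intro HOL.ext) (simp add: energy_def)
  moreover have "continuous_on K (\<lambda>x. u x + c)"
    using assms by (intro continuous_intros) (simp add: fdom_def)
  ultimately show "(\<lambda>x. u x + c) \<in> fdom" "En (\<lambda>x. u x + c) = En u"
    using assms by (simp_all add: fdom_def En_def)
qed

lemma minimizer_add_const:
  assumes "minimizer U u"
  shows "minimizer U (\<lambda>x. u x + c)"
  unfolding minimizer_def
proof (intro conjI ballI impI)
  show "(\<lambda>x. u x + c) \<in> fdom" by (rule fdom_add_const(1)[OF minimizer_fdom[OF assms]])
  fix w assume w: "w \<in> fdom" "\<forall>x\<in>K - U. w x = u x + c"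
  have "En u \<le> En (\<lambda>x. w x + - c)"
    by (rule minimizer_le[OF assms fdom_add_const(1)[OF w(1)]]) (use w(2) in auto)
  then show "En (\<lambda>x. u x + c) \<le> En w"
    using fdom_add_const(2)[OF w(1), of "- c"] fdom_add_const(2)[OF minimizer_fdom[OF assms], of c] by simp
qed

text \<open>Quantitative convexity for \<open>m = u - \<phi> / 2\<close> and
  \<open>h = \<phi> / 2\<close>: minimality of \<open>u\<close> leaves no room for the energy of
  \<open>h\<close>, so \<phi> is constant, and it vanishes at a point of
  \<open>K - U\<close>.\<close>

lemma minimizer_unique:
  assumes u: "minimizer U u" and \<phi>: "continuous_on K \<phi>" "\<And>x. x \<in> K - U \<Longrightarrow> \<phi> x = 0"
    and proper: "x\<^sub>0 \<in> K - U" and w: "(\<lambda>x. u x - \<phi> x) \<in> fdom" "En (\<lambda>x. u x - \<phi> x) \<le> En u"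
    and x: "x \<in> K"
  shows "\<phi> x = 0"
proof -
  define m where "m = (\<lambda>x. u x - \<phi> x / 2)"
  define h where "h = (\<lambda>x. \<phi> x / 2)"
  have split: "(\<lambda>x. m x + h x) = u" "(\<lambda>x. m x - h x) = (\<lambda>x. u x - \<phi> x)"
    by (auto simp: m_def h_def field_simps)
  have h_cont: "continuous_on K h" unfolding h_def using \<phi>(1) by (intro continuous_intros) auto
  have m_cont: "continuous_on K m"
    unfolding m_def using \<phi>(1) minimizer_continuous[OF u] by (intro continuous_intros) auto
  have sq: "(energy m k)\<^sup>2 + \<kappa> * (energy h k)\<^sup>2 \<le> (En u)\<^sup>2" for k
  proof -
    have "(energy m k)\<^sup>2 + \<kappa> * (energy h k)\<^sup>2 \<le> ((energy u k + energy (\<lambda>x. u x - \<phi> x) k) / 2)\<^sup>2"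
      using energy_convex[of m k h] by (simp only: split)
    also have "\<dots> \<le> (En u)\<^sup>2"
      using energy_le_En[OF minimizer_fdom[OF u], of k] energy_le_En[OF w(1), of k] w(2)
        energy_nonneg[of u k] energy_nonneg[of "\<lambda>x. u x - \<phi> x" k]
      by (intro power_mono) auto
    finally show ?thesis .
  qed
  have Enu: "0 \<le> En u" using energy_le_En[OF minimizer_fdom[OF u], of 0] energy_nonneg[of u 0] by linarith
  have "energy m k \<le> En u" for k
  proof -
    have "(energy m k)\<^sup>2 \<le> (En u)\<^sup>2"
      using sq[of k] kappa by (smt (verit) mult_nonneg_nonneg zero_le_power2)
    then show ?thesis using Enu by (rule power2_le_imp_le)
  qed
  then have m: "m \<in> fdom" using fdomI[of m 0 "En u"] m_cont by blast
  have "En u \<le> En m" by (rule minimizer_le[OF u m]) (simp add: m_def \<phi>(2))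
  have "energy h n = 0" for n
  proof -
    \<comment> \<open>The level of \<open>h\<close> is frozen at \<open>n\<close> while that of
      \<open>m\<close> tends to infinity, so a limit is taken only for \<open>m\<close>.\<close>
    have "(energy m k)\<^sup>2 + \<kappa> * (energy h n)\<^sup>2 \<le> (En u)\<^sup>2" if "n \<le> k" for k
    proof -
      have "(energy h n)\<^sup>2 \<le> (energy h k)\<^sup>2"
        using incseqD[OF incseq_energy that] energy_nonneg by (intro power_mono)
      then show ?thesis using sq[of k] mult_left_mono[of "(energy h n)\<^sup>2" "(energy h k)\<^sup>2" \<kappa>] kappa by linarith
    qed
    moreover have "(\<lambda>k. (energy m k)\<^sup>2 + \<kappa> * (energy h n)\<^sup>2) \<longlonglongrightarrow> (En m)\<^sup>2 + \<kappa> * (energy h n)\<^sup>2"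
      by (intro tendsto_intros En_limit[OF m])
    ultimately have "(En m)\<^sup>2 + \<kappa> * (energy h n)\<^sup>2 \<le> (En u)\<^sup>2" by (intro LIMSEQ_le_const2) blast+
    moreover have "(En u)\<^sup>2 \<le> (En m)\<^sup>2" using \<open>En u \<le> En m\<close> Enu by (rule power_mono)
    ultimately have "\<kappa> * (energy h n)\<^sup>2 \<le> 0" by linarith
    then show ?thesis using kappa by (simp add: mult_le_0_iff)
  qed
  note const = energy_zero_imp_const[OF h_cont this]
  have "h x = h x\<^sub>0" using const[OF x] const[of x\<^sub>0] proper by simp
  then show ?thesis using \<phi>(2)[OF proper] by (simp add: h_def)
qed

text \<open>Exchanging \<open>u\<close> and \<open>v\<close> by minimum and maximum inside
  \<open>U\<close> is governed by submodularity in each cell, but cells may straddle the boundary of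
  \<open>U\<close>. Lifting \<open>v\<close> by \<delta> confines the change to a compact set at
  positive distance from \<open>K - U\<close>, which small cells resolve.\<close>

lemma weak_comparison:
  assumes U: "openin (top_of_set K) U" and proper: "U \<noteq> K"
    and u: "minimizer U u" and v: "minimizer U v"
    and boundary: "\<And>x. x \<in> (top_of_set K) frontier_of U \<Longrightarrow> u x \<le> v x"
    and x: "x \<in> U"
  shows "u x \<le> v x"
proof (rule ccontr)
  assume "\<not> u x \<le> v x"
  \<comment> \<open>Half the excess at \<open>x\<close>, so that \<open>\<phi> x = \<delta>\<close>
    yields the final contradiction.\<close>
  define \<delta> where "\<delta> = (u x - v x) / 2"
  have \<delta>: "0 < \<delta>" using \<open>\<not> u x \<le> v x\<close> by (simp add: \<delta>_def)
  have UK: "U \<subseteq> K" using openin_imp_subset[OF U] .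
  obtain x\<^sub>0 where x0: "x\<^sub>0 \<in> K - U" using UK proper by blast
  define cl where "cl = (top_of_set K) closure_of U"
  have cl: "closedin (top_of_set K) cl" "U \<subseteq> cl" "cl \<subseteq> K"
    unfolding cl_def using closure_of_subset[of U "top_of_set K"] UK closure_of_subset_topspace[of "top_of_set K" U] by auto
  have bd: "u z \<le> v z" if "z \<in> cl" "z \<notin> U" for z
    using boundary[of z] that interior_of_openin[OF U] by (simp add: frontier_of_def cl_def)
  note uc = minimizer_continuous[OF u] and vc = minimizer_continuous[OF v]
  \<comment> \<open>On \<open>U\<close>, \<open>u - \<phi>\<close> is
    \<open>min u (v + \<delta>)\<close> and \<open>v + \<phi>\<close> is
    \<open>max v (u - \<delta>)\<close>.\<close>
  define \<phi> where "\<phi> = (\<lambda>x. if x \<in> U then max (u x - v x - \<delta>) 0 else 0)"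
  have \<phi>_cont: "continuous_on K \<phi>"
  proof -
    have K: "cl \<union> (K - U) = K" using cl by blast
    have "continuous_on (cl \<union> (K - U)) \<phi>" unfolding \<phi>_def
    proof (rule continuous_on_cases_local)
      show "closedin (top_of_set (cl \<union> (K - U))) cl" unfolding K by (rule cl(1))
      show "closedin (top_of_set (cl \<union> (K - U))) (K - U)" unfolding K using U
        by (metis closedin_diff closedin_topspace topspace_euclidean_subtopology)
      show "continuous_on cl (\<lambda>x. max (u x - v x - \<delta>) 0)"
        using continuous_on_subset[OF uc cl(3)] continuous_on_subset[OF vc cl(3)] by (intro continuous_intros)
      show "max (u z - v z - \<delta>) 0 = 0" if "z \<in> cl \<and> z \<notin> U \<or> z \<in> K - U \<and> z \<in> U" for z
        using bd[of z] that \<delta> by auto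
    qed (rule continuous_on_const)
    then show ?thesis unfolding K .
  qed
  define S where "S = {z \<in> cl. \<delta> \<le> u z - v z}"
  have "compact cl" using cl(1) compact_K by (rule closedin_compact[rotated])
  moreover have "closedin (top_of_set cl) S"
  proof -
    have "continuous_on cl (\<lambda>z. u z - v z)"
      using continuous_on_subset[OF uc cl(3)] continuous_on_subset[OF vc cl(3)] by (intro continuous_intros)
    then have "closedin (top_of_set cl) (cl \<inter> (\<lambda>z. u z - v z) -` {\<delta>..})"
      by (intro continuous_closedin_preimage) auto
    moreover have "cl \<inter> (\<lambda>z. u z - v z) -` {\<delta>..} = S" by (auto simp: S_def)
    ultimately show ?thesis by simp
  qed
  ultimately have S: "compact S" by (rule closedin_compact)
  have closed: "closed (K - U)"
  proof -
    have "closedin (top_of_set K) (K - U)" using U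
      by (metis closedin_diff closedin_topspace topspace_euclidean_subtopology)
    then show ?thesis using compact_imp_closed[OF compact_K] by (rule closedin_closed_trans)
  qed
  have "S \<inter> (K - U) = {}"
  proof -
    have "z \<in> U" if "z \<in> S" for z
      using that bd[of z] \<delta> unfolding S_def by force
    then show ?thesis by blast
  qed
  then obtain d where d: "0 < d" "\<And>y z. y \<in> S \<Longrightarrow> z \<in> K - U \<Longrightarrow> d \<le> dist y z"
    using separate_compact_closed[OF S closed] by blast
  obtain N where N: "\<forall>n\<ge>N. \<forall>w\<in>words n. \<forall>x\<in>K. \<forall>y\<in>K. dist (contr_word q w x) (contr_word q w y) < d"
    using small_cells[OF d(1)] by blast
  define u' where "u' = (\<lambda>x. u x - \<phi> x)"
  define v' where "v' = (\<lambda>x. v x + \<phi> x)"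
  have cell_le: "E (cell u' w) + E (cell v' w) \<le> E (cell u w) + E (cell v w)"
    if n: "N \<le> n" and w: "w \<in> words n" for n w
  \<comment> \<open>A changed corner lies in \<open>S\<close>, and then the whole cell, being
    smaller than \<open>d\<close>, stays in \<open>U\<close>; submodularity applies to
    \<open>u\<close> and \<open>v + \<delta>\<close>. Otherwise no corner value changes.\<close>
  proof (cases "\<exists>i\<in>letters. \<phi> (contr_word q w (q i)) \<noteq> 0")
    case True
    then obtain i where i: "i \<in> letters" "\<phi> (contr_word q w (q i)) \<noteq> 0" by (elim bexE)
    then have "contr_word q w (q i) \<in> S"
      using cl(2) by (auto simp: \<phi>_def S_def split: if_splits)
    then have inU: "contr_word q w (q j) \<in> U" if j: "j \<in> letters" for j
      using d(2)[of "contr_word q w (q i)" "contr_word q w (q j)"] N n w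
        vertex_in_K[OF i(1)] vertex_in_K[OF j] contr_word_in_K[OF w vertex_in_K[OF j]] by force
    have "E (cell u' w) = E (\<lambda>j. min (cell u w j) (cell v w j + \<delta>))"
      by (rule E_cong) (use inU in \<open>simp add: cell_def u'_def \<phi>_def min_def max_def del: insert_iff\<close>)
    moreover have "E (cell v' w) = E (\<lambda>j. max (cell u w j) (cell v w j + \<delta>) + - \<delta>)"
      by (rule E_cong) (use inU in \<open>simp add: cell_def v'_def \<phi>_def max_def del: insert_iff\<close>)
    moreover have "\<dots> = E (\<lambda>j. max (cell u w j) (cell v w j + \<delta>))" by (rule E_add_const)
    moreover have "E (\<lambda>j. cell v w j + \<delta>) = E (cell v w)" by (rule E_add_const)
    ultimately show ?thesis using E_min_max[of "cell u w" "\<lambda>j. cell v w j + \<delta>"] by linarith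
  next
    case False
    then have zero: "\<phi> (contr_word q w (q i)) = 0" if "i \<in> letters" for i using that by blast
    have "E (cell u' w) = E (cell u w)" by (rule E_cong) (simp only: cell_def u'_def zero diff_0_right)
    moreover have "E (cell v' w) = E (cell v w)" by (rule E_cong) (simp only: cell_def v'_def zero add_0_right)
    ultimately show ?thesis by simp
  qed
  have level: "energy u' n + energy v' n \<le> energy u n + energy v n" if n: "N \<le> n" for n
  proof -
    have "(\<Sum>w\<in>words n. E (cell u' w) + E (cell v' w)) \<le> (\<Sum>w\<in>words n. E (cell u w) + E (cell v w))"
      by (rule sum_mono) (rule cell_le[OF n])
    then have "\<rho> ^ n * (\<Sum>w\<in>words n. E (cell u' w) + E (cell v' w))
        \<le> \<rho> ^ n * (\<Sum>w\<in>words n. E (cell u w) + E (cell v w))"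
      using rho by (intro mult_left_mono) auto
    then show ?thesis by (simp add: energy_def sum.distrib distrib_left)
  qed
  have bound: "energy u' n + energy v' n \<le> En u + En v" if "N \<le> n" for n
    using level[OF that] energy_le_En[OF minimizer_fdom[OF u], of n] energy_le_En[OF minimizer_fdom[OF v], of n]
    by linarith
  have u': "u' \<in> fdom"
  proof (rule fdomI(1)[of u' N])
    show "continuous_on K u'" unfolding u'_def using uc \<phi>_cont by (intro continuous_intros)
    show "energy u' n \<le> En u + En v" if "N \<le> n" for n using bound[OF that] energy_nonneg[of v' n] by linarith
  qed
  have v': "v' \<in> fdom"
  proof (rule fdomI(1)[of v' N])
    show "continuous_on K v'" unfolding v'_def using vc \<phi>_cont by (intro continuous_intros)
    show "energy v' n \<le> En u + En v" if "N \<le> n" for n using bound[OF that] energy_nonneg[of u' n] by linarith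
  qed
  have "(\<lambda>n. energy u' n + energy v' n) \<longlonglongrightarrow> En u' + En v'"
    by (intro tendsto_add En_limit u' v')
  then have "En u' + En v' \<le> En u + En v" by (rule LIMSEQ_le_const2) (use bound in blast)
  \<comment> \<open>Minimality of \<open>v\<close> leaves \<open>u'\<close> with at most the energy
    of \<open>u\<close>, which is what uniqueness requires.\<close>
  moreover have "En v \<le> En v'" by (rule minimizer_le[OF v v']) (simp add: v'_def \<phi>_def)
  ultimately have "En u' \<le> En u" by linarith
  have "\<phi> x = 0"
  proof (rule minimizer_unique[OF u \<phi>_cont _ x0])
    show "\<phi> z = 0" if "z \<in> K - U" for z using that by (simp add: \<phi>_def)
    show "(\<lambda>x. u x - \<phi> x) \<in> fdom" "En (\<lambda>x. u x - \<phi> x) \<le> En u"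
      using u' \<open>En u' \<le> En u\<close> by (simp_all add: u'_def)
    show "x \<in> K" using x UK by blast
  qed
  then show False using x \<delta> by (simp add: \<phi>_def \<delta>_def max_def field_simps split: if_splits)
qed

end

section \<open>Strong comparison\<close>

context gasket_form
begin

definition star :: "nat \<Rightarrow> real^2 \<Rightarrow> nat list set" where
  "star n y = {w \<in> words n. y \<in> corners w}"

text \<open>The indicator of the vertex \<open>y\<close> as seen from cell \<open>w\<close>; on the
  letters it is some \<open>unit_at i\<close> if \<open>w\<close> lies in the star.\<close>

definition spike :: "real^2 \<Rightarrow> nat list \<Rightarrow> nat \<Rightarrow> real" where
  "spike y w i = (if contr_word q w (q i) = y then 1 else 0)"

text \<open>The competitor moves the value at \<open>y\<close> by \<open>t\<close> and is harmonic
  in the cells around \<open>y\<close>. There its energy stays \<open>?J t\<close> on all finer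
  levels, while that of \<open>u\<close> is at least \<open>?J 0\<close>, so \<open>?J\<close> has a
  minimum at 0.\<close>

lemma vertex_balance:
  assumes u: "minimizer U u" and U: "\<And>w. w \<in> star n y \<Longrightarrow> contr_word q w ` K \<subseteq> U"
  shows "(\<Sum>w\<in>star n y. D (cell u w) (spike y w)) = 0"
proof -
  let ?J = "\<lambda>t. \<Sum>w\<in>star n y. E (\<lambda>i. cell u w i + t * spike y w i)"
  have uc: "continuous_on K u" by (rule minimizer_continuous[OF u])
  have star: "star n y \<subseteq> words n" "finite (star n y)"
    using finite_words[of n] by (auto simp: star_def)
  have "(?J has_real_derivative (\<Sum>w\<in>star n y. D (cell u w) (spike y w))) (at 0)"
    by (intro DERIV_sum D_has_derivative)
  moreover have "?J 0 \<le> ?J t" for t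
  proof -
    \<comment> \<open>The level \<open>n\<close> vertex values of the competitor: those of
      \<open>u\<close>, with \<open>y\<close> moved by \<open>t\<close>.\<close>
    define c where "c = (\<lambda>z. u z + t * (if z = y then 1 else 0))"
    define f where "f = (\<lambda>w. if w \<in> star n y then harm (\<lambda>i. c (contr_word q w (q i))) else u \<circ> contr_word q w)"
    have "\<exists>g. continuous_on K g \<and> (\<forall>w\<in>words n. \<forall>x\<in>K. g (contr_word q w x) = f w x)"
    proof (rule glue_words)
      fix w assume w: "w \<in> words n"
      show "continuous_on K (f w)"
        using continuous_on_compose[OF continuous_on_contr_word continuous_on_subset[OF uc cell_subset_K[OF w]]]
        by (simp add: f_def continuous_on_harm)
      fix i assume i: "i \<in> letters"
      show "f w (q i) = c (contr_word q w (q i))"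
      proof (cases "w \<in> star n y")
        case True
        then show ?thesis by (simp add: f_def harm_vertex[OF i])
      next
        case False
        then have "contr_word q w (q i) \<noteq> y" using w cornersI[OF i, of w] by (auto simp: star_def)
        then show ?thesis using False by (simp add: f_def c_def)
      qed
    qed
    then obtain g where g: "continuous_on K g"
      and gf: "\<forall>w\<in>words n. \<forall>x\<in>K. g (contr_word q w x) = f w x" by (elim exE conjE)
    define R where "R = (\<lambda>m. \<Sum>w\<in>words n - star n y. energy (u \<circ> contr_word q w) m)"
    have split: "(\<Sum>w\<in>words n. h w) = (\<Sum>w\<in>words n - star n y. h w) + (\<Sum>w\<in>star n y. h w)" for h :: "nat list \<Rightarrow> real"
      by (rule sum.subset_diff[OF star(1) finite_words])
    have energy_g: "energy g (n + m) = \<rho> ^ n * (R m + ?J t)" for m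
    proof -
      have eq: "energy (g \<circ> contr_word q w) m = energy (f w) m" if "w \<in> words n" for w
        by (rule energy_cong) (use gf that in simp)
      have "(\<Sum>w\<in>words n - star n y. energy (g \<circ> contr_word q w) m) = R m"
        unfolding R_def by (rule sum.cong) (simp_all add: eq f_def)
      moreover have "(\<Sum>w\<in>star n y. energy (g \<circ> contr_word q w) m) = ?J t"
      proof (rule sum.cong)
        fix w assume w: "w \<in> star n y"
        then have "energy (g \<circ> contr_word q w) m = E (\<lambda>i. c (contr_word q w (q i)))"
          using eq[of w] star(1) by (simp add: f_def energy_harm subset_iff)
        then show "energy (g \<circ> contr_word q w) m = E (\<lambda>i. cell u w i + t * spike y w i)"
          by (simp only: c_def cell_def spike_def)
      qed simp
      ultimately show ?thesis unfolding energy_append split by simp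
    qed
    have energy_u: "\<rho> ^ n * (R m + ?J 0) \<le> energy u (n + m)" for m
    proof -
      have "?J 0 \<le> (\<Sum>w\<in>star n y. energy (u \<circ> contr_word q w) m)"
      proof (rule sum_mono)
        fix w assume "w \<in> star n y"
        have "energy (u \<circ> contr_word q w) 0 \<le> energy (u \<circ> contr_word q w) m"
          by (rule incseqD[OF incseq_energy]) simp
        then show "E (\<lambda>i. cell u w i + 0 * spike y w i) \<le> energy (u \<circ> contr_word q w) m"
          by (simp add: energy_0 cell_def)
      qed
      then show ?thesis unfolding energy_append split R_def using rho by (intro mult_left_mono) auto
    qed
    \<comment> \<open>The energy \<open>R m\<close> outside the star is common to \<open>g\<close>
      and \<open>u\<close>, so it cancels.\<close>
    have bound: "energy g k \<le> En u + \<rho> ^ n * (?J t - ?J 0)" if "n \<le> k" for k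
    proof -
      obtain m where k: "k = n + m" using le_Suc_ex[OF \<open>n \<le> k\<close>] by (elim exE)
      have "energy g k = \<rho> ^ n * (R m + ?J 0) + \<rho> ^ n * (?J t - ?J 0)"
        unfolding k energy_g by (simp only: distrib_left[symmetric]) simp
      then show ?thesis using energy_u[of m] energy_le_En[OF minimizer_fdom[OF u], of "n + m"] by linarith
    qed
    have gd: "g \<in> fdom" "En g \<le> En u + \<rho> ^ n * (?J t - ?J 0)"
      using fdomI[of g n, OF g bound] by blast+
    have "En u \<le> En g"
    proof (rule minimizer_le[OF u gd(1)])
      fix x assume x: "x \<in> K - U"
      then obtain w z where w: "w \<in> words n" "z \<in> K" "x = contr_word q w z"
        using K_split_words[of x n] by blast
      then have "w \<notin> star n y" using U x by blast
      then show "g x = u x" using gf w by (simp add: f_def)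
    qed
    then have nonneg: "0 \<le> \<rho> ^ n * (?J t - ?J 0)" using gd(2) by linarith
    show ?thesis
    proof (rule ccontr)
      assume "\<not> ?J 0 \<le> ?J t"
      then have "?J t - ?J 0 < 0" by linarith
      then have "\<rho> ^ n * (?J t - ?J 0) < 0" by (rule mult_pos_neg[OF zero_less_power[OF rho]])
      then show False using nonneg by linarith
    qed
  qed
  ultimately show ?thesis by (rule deriv_zero_of_min)
qed

text \<open>In each cell of the star, ordered contact gives the same one-sided flux inequality. Both
  sums vanish, so the fluxes agree cell by cell and \<open>D_strong_comparison\<close> applies to
  the corner values.\<close>

lemma contact_at_vertex:
  assumes u: "minimizer U u" and v: "minimizer U v" and U: "\<And>w. w \<in> star n y \<Longrightarrow> contr_word q w ` K \<subseteq> U"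
    and le: "\<forall>x\<in>U. u x \<le> v x" and eq: "u y = v y"
    and w: "w \<in> star n y" and l: "l \<in> letters"
  shows "u (contr_word q w (q l)) = v (contr_word q w (q l))"
proof -
  have fin: "finite (star n y)" using finite_words[of n] by (simp add: star_def)
  have cell_le: "\<forall>i\<in>letters. cell u w i \<le> cell v w i" if w: "w \<in> star n y" for w
    using le U[OF w] vertex_in_K by (auto simp: cell_def simp del: insert_iff)
  have mono: "D (cell v w) (spike y w) \<le> D (cell u w) (spike y w)" if w: "w \<in> star n y" for w
  proof (rule D_antimono)
    fix i assume i: "i \<in> letters"
    show "cell u w i \<le> cell v w i" using cell_le[OF w] i by (rule bspec)
    show "0 \<le> spike y w i" by (simp add: spike_def)
    show "cell u w i = cell v w i" if "spike y w i \<noteq> 0"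
      using that eq by (auto simp: spike_def cell_def split: if_splits)
  qed
  have "(\<Sum>w\<in>star n y. D (cell u w) (spike y w) - D (cell v w) (spike y w)) = 0"
    unfolding sum_subtractf using vertex_balance[OF u U] vertex_balance[OF v U] by simp
  then have flux: "D (cell u w) (spike y w) = D (cell v w) (spike y w)"
    using mono w fin by (subst (asm) sum_nonneg_eq_0_iff) auto
  obtain i where i: "i \<in> letters" "y = contr_word q w (q i)"
    using w cornersE[of y w] by (auto simp: star_def simp del: insert_iff)
  have spike: "spike y w j = unit_at i j" if j: "j \<in> letters" for j
    using contr_word_inj[of q w "q j" "q i"] vertex_inj[OF j i(1)] i(2) by (auto simp: spike_def)
  have "cell u w l = cell v w l"
  proof (rule D_strong_comparison[OF cell_le[OF w] i(1) _ _ l])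
    show "cell u w i = cell v w i" using eq i(2) by (simp add: cell_def)
    have "D (cell u w) (spike y w) = D (cell u w) (unit_at i)" "D (cell v w) (spike y w) = D (cell v w) (unit_at i)"
      using spike by (intro D_cong refl; assumption)+
    then show "D (cell u w) (unit_at i) = D (cell v w) (unit_at i)" using flux by simp
  qed
  then show ?thesis by (simp add: cell_def)
qed

text \<open>Weak comparison on the cell without its corners, an open set whose frontier lies in the
  corners.\<close>

lemma cell_comparison:
  assumes w: "w \<in> words n" and sub: "contr_word q w ` K \<subseteq> U"
    and u: "minimizer U u" and v: "minimizer U v"
    and le: "\<And>i. i \<in> letters \<Longrightarrow> u (contr_word q w (q i)) \<le> v (contr_word q w (q i))"
    and x: "x \<in> contr_word q w ` K"
  shows "u x \<le> v x"
proof (cases "x \<in> corners w")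
  case True
  then show ?thesis using le cornersE by blast
next
  case False
  let ?V = "contr_word q w ` K - corners w"
  show ?thesis
  proof (rule weak_comparison)
    show "openin (top_of_set K) ?V" by (rule openin_cell_interior[OF w])
    have one: "(1::nat) \<in> letters" by simp
    show "?V \<noteq> K" using cornersI[OF one, of w] vertex_word_in_K[OF w one] by blast
    show "minimizer ?V u" "minimizer ?V v" using u v sub by (auto intro: minimizer_subset)
    show "u z \<le> v z" if "z \<in> (top_of_set K) frontier_of ?V" for z
    proof -
      have "z \<in> corners w" using that frontier_cell_interior[OF w] by blast
      then show ?thesis using le cornersE by blast
    qed
    show "x \<in> ?V" using x False by blast
  qed
qed

text \<open>If all corners had a gap of at least \<open>c > 0\<close>, comparing
  \<open>u + c\<close> with \<open>v\<close> would keep this gap throughout the cell.\<close>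

lemma contact_in_cell:
  assumes w: "w \<in> words n" and sub: "contr_word q w ` K \<subseteq> U"
    and u: "minimizer U u" and v: "minimizer U v"
    and le: "\<forall>x\<in>U. u x \<le> v x"
    and x: "x \<in> contr_word q w ` K" and eq: "u x = v x"
  shows "\<exists>i\<in>letters. u (contr_word q w (q i)) = v (contr_word q w (q i))"
proof (rule ccontr)
  assume neq: "\<not> (\<exists>i\<in>letters. u (contr_word q w (q i)) = v (contr_word q w (q i)))"
  define gap where "gap = (\<lambda>i. v (contr_word q w (q i)) - u (contr_word q w (q i)))"
  have pos: "0 < gap i" if i: "i \<in> letters" for i
  proof -
    have "contr_word q w (q i) \<in> U" using sub vertex_in_K[OF i] by blast
    then have "u (contr_word q w (q i)) \<le> v (contr_word q w (q i))" by (rule bspec[OF le])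
    moreover have "u (contr_word q w (q i)) \<noteq> v (contr_word q w (q i))" using neq i by blast
    ultimately show ?thesis by (simp add: gap_def)
  qed
  define c where "c = min (gap 1) (min (gap 2) (gap 3))"
  have c: "0 < c" using pos[of 1] pos[of 2] pos[of 3] by (simp add: c_def)
  have "u x + c \<le> v x"
  proof (rule cell_comparison[OF w sub minimizer_add_const[OF u] v _ x])
    fix i assume i: "i \<in> letters"
    have "c \<le> gap i" using i by (auto simp: c_def)
    then show "u (contr_word q w (q i)) + c \<le> v (contr_word q w (q i))" by (simp add: gap_def)
  qed
  then show False using eq c by simp
qed

lemma strong_comparison:
  assumes U: "openin (top_of_set K) U" and conn: "connected U" and proper: "U \<noteq> K"
    and u: "minimizer U u" and v: "minimizer U v"
    and boundary: "\<And>x. x \<in> (top_of_set K) frontier_of U \<Longrightarrow> u x \<le> v x"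
  shows "(\<forall>x\<in>U. u x < v x) \<or> (\<forall>x\<in>U. u x = v x)"
proof -
  have le: "\<forall>x\<in>U. u x \<le> v x"
    by (intro ballI weak_comparison[OF U proper u v boundary])
  have UK: "U \<subseteq> K" by (rule openin_imp_subset[OF U])
  define Z where "Z = {x \<in> U. u x = v x}"
  have "openin (top_of_set U) Z"
  proof (subst openin_subopen, intro ballI)
    fix x assume x: "x \<in> Z"
    then have xU: "x \<in> U" "u x = v x" by (auto simp: Z_def)
    obtain r where r: "0 < r" "ball x r \<inter> K \<subseteq> U"
      using U xU(1) unfolding openin_contains_ball by blast
    \<comment> \<open>With half the radius, a cell through \<open>x\<close> and all cells of the
      star of any of its corners still lie in \<open>U\<close>.\<close>
    then obtain n where n: "\<forall>w\<in>words n. \<forall>x\<in>K. \<forall>y\<in>K. dist (contr_word q w x) (contr_word q w y) < r / 2"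
      using small_cells[of "r / 2"] by auto
    have diam: "dist a b < r / 2" if "w \<in> words n" "a \<in> contr_word q w ` K" "b \<in> contr_word q w ` K" for w a b
      using n that by blast
    have near: "contr_word q w ` K \<subseteq> U" if w: "w \<in> words n" and y: "y \<in> contr_word q w ` K" "dist x y < r / 2" for w y
    proof
      fix z assume z: "z \<in> contr_word q w ` K"
      have "dist x z < r" using diam[OF w y(1) z] y(2) dist_triangle[of x z y] by linarith
      moreover have "z \<in> K" using z cell_subset_K[OF w] by blast
      ultimately have "z \<in> ball x r \<inter> K" by simp
      then show "z \<in> U" using r(2) by blast
    qed
    have cell_eq: "u z = v z" if w: "w \<in> words n" and xw: "x \<in> contr_word q w ` K" and z: "z \<in> contr_word q w ` K" for w z
    proof -
      have sub: "contr_word q w ` K \<subseteq> U" by (rule near[OF w xw]) (use r(1) in simp)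
      obtain i where i: "i \<in> letters" "u (contr_word q w (q i)) = v (contr_word q w (q i))"
        using contact_in_cell[OF w sub u v le xw xU(2)] by (elim bexE)
      define y where "y = contr_word q w (q i)"
      have yw: "y \<in> contr_word q w ` K" unfolding y_def using vertex_in_K[OF i(1)] by blast
      have "contr_word q w' ` K \<subseteq> U" if "w' \<in> star n y" for w'
        using that near[of w' y] corners_subset[of w'] diam[OF w xw yw] by (auto simp: star_def)
      moreover have "w \<in> star n y" using w cornersI[OF i(1), of w] by (simp add: star_def y_def)
      ultimately have vert: "u (contr_word q w (q l)) = v (contr_word q w (q l))" if "l \<in> letters" for l
        using that i(2) by (intro contact_at_vertex[OF u v _ le]) (auto simp: y_def simp del: insert_iff)
      have "u z \<le> v z" by (rule cell_comparison[OF w sub u v _ z]) (simp only: vert)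
      moreover have "v z \<le> u z" by (rule cell_comparison[OF w sub v u _ z]) (simp only: vert)
      ultimately show ?thesis by simp
    qed
    \<comment> \<open>Outside \<open>T\<close> every cell through a point contains \<open>x\<close>,
      so \<open>U \<inter> - T\<close> is a neighbourhood of \<open>x\<close> covered by cells of
      full contact.\<close>
    define T where "T = (\<Union>w\<in>{w \<in> words n. x \<notin> contr_word q w ` K}. contr_word q w ` K)"
    have "closed T" unfolding T_def
      using finite_words[of n] by (intro closed_UN ballI compact_imp_closed compact_cell) simp
    show "\<exists>T. openin (top_of_set U) T \<and> x \<in> T \<and> T \<subseteq> Z"
    proof (intro exI[of _ "U \<inter> - T"] conjI)
      show "openin (top_of_set U) (U \<inter> - T)" using \<open>closed T\<close> by (intro openin_open_Int open_Compl)
      show "x \<in> U \<inter> - T" using xU(1) by (auto simp: T_def)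
      show "U \<inter> - T \<subseteq> Z"
      proof
        fix z assume z: "z \<in> U \<inter> - T"
        then obtain w y where w: "w \<in> words n" "y \<in> K" "z = contr_word q w y"
          using K_split_words[of z n] UK by blast
        then have "z \<in> contr_word q w ` K" by blast
        moreover from this have "x \<in> contr_word q w ` K" using z w(1) unfolding T_def by blast
        ultimately show "z \<in> Z" using cell_eq[OF w(1)] z by (simp add: Z_def)
      qed
    qed
  qed
  moreover have "closedin (top_of_set U) Z"
  proof -
    have "continuous_on U (\<lambda>x. u x - v x)"
      using continuous_on_subset[OF minimizer_continuous[OF u] UK] continuous_on_subset[OF minimizer_continuous[OF v] UK]
      by (intro continuous_intros)
    then have "closedin (top_of_set U) {x \<in> U. u x - v x = 0}"
      by (rule continuous_closedin_preimage_constant)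
    then show ?thesis by (simp add: Z_def)
  qed
  ultimately have "Z = {} \<or> Z = U" using conn unfolding connected_clopen by blast
  then show ?thesis
  proof
    assume "Z = {}"
    then have "\<forall>x\<in>U. u x \<noteq> v x" by (auto simp: Z_def)
    then show ?thesis using le by (auto simp: less_le)
  qed (auto simp: Z_def)
qed

end

section \<open>The canonical form\<close>

context gasket
begin

lemma lift_vertex: "i \<in> letters \<Longrightarrow> lift q f (q i) = f i"
  using equilateral_distinct[OF triangle] by (auto simp: lift_def)

lemma lift_in_funs: "lift q f \<in> funs (q ` letters)"
  by (auto simp: lift_def funs_def)

lemma lift_cong: "(\<And>i. i \<in> letters \<Longrightarrow> f i = g i) \<Longrightarrow> lift q f = lift q g"
  by (rule HOL.ext) (simp add: lift_def)

lemma restr_vertices_eq_lift: "restr (q ` letters) g = lift q (\<lambda>i. g (q i))"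
  by (rule HOL.ext) (auto simp: restr_def lift_def)

lemma renorm_eq:
  "renorm q \<rho> n E0 u = \<rho> ^ n * (\<Sum>w\<in>words n. E0 (lift q (\<lambda>i. u (contr_word q w (q i)))))"
  by (simp only: renorm_def restr_vertices_eq_lift sum_distrib_left o_apply)

lemma vertex_mem: "w \<in> words n \<Longrightarrow> i \<in> letters \<Longrightarrow> contr_word q w (q i) \<in> vertices q n"
  unfolding vertices_def by blast

lemma level_energy_eq:
  "level_energy q \<rho> E0 u n = \<rho> ^ n * (\<Sum>w\<in>words n. E0 (lift q (\<lambda>i. u (contr_word q w (q i)))))"
proof -
  have "lift q (\<lambda>i. restr (vertices q n) u (contr_word q w (q i))) = lift q (\<lambda>i. u (contr_word q w (q i)))"
    if "w \<in> words n" for w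
    by (rule lift_cong) (simp only: restr_def vertex_mem[OF that] if_True)
  then show ?thesis unfolding level_energy_def renorm_eq by simp
qed

lemma renorm_1_eq:
  "renorm q \<rho> 1 E0 u = \<rho> * (\<Sum>i\<in>letters. E0 (lift q (\<lambda>j. u (contr q i (q j)))))"
proof -
  have "(\<Sum>w\<in>words (Suc 0). h w) = (\<Sum>i\<in>letters. h [i])" for h :: "nat list \<Rightarrow> real"
    unfolding words_1 by (subst sum.reindex) (auto simp: inj_on_def)
  then show ?thesis unfolding renorm_eq by (simp only: One_nat_def contr_word_Cons contr_word_Nil id_apply power_Suc0_right)
qed

lemma oscillation_bound:
  assumes p: "1 < p" and form: "p_resistance_form p (q ` letters) (funs (q ` letters)) E0"
  shows "\<exists>C. \<forall>f. \<forall>i\<in>letters. \<forall>j\<in>letters. \<bar>f i - f j\<bar> powr p \<le> C * E0 (lift q f)"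
proof -
  have nonneg: "0 \<le> E0 (lift q f)" for f
    using form lift_in_funs unfolding p_resistance_form_def by blast
  have zero: "{u \<in> funs (q ` letters). E0 u = 0} = const_funs (q ` letters)"
    and rf4: "RF4 p (q ` letters) (funs (q ` letters)) E0"
    using form unfolding p_resistance_form_def RF1_def by blast+
  have "\<exists>C. \<forall>f. \<bar>f i - f j\<bar> powr p \<le> C * E0 (lift q f)" if ij: "i \<in> letters" "j \<in> letters" for i j
  proof -
    have "bdd_above {\<bar>u (q i) - u (q j)\<bar> powr p / E0 u | u. u \<in> funs (q ` letters) - const_funs (q ` letters)}"
      using rf4[unfolded RF4_def, rule_format, OF imageI[OF ij(1)] imageI[OF ij(2)]] .
    then obtain C where C: "\<And>u. u \<in> funs (q ` letters) - const_funs (q ` letters)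
      \<Longrightarrow> \<bar>u (q i) - u (q j)\<bar> powr p / E0 u \<le> C"
      unfolding bdd_above_def by blast
    have "\<bar>f i - f j\<bar> powr p \<le> C * E0 (lift q f)" for f
    \<comment> \<open>RF4 excludes the constants, for which both sides of the claim vanish.\<close>
    proof (cases "lift q f \<in> const_funs (q ` letters)")
      case True
      then obtain c where c: "lift q f = restr (q ` letters) (\<lambda>_. c)" by (auto simp: const_funs_def)
      have "f k = c" if "k \<in> letters" for k
        using fun_cong[OF c, of "q k"] by (simp only: lift_vertex[OF that] restr_def imageI[OF that] if_True)
      then have "f i = f j" using ij by simp
      moreover have "E0 (lift q f) = 0" using True zero by blast
      ultimately show ?thesis using p by simp
    next
      case False
      then have "E0 (lift q f) \<noteq> 0" using zero lift_in_funs[of f] by blast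
      then have "0 < E0 (lift q f)" using nonneg[of f] by simp
      moreover have "\<bar>f i - f j\<bar> powr p / E0 (lift q f) \<le> C"
        using C[of "lift q f"] False lift_in_funs[of f] by (simp only: lift_vertex[OF ij(1)] lift_vertex[OF ij(2)]) blast
      ultimately show ?thesis by (simp add: pos_divide_le_eq)
    qed
    then show ?thesis by blast
  qed
  then have "\<forall>i\<in>letters. \<forall>j\<in>letters. \<exists>C. \<forall>f. \<bar>f i - f j\<bar> powr p \<le> C * E0 (lift q f)" by blast
  then obtain C where C: "\<forall>i\<in>letters. \<forall>j\<in>letters. \<forall>f. \<bar>f i - f j\<bar> powr p \<le> C i j * E0 (lift q f)"
    unfolding bchoice_iff by (elim exE)
  show ?thesis
  proof (intro exI[of _ "\<Sum>i\<in>letters. \<Sum>j\<in>letters. \<bar>C i j\<bar>"] allI ballI)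
    fix f i j assume ij: "i \<in> letters" "j \<in> letters"
    have "\<bar>C i j\<bar> \<le> (\<Sum>j\<in>letters. \<bar>C i j\<bar>)" by (rule member_le_sum[OF ij(2)]) auto
    also have "\<dots> \<le> (\<Sum>i\<in>letters. \<Sum>j\<in>letters. \<bar>C i j\<bar>)"
      by (rule member_le_sum[OF ij(1)]) (auto intro: sum_nonneg)
    finally have "C i j * E0 (lift q f) \<le> (\<Sum>i\<in>letters. \<Sum>j\<in>letters. \<bar>C i j\<bar>) * E0 (lift q f)"
      by (intro mult_right_mono nonneg) linarith
    moreover have "\<bar>f i - f j\<bar> powr p \<le> C i j * E0 (lift q f)" using C ij by blast
    ultimately show "\<bar>f i - f j\<bar> powr p \<le> (\<Sum>i\<in>letters. \<Sum>j\<in>letters. \<bar>C i j\<bar>) * E0 (lift q f)"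
      by linarith
  qed
qed

text \<open>The rows, read as functions on the outer vertices, are glued; symmetry is their
  compatibility at common points.\<close>

lemma matrix_realization:
  assumes sym: "\<And>i j. i \<in> letters \<Longrightarrow> j \<in> letters \<Longrightarrow> A i j = A j i"
  shows "\<exists>v\<in>funs (vertices q 1). (\<forall>i\<in>letters. \<forall>j\<in>letters. v (contr q i (q j)) = A i j)"
proof (intro bexI[of _ "restr (vertices q 1) (glue (\<lambda>i. lift q (A i)))"] ballI)
  fix i j assume ij: "i \<in> letters" "j \<in> letters"
  have "glue (\<lambda>i. lift q (A i)) (contr q i (q j)) = lift q (A i) (q j)"
    by (rule glue_contr[OF _ ij(1) vertex_in_K[OF ij(2)]]) (simp only: lift_vertex sym)
  moreover have "contr q i (q j) \<in> vertices q 1"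
  proof -
    have "[i] \<in> words 1" using ij(1) unfolding One_nat_def words_1 by blast
    then show ?thesis using vertex_mem[of "[i]" 1 j] ij(2) by (simp only: contr_word_Cons contr_word_Nil id_apply)
  qed
  ultimately show "restr (vertices q 1) (glue (\<lambda>i. lift q (A i))) (contr q i (q j)) = A i j"
    by (simp only: restr_def lift_vertex[OF ij(2)] if_True)
qed (simp add: restr_def funs_def)

lemma canonical_gasket_form:
  assumes p: "1 < p" and rho: "0 < \<rho>"
    and form: "p_resistance_form p (q ` letters) (funs (q ` letters)) E0"
    and fixed_form: "renorm_fixed q \<rho> E0"
  shows "\<exists>\<kappa> \<epsilon>. gasket_form q K p (\<lambda>f. E0 (lift q f)) \<kappa> \<epsilon> \<rho>"
proof -
  let ?E = "\<lambda>f. E0 (lift q f)"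
  have nonneg: "0 \<le> ?E f" for f
    using form lift_in_funs unfolding p_resistance_form_def by blast
  obtain k e where "three_point_form p ?E k e"
    using resistance_form_three_point[OF p triangle form] .
  then interpret three_point_form p ?E k e .
  define X where "X = (\<lambda>f. {renorm q \<rho> 1 E0 v | v. v \<in> funs (vertices q 1) \<and> restr (q ` letters) v = lift q f})"
  have trace: "Inf (X f) = ?E f" for f
    using fixed_form lift_in_funs[of f] unfolding renorm_fixed_def form_trace_def X_def by blast
  have energy_nonneg: "0 \<le> renorm q \<rho> 1 E0 v" for v
    unfolding renorm_1_eq using rho by (intro mult_nonneg_nonneg sum_nonneg nonneg) auto
  have realize: "\<rho> * (\<Sum>i\<in>letters. ?E (A i)) \<in> X (\<lambda>i. A i i)"
    if sym: "\<And>i j. i \<in> letters \<Longrightarrow> j \<in> letters \<Longrightarrow> A i j = A j i" for A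
  proof -
    obtain v where v: "v \<in> funs (vertices q 1)" "\<forall>i\<in>letters. \<forall>j\<in>letters. v (contr q i (q j)) = A i j"
      using matrix_realization[of A, OF sym] by blast
    have "lift q (\<lambda>j. v (contr q i (q j))) = lift q (A i)" if "i \<in> letters" for i
      by (rule lift_cong) (use v(2) that in blast)
    then have "renorm q \<rho> 1 E0 v = \<rho> * (\<Sum>i\<in>letters. ?E (A i))"
      unfolding renorm_1_eq by (simp del: sum.insert sum.insert_if)
    moreover have "restr (q ` letters) v = lift q (\<lambda>i. A i i)"
      unfolding restr_vertices_eq_lift
    proof (rule lift_cong)
      fix i assume i: "i \<in> letters"
      then have "v (contr q i (q i)) = A i i" using v(2) by blast
      then show "v (q i) = A i i" by simp
    qed
    ultimately show ?thesis unfolding X_def using v(1) by (intro CollectI exI[of _ v]) simp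
  qed
  have bdd: "bdd_below (X f)" for f
    unfolding bdd_below_def X_def using energy_nonneg by blast
  have "gasket_form q K p ?E k e \<rho>"
  proof (unfold_locales)
    show "0 < \<rho>" by (rule rho)
    show "?E (\<lambda>i. A i i) \<le> \<rho> * (\<Sum>i\<in>letters. ?E (A i))"
      if "\<And>i j. i \<in> letters \<Longrightarrow> j \<in> letters \<Longrightarrow> A i j = A j i" for A
    proof -
      have "Inf (X (\<lambda>i. A i i)) \<le> \<rho> * (\<Sum>i\<in>letters. ?E (A i))"
        by (rule cInf_lower[OF realize bdd]) (rule that)
      then show ?thesis by (simp only: trace)
    qed
    show "\<exists>A. (\<forall>i\<in>letters. \<forall>j\<in>letters. A i j = A j i) \<and> (\<forall>i\<in>letters. A i i = f i) \<and>
        \<rho> * (\<Sum>i\<in>letters. ?E (A i)) \<le> ?E f + e" if e: "0 < e" for e f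
    proof -
      \<comment> \<open>A diagonal matrix shows \<open>X f\<close> to be nonempty, so that elements
        of \<open>X f\<close> come arbitrarily close to its infimum.\<close>
      have "\<rho> * (\<Sum>i\<in>letters. ?E (\<lambda>j. if i = j then f i else 0)) \<in> X (\<lambda>i. if i = i then f i else 0)"
        by (rule realize) auto
      then have "X f \<noteq> {}" by (simp only: if_True simp_thms) blast
      moreover have "Inf (X f) < ?E f + e" using e by (simp add: trace)
      ultimately obtain y where y: "y \<in> X f" "y < ?E f + e" using cInf_lessD by blast
      then obtain v where v: "restr (q ` letters) v = lift q f" "y = renorm q \<rho> 1 E0 v"
        unfolding X_def by blast
      have diag: "v (q i) = f i" if i: "i \<in> letters" for i
        using fun_cong[OF v(1), of "q i"] by (simp only: lift_vertex[OF i] restr_def imageI[OF i] if_True)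
      show ?thesis
      proof (intro exI[of _ "\<lambda>i j. v (contr q i (q j))"] conjI ballI)
        show "v (contr q i (q j)) = v (contr q j (q i))" for i j by (simp only: contr_vertex_commute)
        show "v (contr q i (q i)) = f i" if "i \<in> letters" for i by (simp only: contr_self diag[OF that])
        show "\<rho> * (\<Sum>i\<in>letters. ?E (\<lambda>j. v (contr q i (q j)))) \<le> ?E f + e"
          using y(2) v(2) unfolding renorm_1_eq by linarith
      qed
    qed
    show "\<exists>C. \<forall>f. \<forall>i\<in>letters. \<forall>j\<in>letters. \<bar>f i - f j\<bar> powr p \<le> C * ?E f"
      by (rule oscillation_bound[OF p form])
  qed
  then show ?thesis by blast
qed

end

text \<open>A competitor, set to zero off \<open>K\<close>, contributes its energy to the set whose
  infimum is \<open>En u\<close>; nonnegativity of energies bounds this set below.\<close>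

lemma (in gasket_form) harmonic_off_minimizer:
  assumes u: "u \<in> harmonic_off (funs K \<inter> fdom) En (K - U)"
  shows "minimizer U u"
  unfolding minimizer_def
proof (intro conjI ballI impI)
  show "u \<in> fdom" using u by (simp add: harmonic_off_def)
  fix w assume w: "w \<in> fdom" "\<forall>x\<in>K - U. w x = u x"
  let ?w = "restr K w" and ?X = "{En v | v. v \<in> funs K \<inter> fdom \<and> restr (K - U) v = restr (K - U) u}"
  have wK: "?w x = w x" if "x \<in> K" for x using that by (simp add: restr_def)
  have "?w \<in> fdom" "En ?w = En w" using En_cong[of ?w w, OF wK] w(1) by blast+
  moreover have "?w \<in> funs K" by (simp add: funs_def restr_def)
  moreover have "restr (K - U) ?w = restr (K - U) u" using w(2) by (auto simp: restr_def)
  ultimately have "En w \<in> ?X" by (intro CollectI exI[of _ ?w]) simp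
  moreover have "bdd_below ?X"
    unfolding bdd_below_def using energy_le_En energy_nonneg by (intro exI[of _ 0]) (force intro: order_trans)
  ultimately have "Inf ?X \<le> En w" by (rule cInf_lower)
  then show "En u \<le> En w" using u by (simp add: harmonic_off_def)
qed

theorem theorem3p18:
  fixes p \<rho> :: real
    and q :: "nat \<Rightarrow> real^2"
    and K U :: "(real^2) set"
    and E0 :: "(real^2 \<Rightarrow> real) \<Rightarrow> real"
    and u v :: "real^2 \<Rightarrow> real"
  assumes p: "1 < p"
    and triangle: "equilateral q"
    and gasket: "is_gasket q K"
    and rho: "0 < \<rho>"
    and form: "p_resistance_form p (q ` letters) (funs (q ` letters)) E0"
    and fixed_form: "renorm_fixed q \<rho> E0"
    and invariant: "sym_invariant q K E0"
    and U_open: "openin (top_of_set K) U"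
    and U_connected: "connected U"
    and U_proper: "U \<noteq> K"
    and u: "u \<in> harmonic_off (canonical_domain q K \<rho> E0) (canonical_energy q \<rho> E0) (K - U)"
    and v: "v \<in> harmonic_off (canonical_domain q K \<rho> E0) (canonical_energy q \<rho> E0) (K - U)"
    and boundary: "\<And>x. x \<in> (top_of_set K) frontier_of U \<Longrightarrow> u x \<le> v x"
  shows "(\<forall>x\<in>U. u x < v x) \<or> (\<forall>x \<in> (top_of_set K) closure_of U. u x = v x)"
proof -
  interpret gasket q K by unfold_locales (rule triangle gasket)+
  from canonical_gasket_form[OF p rho form fixed_form]
  obtain \<kappa> \<epsilon> where "gasket_form q K p (\<lambda>f. E0 (lift q f)) \<kappa> \<epsilon> \<rho>" by blast
  then interpret gasket_form q K p "\<lambda>f. E0 (lift q f)" \<kappa> \<epsilon> \<rho> .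
  have level: "level_energy q \<rho> E0 w = energy w" for w
    by (rule HOL.ext) (simp only: level_energy_eq energy_def cell_def)
  have domain: "canonical_domain q K \<rho> E0 = funs K \<inter> fdom"
    by (auto simp: canonical_domain_def fdom_def level)
  have lim: "canonical_energy q \<rho> E0 = En"
    by (rule HOL.ext) (simp only: canonical_energy_def En_def level)
  note mu = harmonic_off_minimizer[OF u[unfolded domain lim]]
  note mv = harmonic_off_minimizer[OF v[unfolded domain lim]]
  have "(\<forall>x\<in>U. u x < v x) \<or> (\<forall>x\<in>U. u x = v x)"
    by (rule strong_comparison[OF U_open U_connected U_proper mu mv boundary])
  then show ?thesis
  proof (elim disjE)
    assume eq: "\<forall>x\<in>U. u x = v x"
    have "continuous_on K (\<lambda>x. u x - v x)"
      using minimizer_continuous[OF mu] minimizer_continuous[OF mv] by (rule continuous_on_diff)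
    \<comment> \<open>The coincidence set is closed in \<open>K\<close>, hence contains the closure
      along with \<open>U\<close>.\<close>
    then have "closedin (top_of_set K) {x \<in> K. u x - v x = 0}"
      by (rule continuous_closedin_preimage_constant)
    moreover have "U \<subseteq> {x \<in> K. u x - v x = 0}"
      using eq openin_imp_subset[OF U_open] by auto
    ultimately have "(top_of_set K) closure_of U \<subseteq> {x \<in> K. u x - v x = 0}"
      by (intro closure_of_minimal)
    then show ?thesis by auto
  qed blast
qed

end
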